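(* Let $S$ be a semidiscrete semigroup generated by a finite collection $\mathcal{F}$ of Möbius transformations. Suppose that $|\Lambda^-(S)|\neq 1$. Then the following statements are equivalent: (i) every composition sequence generated by $\mathcal{F}$ that is an escaping sequence converges ideally; (ii) $S$ is not a cocompact Fuchsian group.
   Context: $\mathbb{H}$ is the upper half-plane and $\overline{\mathbb{R}}=\mathbb{R}\cup\{\infty\}$ its ideal boundary in $\overline{\mathbb{C}}$ (with the chordal metric). "Möbius transformation" means $z\mapsto (az+b)/(cz+d)$ with $a,b,c,d\in\mathbb{R}$, $ad-bc>0$; these form the topological group $\mathcal{M}\cong\mathrm{PSL}(2,\mathbb{R})$ with identity $I$. A semigroup is a nonempty subset of $\mathcal{M}$ closed under composition; the semigroup generated by $\mathcal{F}$ is the set of all finite compositions of elements of $\mathcal{F}$. $S$ is semidiscrete if $I$ is not an accumulation point of $S$ in $\mathcal{M}$. A composition sequence generated by $\mathcal{F}$ is a sequence $F_n=f_1f_2\dotsb f_n$, $n=1,2,\dotsc$, with $f_i\in\mathcal{F}$. A sequence $(F_n)$ in $\mathcal{M}$ is an escaping sequence if for some (equivalently, every) $w\in\mathbb{H}$ the orbit $(F_n(w))$ has no accumulation point in $\mathbb{H}$ (no subsequence converges to a point of $\mathbb{H}$). An escaping sequence converges ideally if there is $p\in\overline{\mathbb{R}}$ such that $F_n(w)\to p$ in the chordal metric for some (equivalently, every) $w\in\mathbb{H}$. The forward limit set $\Lambda^+(S)$ is the set of accumulation points in $\overline{\mathbb{R}}$ of $\{g(w):g\in S\}$, where $w\in\mathbb{H}$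 (independent of $w$), and the backward limit set is $\Lambda^-(S)=\Lambda^+(S^{-1})$ with $S^{-1}=\{g^{-1}:g\in S\}$. A Fuchsian group is a discrete subgroup $G$ of $\mathcal{M}$; it is cocompact if the quotient space $\mathbb{H}/G$ is compact. *)

theory Defs
  imports "HOL-Analysis.Analysis" "HOL-Algebra.Group"
begin

section \<open>The Riemann sphere with the chordal metric\<close>

text \<open>
  The extended complex plane is the type \<open>complex option\<close>; \<^const>\<open>None\<close> is the point at infinity.
\<close>

fun chordal :: "complex option \<Rightarrow> complex option \<Rightarrow> real" where
  "chordal (Some z) (Some w) = 2 * cmod (z - w) / (sqrt (1 + (cmod z)\<^sup>2) * sqrt (1 + (cmod w)\<^sup>2))"
| "chordal (Some z) None = 2 / sqrt (1 + (cmod z)\<^sup>2)"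
| "chordal None (Some w) = 2 / sqrt (1 + (cmod w)\<^sup>2)"
| "chordal None None = 0"

definition sphere_topology :: "complex option topology" where
  "sphere_topology = Metric_space.mtopology UNIV chordal"

text \<open>
  The chordal distance is the Euclidean distance between stereographic projections; the metric
  axioms follow from this.
\<close>

fun stereographic :: "complex option \<Rightarrow> complex \<times> real" where
  "stereographic (Some z) =
     (2 * z / of_real (1 + (cmod z)\<^sup>2), ((cmod z)\<^sup>2 - 1) / (1 + (cmod z)\<^sup>2))"
| "stereographic None = (0, 1)"

lemma chordal_eq_dist_stereographic:
  "chordal p q = dist (stereographic p) (stereographic q)"
proof -
  have pos: "1 + (cmod z)\<^sup>2 > 0" for z
    by (simp add: add_pos_nonneg)
  have inf: "dist (stereographic (Some z)) (stereographic None) = 2 / sqrt (1 + (cmod z)\<^sup>2)" for z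
  proof -
    define A where "A = 1 + (cmod z)\<^sup>2"
    have A: "A > 0" "(cmod z)\<^sup>2 = A - 1"
      using pos[of z] by (auto simp: A_def)
    have "(dist (stereographic (Some z)) (stereographic None))\<^sup>2
        = (2 * cmod z / A)\<^sup>2 + ((A - 2) / A - 1)\<^sup>2"
      using A(1) by (simp add: dist_prod_def dist_norm norm_divide norm_mult A_def[symmetric]
          A(2) power2_commute[of 1] del: of_real_add)
    also have "\<dots> = 4 * (A - 1) / A\<^sup>2 + 4 / A\<^sup>2"
      using A(1) by (simp add: power_mult_distrib power_divide A(2))
        (simp add: field_simps power2_eq_square)
    also have "\<dots> = (2 / sqrt A)\<^sup>2"
      using A(1) by (simp add: power_divide field_simps power2_eq_square)
    finally show ?thesis
      using A(1) by (metis A_def power2_eq_iff_nonneg zero_le_dist divide_nonneg_nonneg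
          real_sqrt_ge_zero less_imp_le zero_le_numeral)
  qed
  have fin: "dist (stereographic (Some z)) (stereographic (Some w)) = chordal (Some z) (Some w)" for z w
  proof -
    define A where "A = 1 + (cmod z)\<^sup>2"
    define B where "B = 1 + (cmod w)\<^sup>2"
    have A: "A > 0" and B: "B > 0"
      using pos by (auto simp: A_def B_def)
    have A': "(Re z)\<^sup>2 = A - 1 - (Im z)\<^sup>2" and B': "(Re w)\<^sup>2 = B - 1 - (Im w)\<^sup>2"
      by (simp_all add: A_def B_def cmod_power2)
    have "(dist (stereographic (Some z)) (stereographic (Some w)))\<^sup>2
        = (cmod (2 * z / of_real A - 2 * w / of_real B))\<^sup>2 + ((A - 2) / A - (B - 2) / B)\<^sup>2"
      by (simp add: dist_prod_def dist_norm A_def B_def)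
    also have "\<dots> = (2 * Re z / A - 2 * Re w / B)\<^sup>2 + (2 * Im z / A - 2 * Im w / B)\<^sup>2
        + ((A - 2) / A - (B - 2) / B)\<^sup>2"
      by (simp add: cmod_power2)
    also have "\<dots> = 4 * ((Re z)\<^sup>2 + (Im z)\<^sup>2 + 1) / A\<^sup>2 + 4 * ((Re w)\<^sup>2 + (Im w)\<^sup>2 + 1) / B\<^sup>2
        - 8 * (Re z * Re w + Im z * Im w + 1) / (A * B)"
      using A B by (simp add: field_simps power2_eq_square)
    also have "\<dots> = 4 / A + 4 / B - 8 * (Re z * Re w + Im z * Im w + 1) / (A * B)"
      unfolding A' B' using A B by (simp add: power2_eq_square)
    also have "\<dots> = 4 * (A + B - 2 - 2 * (Re z * Re w + Im z * Im w)) / (A * B)"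
      using A B by (simp add: field_simps)
    also have "A + B - 2 - 2 * (Re z * Re w + Im z * Im w) = (cmod (z - w))\<^sup>2"
      unfolding A_def B_def cmod_power2 by (simp add: power2_eq_square algebra_simps)
    also have "4 * (cmod (z - w))\<^sup>2 / (A * B) = (chordal (Some z) (Some w))\<^sup>2"
      using A B by (simp add: A_def[symmetric] B_def[symmetric] power_divide power_mult_distrib)
    finally show ?thesis
      using A B by (subst (asm) power2_eq_iff_nonneg) auto
  qed
  show ?thesis
    by (cases p; cases q) (use inf fin in \<open>simp_all add: dist_commute del: stereographic.simps\<close>)
qed

lemma Metric_space_chordal: "Metric_space UNIV chordal"
proof
  fix p q r :: "complex option"
  show "0 \<le> chordal p q" "chordal p q = chordal q p" "chordal p r \<le> chordal p q + chordal q r"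
    by (simp_all add: chordal_eq_dist_stereographic dist_commute dist_triangle)
  have pos: "1 + (cmod z)\<^sup>2 > 0" for z
    by (simp add: add_pos_nonneg)
  then have "1 + (cmod z)\<^sup>2 \<noteq> 0" for z
    by (metis less_irrefl)
  then show "chordal p q = 0 \<longleftrightarrow> p = q"
    by (cases p; cases q) auto
qed

definition upper_half_plane :: "complex option set" where
  "upper_half_plane = Some ` {z. Im z > 0}"

definition ideal_boundary :: "complex option set" where
  "ideal_boundary = insert None (Some ` \<real>)"


section \<open>Quotient topologies\<close>

text \<open>The finest topology on \<open>f ` topspace X\<close> that makes \<open>f\<close> continuous.\<close>

definition quotient_topology :: "'a topology \<Rightarrow> ('a \<Rightarrow> 'b) \<Rightarrow> 'b topology" where
  "quotient_topology X f =
     topology (\<lambda>U. U \<subseteq> f ` topspace X \<and> openin X {x \<in> topspace X. f x \<in> U})"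

lemma openin_quotient_topology:
  "openin (quotient_topology X f) U \<longleftrightarrow>
     U \<subseteq> f ` topspace X \<and> openin X {x \<in> topspace X. f x \<in> U}"
proof -
  have "istopology (\<lambda>U. U \<subseteq> f ` topspace X \<and> openin X {x \<in> topspace X. f x \<in> U})"
    unfolding istopology_def
  proof (intro conjI allI impI)
    fix S T
    assume S: "S \<subseteq> f ` topspace X \<and> openin X {x \<in> topspace X. f x \<in> S}"
      and T: "T \<subseteq> f ` topspace X \<and> openin X {x \<in> topspace X. f x \<in> T}"
    have "{x \<in> topspace X. f x \<in> S \<inter> T} = {x \<in> topspace X. f x \<in> S} \<inter> {x \<in> topspace X. f x \<in> T}"
      by auto
    then show "openin X {x \<in> topspace X. f x \<in> S \<inter> T}"
      using S T by auto
    show "S \<inter> T \<subseteq> f ` topspace X"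
      using S by auto
  next
    fix K
    assume K: "\<forall>U\<in>K. U \<subseteq> f ` topspace X \<and> openin X {x \<in> topspace X. f x \<in> U}"
    have "{x \<in> topspace X. f x \<in> \<Union>K} = (\<Union>U\<in>K. {x \<in> topspace X. f x \<in> U})"
      by auto
    then show "openin X {x \<in> topspace X. f x \<in> \<Union>K}"
      using K by auto
    show "\<Union>K \<subseteq> f ` topspace X"
      using K by auto
  qed
  then show ?thesis
    by (simp add: quotient_topology_def)
qed

lemma topspace_quotient_topology: "topspace (quotient_topology X f) = f ` topspace X"
proof
  show "topspace (quotient_topology X f) \<subseteq> f ` topspace X"
    using openin_topspace[of "quotient_topology X f"] by (simp only: openin_quotient_topology)
  have "{x \<in> topspace X. f x \<in> f ` topspace X} = topspace X"
    by auto
  then have "openin (quotient_topology X f) (f ` topspace X)"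
    by (simp add: openin_quotient_topology)
  then show "f ` topspace X \<subseteq> topspace (quotient_topology X f)"
    by (rule openin_subset)
qed

lemma quotient_map_quotient_topology: "quotient_map X (quotient_topology X f) f"
  by (auto simp: quotient_map_def topspace_quotient_topology openin_quotient_topology)


section \<open>The topological group of Moebius transformations\<close>

type_synonym moebius = "complex option \<Rightarrow> complex option"

fun moebius_map :: "real \<times> real \<times> real \<times> real \<Rightarrow> moebius" where
  "moebius_map (a, b, c, d) None = (if c = 0 then None else Some (of_real (a / c)))"
| "moebius_map (a, b, c, d) (Some z) =
     (if of_real c * z + of_real d = 0 then None
      else Some ((of_real a * z + of_real b) / (of_real c * z + of_real d)))"

definition moebius_coeffs :: "(real \<times> real \<times> real \<times> real) set" where
  "moebius_coeffs = {(a, b, c, d). a * d - b * c > 0}"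

definition moebius_group :: "moebius monoid" where
  "moebius_group = \<lparr>carrier = moebius_map ` moebius_coeffs, mult = (\<circ>), one = id\<rparr>"

text \<open>
  Coefficient quadruples have the same image exactly if they are proportional, so this is the
  quotient topology of \<open>GL\<^sup>+(2,\<real>)\<close> modulo scalars, that is, the topology of \<open>PSL(2,\<real>)\<close>.
\<close>

definition moebius_topology :: "moebius topology" where
  "moebius_topology = quotient_topology (top_of_set moebius_coeffs) moebius_map"

lemma topspace_moebius_topology: "topspace moebius_topology = carrier moebius_group"
  by (simp add: moebius_topology_def topspace_quotient_topology moebius_group_def)

lemma moebius_map_comp:
  fixes a b c d a' b' c' d' :: real
  assumes "a * d - b * c \<noteq> 0" "a' * d' - b' * c' \<noteq> 0"
  shows "moebius_map (a, b, c, d) \<circ> moebius_map (a', b', c', d') =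
         moebius_map (a * a' + b * c', a * b' + b * d', c * a' + d * c', c * b' + d * d')"
proof
  fix p
  let ?C = "of_real :: real \<Rightarrow> complex"
  have det: "?C a * ?C d - ?C b * ?C c \<noteq> 0" "?C a' * ?C d' - ?C b' * ?C c' \<noteq> 0"
    using assms by (simp_all flip: of_real_mult of_real_diff)
  show "(moebius_map (a, b, c, d) \<circ> moebius_map (a', b', c', d')) p =
        moebius_map (a * a' + b * c', a * b' + b * d', c * a' + d * c', c * b' + d * d') p"
  proof (cases p)
    case None
    show ?thesis
    proof (cases "c' = 0")
      case True
      then have "a' \<noteq> 0"
        using assms by auto
      then show ?thesis
        using None True by simp
    next
      case False
      have "?C c * (?C a' / ?C c') + ?C d = ?C (c * a' + d * c') / ?C c'"
        "?C a * (?C a' / ?C c') + ?C b = ?C (a * a' + b * c') / ?C c'"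
        using False by (simp_all add: field_simps)
      then show ?thesis
        using None False by (simp del: of_real_add of_real_mult)
    qed
  next
    case (Some z)
    define n where "n = ?C a' * z + ?C b'"
    define m where "m = ?C c' * z + ?C d'"
    have N: "?C (a * a' + b * c') * z + ?C (a * b' + b * d') = ?C a * n + ?C b * m"
      and M: "?C (c * a' + d * c') * z + ?C (c * b' + d * d') = ?C c * n + ?C d * m"
      by (simp_all add: n_def m_def algebra_simps)
    show ?thesis
    proof (cases "m = 0")
      case True
      have "?C a' * m - ?C c' * n = ?C a' * ?C d' - ?C b' * ?C c'"
        by (simp add: n_def m_def algebra_simps)
      then have "n \<noteq> 0"
        using det True by auto
      then show ?thesis
        using Some True N M n_def m_def by simp
    next
      case False
      have "?C c * (n / m) + ?C d = (?C c * n + ?C d * m) / m"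
        "?C a * (n / m) + ?C b = (?C a * n + ?C b * m) / m"
        using False by (simp_all add: field_simps)
      then show ?thesis
        using Some False N M by (simp add: n_def[symmetric] m_def[symmetric] del: of_real_add of_real_mult)
    qed
  qed
qed

lemma moebius_map_id: "t \<noteq> 0 \<Longrightarrow> moebius_map (t, 0, 0, t) = id"
proof
  show "t \<noteq> 0 \<Longrightarrow> moebius_map (t, 0, 0, t) p = id p" for p
    by (cases p) auto
qed

lemma group_moebius_group: "group moebius_group"
proof (rule groupI)
  show "\<one>\<^bsub>moebius_group\<^esub> \<in> carrier moebius_group"
    using moebius_map_id[of 1] image_eqI[of id moebius_map "(1, 0, 0, 1)" moebius_coeffs]
    by (simp add: moebius_group_def moebius_coeffs_def)
next
  fix f g
  assume "f \<in> carrier moebius_group" "g \<in> carrier moebius_group"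
  then obtain a b c d a' b' c' d' where *: "f = moebius_map (a, b, c, d)" "a * d - b * c > 0"
    "g = moebius_map (a', b', c', d')" "a' * d' - b' * c' > 0"
    by (auto simp: moebius_group_def moebius_coeffs_def)
  have "(a * a' + b * c') * (c * b' + d * d') - (a * b' + b * d') * (c * a' + d * c')
      = (a * d - b * c) * (a' * d' - b' * c')"
    by (simp add: algebra_simps)
  then have "(a * a' + b * c') * (c * b' + d * d') - (a * b' + b * d') * (c * a' + d * c') > 0"
    using * by simp
  moreover have "f \<circ> g =
      moebius_map (a * a' + b * c', a * b' + b * d', c * a' + d * c', c * b' + d * d')"
    using * moebius_map_comp[of a d b c a' d' b' c'] by simp
  ultimately show "f \<otimes>\<^bsub>moebius_group\<^esub> g \<in> carrier moebius_group"
    by (auto simp: moebius_group_def moebius_coeffs_def simp del: moebius_map.simps)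
next
  fix f
  assume "f \<in> carrier moebius_group"
  then obtain a b c d where *: "f = moebius_map (a, b, c, d)" "a * d - b * c > 0"
    by (auto simp: moebius_group_def moebius_coeffs_def)
  have "moebius_map (d, - b, - c, a) \<circ> f = moebius_map (a * d - b * c, 0, 0, a * d - b * c)"
    using * moebius_map_comp[of d a "- b" "- c" a d b c] by (simp add: mult.commute)
  then have "moebius_map (d, - b, - c, a) \<circ> f = id"
    using * moebius_map_id[of "a * d - b * c"] by simp
  moreover have "(d, - b, - c, a) \<in> moebius_coeffs"
    using * by (simp add: moebius_coeffs_def mult.commute)
  ultimately show "\<exists>g\<in>carrier moebius_group. g \<otimes>\<^bsub>moebius_group\<^esub> f = \<one>\<^bsub>moebius_group\<^esub>"
    by (auto simp: moebius_group_def)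
qed (auto simp: moebius_group_def)


section \<open>Semigroups, limit sets and composition sequences\<close>

inductive_set semigroup_generated :: "moebius set \<Rightarrow> moebius set" for F :: "moebius set" where
  generator: "f \<in> F \<Longrightarrow> f \<in> semigroup_generated F"
| comp: "g \<in> semigroup_generated F \<Longrightarrow> h \<in> semigroup_generated F \<Longrightarrow>
     g \<circ> h \<in> semigroup_generated F"

definition moebius_semigroup :: "moebius set \<Rightarrow> bool" where
  "moebius_semigroup S \<longleftrightarrow>
     S \<noteq> {} \<and> S \<subseteq> carrier moebius_group \<and> (\<forall>g\<in>S. \<forall>h\<in>S. g \<circ> h \<in> S)"

lemma moebius_semigroup_generated:
  assumes "F \<subseteq> carrier moebius_group" "F \<noteq> {}"
  shows "moebius_semigroup (semigroup_generated F)"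
proof -
  interpret group moebius_group
    by (rule group_moebius_group)
  have "g \<in> carrier moebius_group" if "g \<in> semigroup_generated F" for g
    using that
  proof induction
    case (generator f)
    then show ?case
      using assms(1) by auto
  next
    case (comp g h)
    then show ?case
      using m_closed[of g h] by (simp add: moebius_group_def comp_def)
  qed
  then show ?thesis
    using assms(2) by (auto simp: moebius_semigroup_def intro: semigroup_generated.intros)
qed

definition semidiscrete :: "moebius set \<Rightarrow> bool" where
  "semidiscrete S \<longleftrightarrow> id \<notin> moebius_topology derived_set_of S"

text \<open>
  In the definitions below the base point \<open>w\<close> may be any point of the upper half-plane: the
  notions do not depend on it.
\<close>

definition forward_limit_set :: "moebius set \<Rightarrow> complex option set" where
  "forward_limit_set S =
     {p \<in> ideal_boundary. \<exists>w\<in>upper_half_plane. p \<in> sphere_topology derived_set_of {g w |g. g \<in> S}}"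

definition backward_limit_set :: "moebius set \<Rightarrow> complex option set" where
  "backward_limit_set S = forward_limit_set {inv\<^bsub>moebius_group\<^esub> g |g. g \<in> S}"

text \<open>Sequences are indexed from \<open>0\<close>, so \<open>X n = f 0 \<circ> \<dots> \<circ> f n\<close>.\<close>

definition composition_sequence :: "moebius set \<Rightarrow> (nat \<Rightarrow> moebius) \<Rightarrow> bool" where
  "composition_sequence F X \<longleftrightarrow>
     (\<exists>f. (\<forall>n. f n \<in> F) \<and> X 0 = f 0 \<and> (\<forall>n. X (Suc n) = X n \<circ> f (Suc n)))"

definition escaping_sequence :: "(nat \<Rightarrow> moebius) \<Rightarrow> bool" where
  "escaping_sequence X \<longleftrightarrow>
     range X \<subseteq> carrier moebius_group \<and>
     (\<exists>w\<in>upper_half_plane.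
        \<not> (\<exists>r :: nat \<Rightarrow> nat. \<exists>p\<in>upper_half_plane.
             strict_mono r \<and> limitin sphere_topology (\<lambda>n. X (r n) w) p sequentially))"

definition converges_ideally :: "(nat \<Rightarrow> moebius) \<Rightarrow> bool" where
  "converges_ideally X \<longleftrightarrow>
     (\<exists>p\<in>ideal_boundary. \<exists>w\<in>upper_half_plane.
        limitin sphere_topology (\<lambda>n. X n w) p sequentially)"


section \<open>Cocompact Fuchsian groups\<close>

definition fuchsian_group :: "moebius set \<Rightarrow> bool" where
  "fuchsian_group G \<longleftrightarrow>
     subgroup G moebius_group \<and> subtopology moebius_topology G = discrete_topology G"

definition orbit :: "moebius set \<Rightarrow> complex option \<Rightarrow> complex option set" where
  "orbit G z = {g z |g. g \<in> G}"

definition orbit_space :: "moebius set \<Rightarrow> complex option set topology" where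
  "orbit_space G = quotient_topology (subtopology sphere_topology upper_half_plane) (orbit G)"

definition cocompact_fuchsian_group :: "moebius set \<Rightarrow> bool" where
  "cocompact_fuchsian_group G \<longleftrightarrow> fuchsian_group G \<and> compact_space (orbit_space G)"

end

theory Submission
  imports Defs
begin

text \<open>
  A Moebius transformation is represented by a real matrix \<open>A\<close> of determinant 1, the point \<open>A \<i>\<close> of the
  half-plane by the positive definite form \<open>v \<mapsto> |A\<inverse> v|\<^sup>2\<close>, and an ideal point by a vector \<open>v\<close> up to scaling;
  then \<open>|A\<inverse> v|\<close> measures the horoball at \<open>v\<close> with \<open>A \<i>\<close> on its boundary, and the chordal distance from \<open>A \<i>\<close>
  to \<open>v\<close> is \<open>2 |A\<inverse> v| / (|A| |v|)\<close>.

  Suppose that an escaping composition sequence \<open>F\<^sub>n\<close> has two limit points. Its steps have bounded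
  length, so it crosses infinitely often, at bounded distance, every geodesic that separates them; hence it
  visits arbitrarily small horoballs at all points of one of the two arcs between them. Pulling back by
  \<open>F\<^sub>m\<close>, whose preimages of the arc exhaust the circle except for at most one point \<open>q\<close>, one sees that \<open>S\<close>
  visits arbitrarily small horoballs at every ideal point other than \<open>q\<close>. If \<open>q\<close> is really exceptional, then
  it is fixed by \<open>S\<close> and is the only point of \<open>\<Lambda>\<^sup>-(S)\<close>. Otherwise, by compactness, every orbit of \<open>S\<close> is
  coarsely dense in the half-plane; a recurrence argument then produces inverses from semidiscreteness.

  Conversely, in a cocompact group one can follow, at bounded distance, the path
  \<open>sin (ln (n + 1)) + \<i> / (n + 1)\<close>, which has bounded steps and does not converge.
\<close>

section \<open>Two-by-two matrices\<close>

text \<open>The obstacle is that inverses of elements of \<open>S\<close> become available only at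
  the very end of the harder implication, so each step has to move forward along words. Horoballs
  fit this: if \<open>F\<^sub>n\<close> visits a small horoball at \<open>F\<^sub>m z\<close>, then
  the tail \<open>F\<^sub>m\<inverse> F\<^sub>n\<close>, which does lie in \<open>S\<close>, visits
  an equally small one at \<open>z\<close>. The preimages of the arc grow for a metric reason: for
  \<open>x\<close> inside the arc, \<open>|F\<^sub>m\<inverse> x|\<close> becomes small, which makes
  \<open>F\<^sub>m\<close> contract all directions that it sends outside the arc, whereas
  determinant 1 forbids contracting two independent vectors. Coarse density comes from a similar
  rigidity: a large matrix of determinant 1 has almost dependent columns, so an element that halves
  its longer column shrinks the whole matrix. In the converse, the path is chosen so that its
  horizontal speed is comparable to its height; discreteness then leaves only finitely many
  increments between the orbit points that follow it, and this controls the detours made while an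
  increment is spelled out in generators.\<close>

type_synonym mat2 = "real \<times> real \<times> real \<times> real"

fun mdet :: "mat2 \<Rightarrow> real" where
  "mdet (a, b, c, d) = a * d - b * c"

fun mmul :: "mat2 \<Rightarrow> mat2 \<Rightarrow> mat2" where
  "mmul (a, b, c, d) (a', b', c', d') =
     (a * a' + b * c', a * b' + b * d', c * a' + d * c', c * b' + d * d')"

fun madj :: "mat2 \<Rightarrow> mat2" where
  "madj (a, b, c, d) = (d, - b, - c, a)"

definition mone :: mat2 where
  "mone = (1, 0, 0, 1)"

fun mapp :: "mat2 \<Rightarrow> real \<times> real \<Rightarrow> real \<times> real" where
  "mapp (a, b, c, d) (x, y) = (a * x + b * y, c * x + d * y)"

fun wedge :: "real \<times> real \<Rightarrow> real \<times> real \<Rightarrow> real" where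
  "wedge (x, y) (x', y') = x * y' - y * x'"

lemma norm_pair2: "(norm (x :: real, y :: real))\<^sup>2 = x\<^sup>2 + y\<^sup>2"
  by (simp add: norm_prod_def)

text \<open>The product norm on \<open>mat2\<close> is the Frobenius norm. Rotations on either side
  leave it unchanged, so for determinant 1 it depends only on the point \<open>A \<i>\<close>;
  \<open>pt_cases\<close> gives the formula.\<close>

lemma norm_mat2: "(norm ((a, b, c, d) :: mat2))\<^sup>2 = a\<^sup>2 + b\<^sup>2 + c\<^sup>2 + d\<^sup>2"
  by (simp add: norm_prod_def)

lemma mdet_mmul [simp]: "mdet (mmul A B) = mdet A * mdet B"
  by (cases A rule: prod_cases4; cases B rule: prod_cases4) (simp add: algebra_simps)

lemma mdet_madj [simp]: "mdet (madj A) = mdet A"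
  by (cases A rule: prod_cases4) (simp add: algebra_simps)

lemma mdet_mone [simp]: "mdet mone = 1"
  by (simp add: mone_def)

lemma mmul_assoc: "mmul (mmul A B) C = mmul A (mmul B C)"
  by (cases A rule: prod_cases4; cases B rule: prod_cases4; cases C rule: prod_cases4)
    (simp add: algebra_simps)

lemma mmul_mone [simp]: "mmul A mone = A" "mmul mone A = A"
  by (cases A rule: prod_cases4; simp add: mone_def)+

lemma madj_madj [simp]: "madj (madj A) = A"
  by (cases A rule: prod_cases4) simp

lemma madj_mmul: "madj (mmul A B) = mmul (madj B) (madj A)"
  by (cases A rule: prod_cases4; cases B rule: prod_cases4) (simp add: algebra_simps)

lemma mmul_madj [simp]:
  assumes "mdet A = 1"
  shows "mmul A (madj A) = mone" "mmul (madj A) A = mone"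
  using assms by (cases A rule: prod_cases4; simp add: mone_def algebra_simps)+

lemma mmul_madj_cancel [simp]:
  assumes "mdet A = 1"
  shows "mmul A (mmul (madj A) B) = B" "mmul (madj A) (mmul A B) = B"
  using assms by (simp_all flip: mmul_assoc)

lemma mapp_mmul: "mapp (mmul A B) v = mapp A (mapp B v)"
  by (cases A rule: prod_cases4; cases B rule: prod_cases4; cases v) (simp add: algebra_simps)

lemma mapp_mone [simp]: "mapp mone v = v"
  by (cases v) (simp add: mone_def)

lemma mapp_madj_cancel [simp]:
  assumes "mdet A = 1"
  shows "mapp A (mapp (madj A) v) = v" "mapp (madj A) (mapp A v) = v"
  using assms by (simp_all flip: mapp_mmul)

lemma mapp_scaleR: "mapp A (t *\<^sub>R v) = t *\<^sub>R mapp A v" "mapp (t *\<^sub>R A) v = t *\<^sub>R mapp A v"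
  by (cases A rule: prod_cases4; cases v; simp add: algebra_simps)+

lemma mapp_add: "mapp A (v + w) = mapp A v + mapp A w"
  by (cases A rule: prod_cases4; cases v; cases w) (simp add: algebra_simps)

lemma mmul_diff: "mmul A (B - C) = mmul A B - mmul A C"
  by (cases A rule: prod_cases4; cases B rule: prod_cases4; cases C rule: prod_cases4)
    (simp add: algebra_simps)

lemma norm_madj [simp]: "norm (madj A) = norm A"
proof -
  have "(norm (madj A))\<^sup>2 = (norm A)\<^sup>2"
    by (cases A rule: prod_cases4) (simp add: norm_mat2)
  then show ?thesis
    by (metis norm_ge_zero power2_eq_iff_nonneg)
qed

lemma norm_mmul_le: "norm (mmul A B) \<le> norm A * norm B"
proof (rule power2_le_imp_le)
  obtain a b c d a' b' c' d' where AB: "A = (a, b, c, d)" "B = (a', b', c', d')"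
    by (metis prod_cases4)
  \<comment> \<open>Lagrange's identity: the defect is the sum of the squared minors of a row of
    \<open>A\<close> against a column of \<open>B\<close>.\<close>
  have "(norm A * norm B)\<^sup>2 = (norm (mmul A B))\<^sup>2 + (a * c' - b * a')\<^sup>2 + (a * d' - b * b')\<^sup>2
      + (c * c' - d * a')\<^sup>2 + (c * d' - d * b')\<^sup>2"
    unfolding power_mult_distrib AB mmul.simps norm_mat2
    by (simp add: power2_eq_square algebra_simps)
  then show "(norm (mmul A B))\<^sup>2 \<le> (norm A * norm B)\<^sup>2"
    by simp
qed simp

lemma norm_mapp_le: "norm (mapp A v) \<le> norm A * norm v"
proof (rule power2_le_imp_le)
  obtain a b c d x y where AB: "A = (a, b, c, d)" "v = (x, y)"
    by (metis prod_cases4 surj_pair)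
  have "(norm A * norm v)\<^sup>2 = (norm (mapp A v))\<^sup>2 + (a * y - b * x)\<^sup>2 + (c * y - d * x)\<^sup>2"
    unfolding power_mult_distrib AB mapp.simps norm_mat2 norm_pair2
    by (simp add: power2_eq_square algebra_simps)
  then show "(norm (mapp A v))\<^sup>2 \<le> (norm A * norm v)\<^sup>2"
    by simp
qed simp

lemma norm_mapp_ge:
  assumes "mdet A = 1"
  shows "norm v \<le> norm A * norm (mapp A v)"
  using norm_mapp_le[of "madj A" "mapp A v"] assms by simp

lemma mapp_zero [simp]: "mapp A 0 = 0"
  using norm_mapp_le[of A 0] by simp

lemma mapp_eq_0_iff [simp]:
  assumes "mdet A = 1"
  shows "mapp A v = 0 \<longleftrightarrow> v = 0"
  using norm_mapp_ge[OF assms, of v] by auto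

lemma norm_mat2_pos: "mdet A = 1 \<Longrightarrow> norm A > 0"
  by (cases A rule: prod_cases4) (auto simp: zero_prod_def)

lemma wedge_mapp: "wedge (mapp A v) (mapp A w) = mdet A * wedge v w"
  by (cases A rule: prod_cases4; cases v; cases w) (simp add: algebra_simps)

lemma wedge_mapp_left:
  assumes "mdet A = 1"
  shows "wedge (mapp A v) w = wedge v (mapp (madj A) w)"
  using wedge_mapp[of "madj A" "mapp A v" w] assms by simp

lemma inner_wedge: "(inner v w)\<^sup>2 + (wedge v w)\<^sup>2 = (norm v)\<^sup>2 * (norm w)\<^sup>2"
  by (cases v; cases w)
    (simp only: norm_pair2 mapp.simps wedge.simps inner_Pair inner_real_def,
      simp add: power2_eq_square algebra_simps)

lemma abs_wedge_le: "\<bar>wedge v w\<bar> \<le> norm v * norm w"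
proof (rule power2_le_imp_le)
  show "\<bar>wedge v w\<bar>\<^sup>2 \<le> (norm v * norm w)\<^sup>2"
    unfolding power_mult_distrib power2_abs
    using inner_wedge[of v w] zero_le_power2[of "inner v w"] by linarith
qed simp

lemma wedge_scaleR [simp]: "wedge (t *\<^sub>R v) w = t * wedge v w" "wedge v (t *\<^sub>R w) = t * wedge v w"
  by (cases v; cases w; simp add: algebra_simps)+

lemma wedge_zero [simp]: "wedge 0 v = 0" "wedge v 0 = 0"
  using wedge_scaleR(1)[of 0 v v] wedge_scaleR(2)[of v 0 v] by simp_all

lemma wedge_self [simp]: "wedge v v = 0"
  by (cases v) simp

lemma wedge_commute: "wedge v w = - wedge w v"
  by (cases v; cases w) simp

lemma wedge_eq_0_imp_parallel:
  assumes "wedge v w = 0" "v \<noteq> 0"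
  obtains t where "w = t *\<^sub>R v"
proof -
  obtain x y x' y' where vw: "v = (x, y)" "w = (x', y')"
    by (metis surj_pair)
  show ?thesis
  proof (cases "x = 0")
    case True
    then have "w = (y' / y) *\<^sub>R v"
      using assms vw by (auto simp: zero_prod_def)
    then show ?thesis by (rule that)
  next
    case False
    then have "w = (x' / x) *\<^sub>R v"
      using assms vw by (auto simp: field_simps)
    then show ?thesis by (rule that)
  qed
qed

text \<open>Cramer's rule: \<open>wedge v w\<close> times \<open>A\<close> is the difference of the
  rank one maps \<open>z \<mapsto> wedge z w * A v\<close> and
  \<open>z \<mapsto> wedge z v * A w\<close>, which are \<open>B\<close> and \<open>C\<close> below.
  Thus upper bounds at two ideal points confine a point of the half-plane to a compact set.\<close>

lemma norm_mat2_le_basis: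
  "norm A * \<bar>wedge v w\<bar> \<le> norm (mapp A v) * norm w + norm (mapp A w) * norm v"
proof -
  obtain x y x' y' where vw: "v = (x, y)" "w = (x', y')"
    by (metis surj_pair)
  obtain p q p' q' where pq: "mapp A v = (p, q)" "mapp A w = (p', q')"
    by (metis surj_pair)
  define B where "B = ((p * y', - (p * x'), q * y', - (q * x')) :: mat2)"
  define C where "C = ((p' * y, - (p' * x), q' * y, - (q' * x)) :: mat2)"
  have "wedge v w *\<^sub>R A = B - C"
    using pq unfolding B_def C_def unfolding vw
    by (cases A rule: prod_cases4) (auto simp: algebra_simps)
  then have "norm A * \<bar>wedge v w\<bar> = norm (B - C)"
    by (metis mult.commute norm_scaleR real_norm_def)
  also have "\<dots> \<le> norm B + norm C"
    by (rule norm_triangle_ineq4)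
  also have "norm B = norm (mapp A v) * norm w"
  proof -
    have "(norm B)\<^sup>2 = (norm (mapp A v) * norm w)\<^sup>2"
      unfolding power_mult_distrib pq B_def norm_mat2 unfolding vw norm_pair2
      by (simp add: power_mult_distrib algebra_simps)
    then show ?thesis
      by (subst (asm) power2_eq_iff_nonneg) auto
  qed
  also have "norm C = norm (mapp A w) * norm v"
  proof -
    have "(norm C)\<^sup>2 = (norm (mapp A w) * norm v)\<^sup>2"
      unfolding power_mult_distrib pq C_def norm_mat2 unfolding vw norm_pair2
      by (simp add: power_mult_distrib algebra_simps)
    then show ?thesis
      by (subst (asm) power2_eq_iff_nonneg) auto
  qed
  finally show ?thesis .
qed

text \<open>With \<open>J\<close> the quarter turn of \<open>u\<close>, the vector
  \<open>(norm u)\<^sup>2 u'\<close> equals \<open>inner u u' u + wedge u u' J\<close>, and the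
  first term contributes nothing positive. Geometrically, a step of bounded length that crosses a
  geodesic starts close to it.\<close>

lemma inner_mapp_le_if_inner_nonpos:
  assumes neg: "inner u u' \<le> 0"
  shows "inner (mapp A u) (mapp A u') \<le> (norm A)\<^sup>2 * \<bar>wedge u u'\<bar>"
proof (cases "u = 0")
  case False
  obtain x y where u: "u = (x, y)"
    by (metis surj_pair)
  define J where "J = (- y, x)"
  have normJ: "norm J = norm u"
    by (simp add: J_def u norm_prod_def add.commute)
  have "(norm u)\<^sup>2 * inner (mapp A u) (mapp A u') =
      inner u u' * (norm (mapp A u))\<^sup>2 + wedge u u' * inner (mapp A u) (mapp A J)"
    unfolding J_def u
    by (cases A rule: prod_cases4; cases u')
    (simp only: norm_pair2 mapp.simps wedge.simps inner_Pair inner_real_def,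
      simp add: power2_eq_square algebra_simps)
  also have "\<dots> \<le> wedge u u' * inner (mapp A u) (mapp A J)"
    using neg by (simp add: mult_nonpos_nonneg)
  also have "\<dots> \<le> \<bar>wedge u u'\<bar> * \<bar>inner (mapp A u) (mapp A J)\<bar>"
    by (metis abs_ge_self abs_mult)
  also have "\<dots> \<le> \<bar>wedge u u'\<bar> * ((norm A * norm u) * (norm A * norm u))"
  proof (intro mult_left_mono)
    have "\<bar>inner (mapp A u) (mapp A J)\<bar> \<le> norm (mapp A u) * norm (mapp A J)"
      by (rule Cauchy_Schwarz_ineq2)
    also have "\<dots> \<le> (norm A * norm u) * (norm A * norm u)"
      using norm_mapp_le[of A u] norm_mapp_le[of A J] normJ by (intro mult_mono) auto
    finally show "\<bar>inner (mapp A u) (mapp A J)\<bar> \<le> (norm A * norm u) * (norm A * norm u)" .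
  qed simp
  also have "\<dots> = (norm u)\<^sup>2 * ((norm A)\<^sup>2 * \<bar>wedge u u'\<bar>)"
    by (simp add: power2_eq_square)
  finally show ?thesis
    using False by simp
qed simp

text \<open>Both rows are orthogonal to the unit kernel vector \<open>a\<close>, so
  \<open>A v\<close> is \<open>wedge v a\<close> times a fixed vector. That vector has length 1
  because \<open>A\<close> has, and it cancels from inner products.\<close>

lemma singular_mat2_decomp:
  assumes "mdet A = 0" "norm A = 1"
  obtains a where "norm a = 1" "mapp A a = 0"
    "\<And>v w. inner (mapp A v) (mapp A w) = wedge v a * wedge w a"
proof -
  obtain p q r s where A: "A = (p, q, r, s)"
    by (metis prod_cases4)
  have det: "p * s = q * r"
    using assms(1) A by simp
  have one: "p\<^sup>2 + q\<^sup>2 + r\<^sup>2 + s\<^sup>2 = 1"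
    using norm_mat2[of p q r s] assms(2) A by simp
  obtain x y where xy: "p * x + q * y = 0" "r * x + s * y = 0" "x\<^sup>2 + y\<^sup>2 = 1"
  proof (cases "p = 0 \<and> q = 0")
    case True
    then show ?thesis
      using one by (intro that[of "- s" r]) (auto simp: algebra_simps)
  next
    case False
    define n where "n = sqrt (p\<^sup>2 + q\<^sup>2)"
    have n: "n > 0" "n\<^sup>2 = p\<^sup>2 + q\<^sup>2"
      using False by (auto simp: n_def sum_power2_gt_zero_iff)
    show ?thesis
    proof (rule that[of "- q / n" "p / n"])
      show "p * (- q / n) + q * (p / n) = 0" by simp
      show "r * (- q / n) + s * (p / n) = 0"
        using det n by (simp add: field_simps)
      have "(- q / n)\<^sup>2 + (p / n)\<^sup>2 = n\<^sup>2 / n\<^sup>2"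
        unfolding n(2) add_divide_distrib by (simp add: power_divide n(2))
      then show "(- q / n)\<^sup>2 + (p / n)\<^sup>2 = 1"
        using n(1) by simp
    qed
  qed
  have row1: "p = (p * y - q * x) * y" "q = - (p * y - q * x) * x"
    using xy(1,3) by algebra+
  have row2: "r = (r * y - s * x) * y" "s = - (r * y - s * x) * x"
    using xy(2,3) by algebra+
  have sq: "(p * y - q * x)\<^sup>2 + (r * y - s * x)\<^sup>2 = 1"
    using xy one by algebra
  show ?thesis
  proof (rule that[of "(x, y)"])
    show "norm (x, y) = 1"
      using xy(3) by (simp add: norm_prod_def)
    show "mapp A (x, y) = 0"
      using xy A by (simp add: zero_prod_def)
    fix v w :: "real \<times> real"
    obtain v1 v2 w1 w2 where vw: "v = (v1, v2)" "w = (w1, w2)"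
      by (metis surj_pair)
    have 1: "p * t + q * t' = (p * y - q * x) * (t * y - t' * x)" for t t'
      using row1 by algebra
    have 2: "r * t + s * t' = (r * y - s * x) * (t * y - t' * x)" for t t'
      using row2 by algebra
    show "inner (mapp A v) (mapp A w) = wedge v (x, y) * wedge w (x, y)"
      unfolding vw A mapp.simps inner_Pair inner_real_def 1 2 wedge.simps
      using sq by algebra
  qed
qed

lemma continuous_mat2:
  "continuous_on UNIV mdet" "continuous_on UNIV (\<lambda>M. mmul A M)" "continuous_on UNIV madj"
  "continuous_on UNIV (\<lambda>M. mapp M v)" "continuous_on UNIV (\<lambda>v. mapp A v)"
  "continuous_on UNIV (\<lambda>v. wedge v w)"
proof -
  show "continuous_on UNIV mdet"
  proof -
    have "mdet = (\<lambda>M. fst M * snd (snd (snd M)) - fst (snd M) * fst (snd (snd M)))"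
      by (auto simp: fun_eq_iff)
    then show ?thesis by (rule ssubst) (intro continuous_intros)
  qed
  show "continuous_on UNIV madj"
  proof -
    have "madj = (\<lambda>M. (snd (snd (snd M)), - fst (snd M), - fst (snd (snd M)), fst M))"
      by (auto simp: fun_eq_iff)
    then show ?thesis by (rule ssubst) (intro continuous_intros)
  qed
  obtain a b c d where A: "A = (a, b, c, d)" by (metis prod_cases4)
  show "continuous_on UNIV (\<lambda>M. mmul A M)"
  proof -
    have "(\<lambda>M. mmul A M) = (\<lambda>M. (a * fst M + b * fst (snd (snd M)),
        a * fst (snd M) + b * snd (snd (snd M)), c * fst M + d * fst (snd (snd M)),
        c * fst (snd M) + d * snd (snd (snd M))))"
      by (auto simp: fun_eq_iff A)
    then show ?thesis by (rule ssubst) (intro continuous_intros)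
  qed
  obtain x y where v: "v = (x, y)" by (metis surj_pair)
  show "continuous_on UNIV (\<lambda>M. mapp M v)"
  proof -
    have "(\<lambda>M. mapp M v) = (\<lambda>M. (fst M * x + fst (snd M) * y,
        fst (snd (snd M)) * x + snd (snd (snd M)) * y))"
      by (auto simp: fun_eq_iff v)
    then show ?thesis by (rule ssubst) (intro continuous_intros)
  qed
  show "continuous_on UNIV (\<lambda>v. mapp A v)"
  proof -
    have "(\<lambda>v. mapp A v) = (\<lambda>v. (a * fst v + b * snd v, c * fst v + d * snd v))"
      by (auto simp: fun_eq_iff A)
    then show ?thesis by (rule ssubst) (intro continuous_intros)
  qed
  obtain w1 w2 where w: "w = (w1, w2)" by (metis surj_pair)
  show "continuous_on UNIV (\<lambda>v. wedge v w)"
  proof -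
    have "(\<lambda>v. wedge v w) = (\<lambda>v. fst v * w2 - snd v * w1)"
      by (auto simp: fun_eq_iff w)
    then show ?thesis by (rule ssubst) (intro continuous_intros)
  qed
qed

section \<open>Escaping sequences of matrices\<close>

text \<open>The normalised inverses lie on a compact sphere and their determinants tend to 0, so
  they subconverge to a matrix of rank one with kernel \<open>a\<close>. Putting
  \<open>v = w = a\<close> shows that \<open>a\<close> is the ideal limit of the points
  \<open>F (r n) \<i>\<close>; for other vectors the sign of the limit tells on which of the two
  arcs between \<open>v\<close> and \<open>w\<close> it lies.\<close>

lemma rank_one_subsequence:
  fixes F :: "nat \<Rightarrow> mat2"
  assumes det: "\<And>n. mdet (F n) = 1" and esc: "filterlim (\<lambda>n. norm (F n)) at_top sequentially"
  obtains r a where "strict_mono r" "norm a = 1"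
    "\<And>v w. (\<lambda>n. inner (mapp (madj (F (r n))) v) (mapp (madj (F (r n))) w) / (norm (F (r n)))\<^sup>2)
       \<longlonglongrightarrow> wedge v a * wedge w a"
proof -
  define U where "U n = (1 / norm (F n)) *\<^sub>R madj (F n)" for n
  have pos: "norm (F n) > 0" for n
    by (rule norm_mat2_pos) (rule det)
  have normU: "norm (U n) = 1" for n
    using pos[of n] by (simp add: U_def)
  have "compact (sphere 0 1 :: mat2 set)"
    by simp
  then obtain V r where V: "V \<in> sphere 0 1" and r: "strict_mono (r :: nat \<Rightarrow> nat)" "(U \<circ> r) \<longlonglongrightarrow> V"
    using normU unfolding compact_def by (metis mem_sphere_0)
  have mdet_U: "mdet (U n) = (1 / norm (F n))\<^sup>2" for n
  proof -
    have "mdet (t *\<^sub>R A) = t\<^sup>2 * mdet A" for t A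
      by (cases A rule: prod_cases4) (simp add: power2_eq_square algebra_simps)
    then show ?thesis
      using det by (simp add: U_def)
  qed
  have "(\<lambda>n. mdet (U (r n))) \<longlonglongrightarrow> mdet V"
    using continuous_on_tendsto_compose[OF continuous_mat2(1) r(2)] by (simp add: o_def)
  moreover have "(\<lambda>n. mdet (U (r n))) \<longlonglongrightarrow> 0"
  proof -
    have "(\<lambda>n. 1 / norm (F n)) \<longlonglongrightarrow> 0"
      using esc by (simp add: tendsto_inverse_0_at_top flip: inverse_eq_divide)
    then have "(\<lambda>n. (1 / norm (F n))\<^sup>2) \<longlonglongrightarrow> 0"
      by (metis tendsto_power zero_power2)
    then have "((\<lambda>n. (1 / norm (F n))\<^sup>2) \<circ> r) \<longlonglongrightarrow> 0"
      using r(1) by (rule LIMSEQ_subseq_LIMSEQ)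
    then show ?thesis
      by (simp add: mdet_U o_def)
  qed
  ultimately have "mdet V = 0"
    by (rule LIMSEQ_unique)
  moreover have "norm V = 1"
    using V by simp
  ultimately obtain a where a: "norm a = 1"
    "\<And>v w. inner (mapp V v) (mapp V w) = wedge v a * wedge w a"
    by (rule singular_mat2_decomp) blast
  have lim: "(\<lambda>n. mapp (U (r n)) v) \<longlonglongrightarrow> mapp V v" for v
    using continuous_on_tendsto_compose[OF continuous_mat2(4) r(2)] by (simp add: o_def)
  show ?thesis
  proof (rule that[OF r(1) a(1)])
    fix v w
    have "(\<lambda>n. inner (mapp (U (r n)) v) (mapp (U (r n)) w)) \<longlonglongrightarrow> wedge v a * wedge w a"
      unfolding a(2)[symmetric] by (intro tendsto_inner lim)
    then show "(\<lambda>n. inner (mapp (madj (F (r n))) v) (mapp (madj (F (r n))) w) / (norm (F (r n)))\<^sup>2)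
       \<longlonglongrightarrow> wedge v a * wedge w a"
      by (simp add: U_def mapp_scaleR power2_eq_square)
  qed
qed

text \<open>
  The sign of the inner product tells on which side of the geodesic from \<open>v\<close> to \<open>v'\<close> the point
  \<open>F n (\<i>)\<close> lies, and \<open>norm (mapp (madj (F n)) v)\<close> is small exactly if that point lies deep inside a
  horoball based at \<open>v\<close>.
\<close>

lemma horoball_visit_if_crossing:
  fixes F g :: "nat \<Rightarrow> mat2"
  assumes det: "\<And>n. mdet (F n) = 1" "\<And>n. mdet (g n) = 1"
    and step: "\<And>n. F (Suc n) = mmul (F n) (g n)" and bound: "\<And>n. norm (g n) \<le> M"
    and esc: "filterlim (\<lambda>n. norm (F n)) at_top sequentially"
    and pos: "\<exists>\<^sub>F n in sequentially. inner (mapp (madj (F n)) v) (mapp (madj (F n)) v') > 0"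
    and neg: "\<exists>\<^sub>F n in sequentially. inner (mapp (madj (F n)) v) (mapp (madj (F n)) v') < 0"
    and D: "wedge v v' \<noteq> 0"
  shows "(\<forall>\<epsilon>>0. \<exists>\<^sub>F n in sequentially. norm (mapp (madj (F n)) v) < \<epsilon>) \<or>
    (\<forall>\<epsilon>>0. \<exists>\<^sub>F n in sequentially. norm (mapp (madj (F n)) v') < \<epsilon>)"
proof (rule ccontr)
  assume contr: "\<not> ?thesis"
  define p where "p n = mapp (madj (F n)) v" for n
  define q where "q n = mapp (madj (F n)) v'" for n
  obtain \<epsilon>1 \<epsilon>2 where "\<epsilon>1 > 0" "\<epsilon>2 > 0"
    and ev: "\<forall>\<^sub>F n in sequentially. norm (p n) \<ge> \<epsilon>1" "\<forall>\<^sub>F n in sequentially. norm (q n) \<ge> \<epsilon>2"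
    using contr unfolding p_def q_def by (auto simp: not_frequently not_less)
  \<comment> \<open>\<open>norm (p n) * norm (q n) / \<bar>wedge v v'\<bar>\<close> is the
    hyperbolic cosine of the distance from \<open>F n \<i>\<close> to the geodesic. \<open>C\<close>
    bounds the product just before a crossing, and \<open>L\<close> is the bound on
    \<open>norm (F n)\<close> that results when neither factor is small.\<close>
  define C where "C = sqrt ((M\<^sup>2 * \<bar>wedge v v'\<bar>)\<^sup>2 + (wedge v v')\<^sup>2)"
  define L where "L = ((C / \<epsilon>2) * norm v' + (C / \<epsilon>1) * norm v) / \<bar>wedge v v'\<bar>"
  have "\<forall>\<^sub>F n in sequentially. norm (F n) > L"
    using esc by (simp add: filterlim_at_top_dense)
  with ev have "\<forall>\<^sub>F n in sequentially. norm (p n) \<ge> \<epsilon>1 \<and> norm (q n) \<ge> \<epsilon>2 \<and> norm (F n) > L"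
    by eventually_elim simp
  then obtain N where N: "\<And>n. n \<ge> N \<Longrightarrow> norm (p n) \<ge> \<epsilon>1 \<and> norm (q n) \<ge> \<epsilon>2 \<and> norm (F n) > L"
    unfolding eventually_sequentially by blast
  obtain i where i: "i \<ge> N" "inner (p i) (q i) > 0"
    using pos by (auto simp: frequently_sequentially p_def q_def)
  obtain j where j: "j \<ge> i" "inner (p j) (q j) < 0"
    using neg by (auto simp: frequently_sequentially p_def q_def)
  have "\<exists>n\<ge>i. inner (p n) (q n) \<ge> 0 \<and> inner (p (Suc n)) (q (Suc n)) < 0"
  proof (rule ccontr)
    assume *: "\<not> ?thesis"
    have "inner (p k) (q k) \<ge> 0" if "k \<ge> i" for k
      using that by (induction rule: dec_induct) (use * i in \<open>auto simp: not_less\<close>)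
    then show False
      using j by (meson not_less)
  qed
  then obtain n where n: "n \<ge> i" "inner (p n) (q n) \<ge> 0" "inner (p (Suc n)) (q (Suc n)) < 0"
    by blast
  have g: "mapp (g n) (p (Suc n)) = p n" "mapp (g n) (q (Suc n)) = q n"
    using det by (simp_all add: p_def q_def step madj_mmul mapp_mmul)
  have wedge_pq: "wedge (p k) (q k) = wedge v v'" for k
    using det by (simp add: p_def q_def wedge_mapp)
  have M: "(norm (g n))\<^sup>2 \<le> M\<^sup>2"
    using bound by (intro power_mono) auto
  have "inner (p n) (q n) \<le> (norm (g n))\<^sup>2 * \<bar>wedge v v'\<bar>"
    using inner_mapp_le_if_inner_nonpos[of "p (Suc n)" "q (Suc n)" "g n"] n(3) g wedge_pq by simp
  also have "\<dots> \<le> M\<^sup>2 * \<bar>wedge v v'\<bar>"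
    using M by (intro mult_right_mono) auto
  finally have "(inner (p n) (q n))\<^sup>2 \<le> (M\<^sup>2 * \<bar>wedge v v'\<bar>)\<^sup>2"
    using n(2) by (intro power_mono)
  then have "(norm (p n) * norm (q n))\<^sup>2 \<le> (M\<^sup>2 * \<bar>wedge v v'\<bar>)\<^sup>2 + (wedge v v')\<^sup>2"
    using inner_wedge[of "p n" "q n"] by (simp add: power_mult_distrib wedge_pq)
  then have C: "norm (p n) * norm (q n) \<le> C"
    unfolding C_def by (rule real_le_rsqrt)
  have lower: "norm (p n) \<ge> \<epsilon>1" "norm (q n) \<ge> \<epsilon>2" "norm (F n) > L"
    using N[of n] n i by auto
  have "norm (p n) * \<epsilon>2 \<le> norm (p n) * norm (q n)" "\<epsilon>1 * norm (q n) \<le> norm (p n) * norm (q n)"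
    using lower by (auto intro: mult_left_mono mult_right_mono)
  then have "norm (p n) * \<epsilon>2 \<le> C" "norm (q n) * \<epsilon>1 \<le> C"
    using C by (auto simp: mult.commute)
  then have "norm (p n) \<le> C / \<epsilon>2" "norm (q n) \<le> C / \<epsilon>1"
    using \<open>\<epsilon>1 > 0\<close> \<open>\<epsilon>2 > 0\<close> by (auto simp: field_simps)
  then have "norm (p n) * norm v' + norm (q n) * norm v \<le> (C / \<epsilon>2) * norm v' + (C / \<epsilon>1) * norm v"
    by (intro add_mono mult_right_mono) auto
  then have "norm (F n) * \<bar>wedge v v'\<bar> \<le> (C / \<epsilon>2) * norm v' + (C / \<epsilon>1) * norm v"
    using norm_mat2_le_basis[of "madj (F n)" v v'] by (simp add: p_def q_def)
  then have "norm (F n) \<le> L"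
    using D by (simp add: L_def field_simps)
  then show False
    using lower by simp
qed

section \<open>Horospheric limit points of a semigroup\<close>

text \<open>The ideal point of \<open>v\<close> is a horospheric limit point of \<open>T\<close>:
  the orbit of \<open>\<i>\<close> enters every horoball based there.\<close>

definition attracting :: "mat2 set \<Rightarrow> real \<times> real \<Rightarrow> bool" where
  "attracting T v \<longleftrightarrow> (\<forall>\<epsilon>>0. \<exists>A\<in>T. norm (mapp (madj A) v) < \<epsilon>)"

definition matrix_semigroup :: "mat2 set \<Rightarrow> bool" where
  "matrix_semigroup T \<longleftrightarrow> (\<forall>A\<in>T. mdet A = 1) \<and> (\<forall>A\<in>T. \<forall>B\<in>T. mmul A B \<in> T)"

lemma matrix_semigroupD:
  assumes "matrix_semigroup T"
  shows "A \<in> T \<Longrightarrow> mdet A = 1" "A \<in> T \<Longrightarrow> B \<in> T \<Longrightarrow> mmul A B \<in> T"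
  using assms by (auto simp: matrix_semigroup_def)

text \<open>Every \<open>F m\<close> keeps a non-attracting vector \<open>z\<close> out of the arc
  that is visited by small horoballs, since otherwise the tails of the sequence would make
  \<open>z\<close> attracting. Out of the arc, \<open>norm (mapp (F m) z)\<close> is controlled by
  \<open>norm (mapp (madj (F m)) x)\<close> for a fixed \<open>x\<close> inside it, and the latter
  becomes arbitrarily small. Two vectors shortened together while their wedge is preserved have
  wedge 0.\<close>

lemma not_attracting_parallel:
  fixes F g :: "nat \<Rightarrow> mat2"
  assumes T: "matrix_semigroup T"
    and det: "\<And>n. mdet (F n) = 1" and gT: "\<And>n. g n \<in> T"
    and step: "\<And>n. F (Suc n) = mmul (F n) (g n)" and bound: "\<And>n. norm (g n) \<le> M"
    and esc: "filterlim (\<lambda>n. norm (F n)) at_top sequentially"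
    and div: "\<And>v. v \<noteq> 0 \<Longrightarrow> \<not> (\<lambda>n. norm (mapp (madj (F n)) v) / norm (F n)) \<longlonglongrightarrow> 0"
    and y: "\<not> attracting T y" "\<not> attracting T y'"
  shows "wedge y y' = 0"
proof -
  have detg: "mdet (g n) = 1" for n
    using T gT by (simp add: matrix_semigroupD)
  define SG where "SG v \<longleftrightarrow> (\<forall>\<epsilon>>0. \<exists>\<^sub>F n in sequentially. norm (mapp (madj (F n)) v) < \<epsilon>)" for v
  define B where "B n v w = inner (mapp (madj (F n)) v) (mapp (madj (F n)) w)" for n v w
  have pos: "norm (F n) > 0" for n
    by (rule norm_mat2_pos) (rule det)
  \<comment> \<open>\<open>a\<close> is one limit point of the sequence. As the sequence does not
    converge to \<open>a\<close>, a subsequence keeps a positive chordal distance from it, and a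
    limit point \<open>b\<close> of that subsequence differs from \<open>a\<close>.\<close>
  obtain r a where r: "strict_mono r" "norm a = 1"
    and lima: "\<And>v w. (\<lambda>n. B (r n) v w / (norm (F (r n)))\<^sup>2) \<longlonglongrightarrow> wedge v a * wedge w a"
    unfolding B_def by (rule rank_one_subsequence[OF det esc]) blast
  have "a \<noteq> 0"
    using r by auto
  from div[OF this] obtain \<epsilon> where "\<epsilon> > 0"
    and fr: "\<exists>\<^sub>F n in sequentially. norm (mapp (madj (F n)) a) / norm (F n) \<ge> \<epsilon>"
    using pos by (auto simp: tendsto_iff not_eventually not_less)
  then have "infinite {n. norm (mapp (madj (F n)) a) / norm (F n) \<ge> \<epsilon>}"
    by (simp add: frequently_cofinite flip: cofinite_eq_sequentially)
  from infinite_enumerate[OF this] obtain \<sigma> where \<sigma>: "strict_mono (\<sigma> :: nat \<Rightarrow> nat)"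
    "\<And>n. norm (mapp (madj (F (\<sigma> n))) a) / norm (F (\<sigma> n)) \<ge> \<epsilon>"
    by blast
  have "filterlim (\<lambda>n. norm (F (\<sigma> n))) at_top sequentially"
    using filterlim_compose[OF esc filterlim_subseq[OF \<sigma>(1)]] .
  then obtain r' b where r': "strict_mono r'" "norm b = 1"
    and limb: "\<And>v w. (\<lambda>n. B (\<sigma> (r' n)) v w / (norm (F (\<sigma> (r' n))))\<^sup>2) \<longlonglongrightarrow> wedge v b * wedge w b"
    unfolding B_def by (rule rank_one_subsequence[of "\<lambda>n. F (\<sigma> n)", OF det]) blast
  have "\<epsilon>\<^sup>2 \<le> wedge a b * wedge a b"
  proof (rule LIMSEQ_le_const[OF limb])
    have "\<epsilon>\<^sup>2 \<le> (norm (mapp (madj (F (\<sigma> n))) a) / norm (F (\<sigma> n)))\<^sup>2" for n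
      using \<sigma>(2) \<open>\<epsilon> > 0\<close> by (intro power_mono) auto
    then show "\<exists>N. \<forall>n\<ge>N. \<epsilon>\<^sup>2 \<le> B (\<sigma> (r' n)) a a / (norm (F (\<sigma> (r' n))))\<^sup>2"
      by (simp add: B_def power_divide dot_square_norm)
  qed
  then have ab: "wedge a b \<noteq> 0"
    using \<open>\<epsilon> > 0\<close> by (metis mult_zero_left not_less zero_less_power)
  have freq: "\<exists>\<^sub>F n in sequentially. P n"
    if \<rho>: "strict_mono \<rho>" "\<forall>\<^sub>F n in sequentially. P (\<rho> n)"
    for P :: "nat \<Rightarrow> bool" and \<rho> :: "nat \<Rightarrow> nat"
    unfolding frequently_sequentially
  proof
    fix N
    obtain k where k: "\<And>n. n \<ge> k \<Longrightarrow> P (\<rho> n)"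
      using \<rho>(2) unfolding eventually_sequentially by blast
    have "\<rho> (max N k) \<ge> N"
      using seq_suble[OF \<rho>(1), of "max N k"] by simp
    then show "\<exists>n\<ge>N. P n"
      using k[of "max N k"] by auto
  qed
  have sign: "(\<exists>\<^sub>F n in sequentially. 0 < B n v w)"
    if "strict_mono \<rho>" "(\<lambda>n. B (\<rho> n) v w / (norm (F (\<rho> n)))\<^sup>2) \<longlonglongrightarrow> l" "l > 0" for \<rho> v w l
  proof -
    have "\<forall>\<^sub>F n in sequentially. 0 < B (\<rho> n) v w / (norm (F (\<rho> n)))\<^sup>2"
      using that by (simp add: order_tendsto_iff)
    then have "\<forall>\<^sub>F n in sequentially. 0 < B (\<rho> n) v w"
      using pos by (auto elim!: eventually_mono simp: zero_less_divide_iff)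
    then show ?thesis
      using freq[OF that(1)] by simp
  qed
  have sign': "(\<exists>\<^sub>F n in sequentially. B n v w < 0)"
    if "strict_mono \<rho>" "(\<lambda>n. B (\<rho> n) v w / (norm (F (\<rho> n)))\<^sup>2) \<longlonglongrightarrow> l" "l < 0" for \<rho> v w l
  proof -
    have "\<forall>\<^sub>F n in sequentially. B (\<rho> n) v w / (norm (F (\<rho> n)))\<^sup>2 < 0"
      using that by (simp add: order_tendsto_iff)
    then have "\<forall>\<^sub>F n in sequentially. B (\<rho> n) v w < 0"
      using pos by (auto elim!: eventually_mono simp: divide_less_0_iff)
    then show ?thesis
      using freq[OF that(1)] by simp
  qed
  have \<sigma>r': "strict_mono (\<lambda>n. \<sigma> (r' n))"
    using \<sigma>(1) r'(1) by (simp add: strict_mono_def)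
  \<comment> \<open>The sign of \<open>wedge v a * wedge v b\<close> distinguishes the two arcs
    between \<open>a\<close> and \<open>b\<close>. For \<open>v\<close> and \<open>w\<close> on
    different arcs, the geodesic joining them separates \<open>a\<close> from \<open>b\<close>, so
    the sequence changes sides infinitely often.\<close>
  have cross: "SG v \<or> SG w"
    if vw: "wedge v a * wedge v b > 0" "wedge w a * wedge w b < 0" for v w
  proof -
    have prod: "(wedge v a * wedge w a) * (wedge v b * wedge w b) < 0"
      using mult_pos_neg[OF vw] by (simp add: mult_ac)
    have "wedge v w \<noteq> 0"
    proof
      assume "wedge v w = 0"
      moreover have "v \<noteq> 0"
        using vw by auto
      ultimately obtain t where "w = t *\<^sub>R v"
        by (rule wedge_eq_0_imp_parallel)
      then have "wedge w a * wedge w b = t\<^sup>2 * (wedge v a * wedge v b)"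
        by (simp add: power2_eq_square)
      then show False
        using vw by (metis less_imp_le mult_nonneg_nonneg not_less zero_le_power2)
    qed
    moreover have "(\<exists>\<^sub>F n in sequentially. 0 < B n v w) \<and> (\<exists>\<^sub>F n in sequentially. B n v w < 0)"
      using prod sign[OF r(1) lima] sign[OF \<sigma>r' limb] sign'[OF r(1) lima] sign'[OF \<sigma>r' limb]
      unfolding mult_less_0_iff by blast
    ultimately show ?thesis
      using horoball_visit_if_crossing[OF det detg step bound esc, of v w]
      unfolding SG_def B_def by blast
  qed
  \<comment> \<open>By \<open>cross\<close>, a point of the first arc without visits forces visits
    on the whole second arc. Passing from \<open>b\<close> to \<open>- b\<close> exchanges the arcs
    and keeps the ideal point.\<close>
  obtain c where c: "norm c = 1" "wedge c a \<noteq> 0"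
    and arc: "\<And>v. wedge v a * wedge v c > 0 \<Longrightarrow> SG v"
  proof (cases "\<forall>v. wedge v a * wedge v b > 0 \<longrightarrow> SG v")
    case True
    then show ?thesis
      using that[of b] r' ab wedge_commute[of a b] by auto
  next
    case False
    then have "SG v" if "wedge v a * wedge v b < 0" for v
      using cross that by blast
    moreover have "wedge v (- b) = - wedge v b" "wedge (- b) v = - wedge b v" for v
      using wedge_scaleR(2)[of v "-1" b] wedge_scaleR(1)[of "-1" b v] by simp_all
    ultimately show ?thesis
      using that[of "- b"] r' ab wedge_commute[of a b] by auto
  qed
  \<comment> \<open>A vector inside the chosen arc: \<open>wedge x a\<close> and
    \<open>wedge x c\<close> both equal \<open>- wedge c a\<close>.\<close>
  define x where "x = a - c"
  have wx: "wedge z x = wedge z a - wedge z c" for z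
    unfolding x_def by (cases z; cases a; cases c) (simp add: algebra_simps)
  have arc_x: "SG x"
  proof (rule arc)
    have "wedge x w = wedge a w - wedge c w" for w
      unfolding x_def by (cases w; cases a; cases c) (simp add: algebra_simps)
    then have "wedge x a * wedge x c = (wedge c a)\<^sup>2"
      using wedge_commute[of a c] by (simp add: power2_eq_square)
    then show "wedge x a * wedge x c > 0"
      using c by simp
  qed
  \<comment> \<open>Out of the arc the numbers \<open>wedge z a\<close> and \<open>wedge z c\<close>
    do not have the same strict sign, so their absolute values add up in \<open>wx\<close>; Cramer's
    rule bounds \<open>z\<close> by this sum.\<close>
  have far: "\<bar>wedge c a\<bar> * norm z \<le> \<bar>wedge z x\<bar>" if "\<not> wedge z a * wedge z c > 0" for z
  proof -
    have "wedge c a *\<^sub>R z = wedge z a *\<^sub>R c - wedge z c *\<^sub>R a"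
      by (cases z; cases a; cases c) (simp add: algebra_simps)
    then have "\<bar>wedge c a\<bar> * norm z = norm (wedge z a *\<^sub>R c - wedge z c *\<^sub>R a)"
      by (metis norm_scaleR real_norm_def)
    also have "\<dots> \<le> \<bar>wedge z a\<bar> + \<bar>wedge z c\<bar>"
      using norm_triangle_ineq4[of "wedge z a *\<^sub>R c" "wedge z c *\<^sub>R a"] c r by simp
    also have "\<dots> = \<bar>wedge z x\<bar>"
      using that unfolding wx by (auto simp: not_less mult_le_0_iff)
    finally show ?thesis .
  qed
  have suffix: "mmul (madj (F m)) (F (m + Suc k)) \<in> T" for m k
  proof (induction k)
    case 0
    then show ?case
      using gT det by (simp add: step)
  next
    case (Suc k)
    have "mmul (madj (F m)) (F (m + Suc (Suc k))) =
        mmul (mmul (madj (F m)) (F (m + Suc k))) (g (m + Suc k))"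
      using step[of "m + Suc k"] by (simp add: mmul_assoc)
    then show ?case
      using Suc gT T by (simp add: matrix_semigroupD)
  qed
  have bad: "\<bar>wedge c a\<bar> * norm (mapp (F m) z) \<le> norm z * norm (mapp (madj (F m)) x)"
    if z: "\<not> attracting T z" for m z
  proof -
    have "\<not> SG (mapp (F m) z)"
    proof
      assume SG: "SG (mapp (F m) z)"
      have "\<exists>A\<in>T. norm (mapp (madj A) z) < \<epsilon>" if \<epsilon>: "\<epsilon> > 0" for \<epsilon>
      proof -
        \<comment> \<open>\<open>n\<close> has to exceed \<open>m\<close>, because \<open>T\<close>
          may lack the identity and the tail must be a nonempty product.\<close>
        obtain n where n: "n \<ge> Suc m" "norm (mapp (madj (F n)) (mapp (F m) z)) < \<epsilon>"
          using SG \<epsilon> unfolding SG_def frequently_sequentially by blast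
        then obtain k where "n = m + Suc k"
          by (metis add_Suc_shift le_Suc_ex)
        then show ?thesis
          using n suffix[of m k]
          by (intro bexI[of _ "mmul (madj (F m)) (F (m + Suc k))"])
            (simp_all add: madj_mmul mapp_mmul)
      qed
      then show False
        using z by (simp add: attracting_def)
    qed
    then have "\<bar>wedge c a\<bar> * norm (mapp (F m) z) \<le> \<bar>wedge (mapp (F m) z) x\<bar>"
      using far arc by blast
    also have "\<dots> = \<bar>wedge z (mapp (madj (F m)) x)\<bar>"
      by (simp add: wedge_mapp_left det)
    also have "\<dots> \<le> norm z * norm (mapp (madj (F m)) x)"
      by (rule abs_wedge_le)
    finally show ?thesis .
  qed
  have "(wedge c a)\<^sup>2 * \<bar>wedge y y'\<bar> \<le> 0 + e" if "e > 0" for e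
  proof -
    define K where "K = norm y * norm y' + 1"
    have K: "K > 0" "norm y * norm y' \<le> K"
      by (auto simp: K_def add_nonneg_pos)
    have "sqrt (e / K) > 0"
      using \<open>e > 0\<close> K by simp
    then obtain m where m: "norm (mapp (madj (F m)) x) < sqrt (e / K)"
      using arc_x unfolding SG_def frequently_sequentially by blast
    have "(wedge c a)\<^sup>2 * \<bar>wedge y y'\<bar> = (wedge c a)\<^sup>2 * \<bar>wedge (mapp (F m) y) (mapp (F m) y')\<bar>"
      by (simp add: wedge_mapp det)
    also have "\<dots> \<le> (wedge c a)\<^sup>2 * (norm (mapp (F m) y) * norm (mapp (F m) y'))"
      by (intro mult_left_mono abs_wedge_le) simp
    also have "\<dots> = (\<bar>wedge c a\<bar> * norm (mapp (F m) y)) * (\<bar>wedge c a\<bar> * norm (mapp (F m) y'))"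
      by (simp add: power2_eq_square flip: power2_abs[of "wedge c a"])
    also have "\<dots> \<le> (norm y * norm (mapp (madj (F m)) x)) * (norm y' * norm (mapp (madj (F m)) x))"
      using y by (intro mult_mono bad) auto
    also have "\<dots> = (norm y * norm y') * (norm (mapp (madj (F m)) x))\<^sup>2"
      by (simp add: power2_eq_square)
    also have "\<dots> \<le> K * (sqrt (e / K))\<^sup>2"
      using K m by (intro mult_mono power_mono) auto
    also have "\<dots> = 0 + e"
      using K \<open>e > 0\<close> by simp
    finally show ?thesis .
  qed
  then have "(wedge c a)\<^sup>2 * \<bar>wedge y y'\<bar> \<le> 0"
    by (rule field_le_epsilon)
  then show ?thesis
    using c by (simp add: mult_le_0_iff)
qed

text \<open>If \<open>B\<close> shortens \<open>mapp (madj A) q\<close>, then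
  \<open>mmul A B\<close> shortens \<open>q\<close>; hence \<open>madj A\<close> sends
  non-attracting vectors to non-attracting ones, and there is only one such direction. An eigenvalue
  of modulus below 1 would make \<open>q\<close> attracting through the powers of
  \<open>A\<close>.\<close>

lemma unique_not_attracting_eigenvector:
  assumes T: "matrix_semigroup T"
    and par: "\<And>y. \<not> attracting T y \<Longrightarrow> wedge q y = 0"
    and q: "\<not> attracting T q" "q \<noteq> 0" and A: "A \<in> T"
  obtains t where "\<bar>t\<bar> \<ge> 1" "mapp (madj A) q = t *\<^sub>R q"
proof -
  have "\<not> attracting T (mapp (madj A) q)"
  proof
    assume *: "attracting T (mapp (madj A) q)"
    have "\<exists>B\<in>T. norm (mapp (madj B) q) < \<epsilon>" if \<epsilon>: "\<epsilon> > 0" for \<epsilon>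
    proof -
      obtain B where "B \<in> T" "norm (mapp (madj B) (mapp (madj A) q)) < \<epsilon>"
        using * \<epsilon> unfolding attracting_def by blast
      then show ?thesis
        using T A by (intro bexI[of _ "mmul A B"]) (simp_all add: matrix_semigroupD madj_mmul mapp_mmul)
    qed
    then show False
      using q by (simp add: attracting_def)
  qed
  then have "wedge q (mapp (madj A) q) = 0"
    by (rule par)
  then obtain t where t: "mapp (madj A) q = t *\<^sub>R q"
    using q(2) by (rule wedge_eq_0_imp_parallel)
  have "\<exists>B\<in>T. mapp (madj B) q = t ^ Suc k *\<^sub>R q" for k
  proof (induction k)
    case 0
    then show ?case
      using A t by auto
  next
    case (Suc k)
    then obtain B where "B \<in> T" "mapp (madj B) q = t ^ Suc k *\<^sub>R q"
      by blast
    then show ?case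
      using A T t by (intro bexI[of _ "mmul A B"])
        (simp_all add: matrix_semigroupD madj_mmul mapp_mmul mapp_scaleR)
  qed
  note powers = this
  have "\<bar>t\<bar> \<ge> 1"
  proof (rule ccontr)
    assume "\<not> \<bar>t\<bar> \<ge> 1"
    have "\<exists>B\<in>T. norm (mapp (madj B) q) < \<epsilon>" if "\<epsilon> > 0" for \<epsilon>
    proof -
      have "\<epsilon> / norm q > 0"
        using that q by simp
      then obtain k where k: "\<bar>t\<bar> ^ k < \<epsilon> / norm q"
        using real_arch_pow_inv \<open>\<not> \<bar>t\<bar> \<ge> 1\<close> by (metis not_le)
      have "\<bar>t\<bar> ^ Suc k \<le> \<bar>t\<bar> ^ k"
        using \<open>\<not> \<bar>t\<bar> \<ge> 1\<close> by (intro power_decreasing) auto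
      with k have "\<bar>t\<bar> ^ Suc k < \<epsilon> / norm q"
        by linarith
      then have "\<bar>t\<bar> ^ Suc k * norm q < \<epsilon>"
        using q by (simp add: pos_less_divide_eq)
      then show ?thesis
        using powers[of k] by (metis norm_scaleR power_abs real_norm_def)
    qed
    then show False
      using q by (simp add: attracting_def)
  qed
  then show ?thesis
    using t by (rule that)
qed

section \<open>Contraction and coarse density\<close>

text \<open>Here \<open>e\<close>, \<open>f\<close> is the standard basis in either order, so that
  \<open>p\<close> is the longer column. Determinant 1 makes \<open>q\<close> a multiple of
  \<open>p\<close> up to a vector of length \<open>1 / norm p\<close>; so \<open>B\<close> halves
  \<open>q\<close> up to the error \<open>b / norm p\<close>, which is at most
  \<open>norm p / 4\<close> for large \<open>h\<close>. As \<open>norm q \<le> norm p\<close>, the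
  coefficients \<open>1/4 + 1/4 + 1/16\<close> of \<open>(norm p)\<^sup>2\<close> add up to
  \<open>9/16\<close>, the square of \<open>3/4\<close>.\<close>

lemma norm_mmul_shrink:
  assumes ef: "\<And>M. (norm M)\<^sup>2 = (norm (mapp M e))\<^sup>2 + (norm (mapp M f))\<^sup>2"
    and wef: "\<bar>wedge e f\<bar> = 1"
    and h: "mdet h = 1" and larger: "norm (mapp h f) \<le> norm (mapp h e)"
    and B: "norm B \<le> b" "8 * b \<le> (norm h)\<^sup>2" and half: "norm (mapp B (mapp h e)) \<le> norm (mapp h e) / 2"
  shows "norm (mmul B h) \<le> 3 / 4 * norm h"
proof -
  define p where "p = mapp h e"
  define q where "q = mapp h f"
  have b0: "b \<ge> 0"
    using B by (meson norm_ge_zero order_trans)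
  have wpq: "\<bar>wedge p q\<bar> = 1"
    using wef h by (simp add: p_def q_def wedge_mapp)
  then have "p \<noteq> 0"
    by auto
  have q_le: "norm (mapp B q) \<le> norm q / 2 + b / norm p"
  proof -
    define J where "J = (- snd p, fst p)"
    have normJ: "norm J = norm p"
      unfolding J_def by (cases p) (simp add: norm_prod_def add.commute)
    have "(norm p)\<^sup>2 *\<^sub>R q = inner p q *\<^sub>R p + wedge p q *\<^sub>R J"
      unfolding J_def by (cases p; cases q; simp only: norm_pair2) (simp add: power2_eq_square algebra_simps)
    then have "(norm p)\<^sup>2 *\<^sub>R mapp B q = inner p q *\<^sub>R mapp B p + wedge p q *\<^sub>R mapp B J"
      by (metis mapp_add mapp_scaleR(1))
    then have "(norm p)\<^sup>2 * norm (mapp B q) = norm (inner p q *\<^sub>R mapp B p + wedge p q *\<^sub>R mapp B J)"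
      by (metis abs_of_nonneg norm_scaleR zero_le_power2)
    also have "\<dots> \<le> \<bar>inner p q\<bar> * norm (mapp B p) + norm (mapp B J)"
      using norm_triangle_ineq[of "inner p q *\<^sub>R mapp B p" "wedge p q *\<^sub>R mapp B J"] wpq by simp
    also have "\<dots> \<le> (norm p * norm q) * (norm p / 2) + b * norm p"
    proof (intro add_mono mult_mono)
      show "norm (mapp B J) \<le> b * norm p"
        using norm_mapp_le[of B J] B(1) normJ by (metis mult_right_mono norm_ge_zero order_trans)
    qed (use half Cauchy_Schwarz_ineq2 in \<open>auto simp: p_def\<close>)
    finally have "norm (mapp B q) \<le> ((norm p * norm q) * (norm p / 2) + b * norm p) / (norm p)\<^sup>2"
      using \<open>p \<noteq> 0\<close> by (simp add: pos_le_divide_eq mult.commute)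
    also have "\<dots> = norm q / 2 + b / norm p"
      using \<open>p \<noteq> 0\<close> by (simp add: add_divide_distrib power2_eq_square)
    finally show ?thesis .
  qed
  have np: "(norm h)\<^sup>2 \<le> 2 * (norm p)\<^sup>2"
    using ef[of h] power_mono[OF larger, of 2] by (simp add: p_def q_def)
  have "norm q \<le> norm p"
    using larger by (simp add: p_def q_def)
  have nBh: "(norm (mmul B h))\<^sup>2 \<le> (norm p / 2)\<^sup>2 + (norm q / 2 + b / norm p)\<^sup>2"
    unfolding ef[of "mmul B h"] mapp_mmul p_def[symmetric] q_def[symmetric]
    using half q_le by (intro add_mono power_mono) (auto simp: p_def)
  have "b / norm p \<le> norm p / 4"
    using \<open>p \<noteq> 0\<close> B(2) np by (simp add: field_simps power2_eq_square)
  then have "(norm q / 2 + b / norm p)\<^sup>2 \<le> (norm q / 2 + norm p / 4)\<^sup>2"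
    using b0 by (intro power_mono) auto
  also have "\<dots> = (norm q)\<^sup>2 / 4 + norm q * norm p / 4 + (norm p)\<^sup>2 / 16"
    by (simp add: power2_eq_square algebra_simps)
  finally have "(norm (mmul B h))\<^sup>2 \<le>
      (norm p)\<^sup>2 / 4 + ((norm q)\<^sup>2 / 4 + norm q * norm p / 4 + (norm p)\<^sup>2 / 16)"
    using nBh by (simp add: power_divide)
  moreover have "norm q * norm p \<le> (norm p)\<^sup>2"
    using mult_right_mono[OF \<open>norm q \<le> norm p\<close>, of "norm p"] by (simp add: power2_eq_square)
  moreover have "(norm q)\<^sup>2 \<ge> 0"
    by simp
  ultimately have "(norm (mmul B h))\<^sup>2 \<le> 9 / 16 * ((norm p)\<^sup>2 + (norm q)\<^sup>2)"
    unfolding distrib_left by linarith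
  also have "\<dots> = (3 / 4 * norm h)\<^sup>2"
    unfolding power_mult_distrib ef[of h] p_def q_def by (simp add: power2_eq_square)
  finally show ?thesis
    by (rule power2_le_imp_le) simp
qed

text \<open>By compactness of the circle, finitely many elements suffice to halve every vector.
  Hence a point far from \<open>\<i>\<close> is brought closer by a definite factor, and iteration
  leads into a fixed ball. The identity is adjoined for points that lie in the ball from the
  start.\<close>

lemma attracting_imp_coarsely_dense:
  assumes T: "matrix_semigroup T" and attr: "\<And>v. v \<noteq> 0 \<Longrightarrow> attracting T v"
  obtains R where "R > 0"
    "\<And>h. mdet h = 1 \<Longrightarrow> \<exists>A\<in>insert mone T. norm (mmul (madj A) h) \<le> R"
proof -
  define V where "V A = {v. norm (mapp (madj A) v) < 1 / 2}" for A
  have "compact (sphere 0 1 :: (real \<times> real) set)"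
    by simp
  moreover have "open (V A)" for A
    unfolding V_def using continuous_mat2(5)[of "madj A"]
    by (intro open_Collect_less continuous_intros)
  moreover have "sphere 0 1 \<subseteq> (\<Union>A\<in>T. V A)"
  proof
    fix v :: "real \<times> real"
    assume "v \<in> sphere 0 1"
    then have "v \<noteq> 0"
      by auto
    then have "\<exists>A\<in>T. norm (mapp (madj A) v) < 1 / 2"
      using attr[of v] unfolding attracting_def by (meson half_gt_zero zero_less_one)
    then show "v \<in> (\<Union>A\<in>T. V A)"
      by (auto simp: V_def)
  qed
  ultimately obtain T0 where T0: "T0 \<subseteq> T" "finite T0" "sphere 0 1 \<subseteq> (\<Union>A\<in>T0. V A)"
    by (rule compactE_image)
  obtain b where b: "b > 0" "\<And>A. A \<in> T0 \<Longrightarrow> norm A \<le> b"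
    using finite_imp_bounded[OF T0(2)] by (auto simp: bounded_pos)
  \<comment> \<open>The threshold beyond which \<open>norm_mmul_shrink\<close> applies.\<close>
  define R where "R = sqrt (8 * b)"
  have R: "R > 0" "R\<^sup>2 = 8 * b"
    using b by (auto simp: R_def)
  have shrink: "\<exists>A\<in>T. norm (mmul (madj A) h) \<le> 3 / 4 * norm h"
    if h: "mdet h = 1" "norm h > R" for h
  proof -
    have big: "8 * b \<le> (norm h)\<^sup>2"
      using h(2) R by (metis less_imp_le power_mono)
    have half: "\<exists>A\<in>T0. norm (mapp (madj A) v) \<le> norm v / 2" for v
    proof (cases "v = 0")
      case True
      have "T0 \<noteq> {}"
        using T0(3) by (auto simp: sphere_eq_empty)
      then show ?thesis
        using True by auto
    next
      case False
      then have "(1 / norm v) *\<^sub>R v \<in> sphere 0 1"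
        by simp
      then obtain A where "A \<in> T0" "norm (mapp (madj A) ((1 / norm v) *\<^sub>R v)) < 1 / 2"
        using T0(3) by (fastforce simp: V_def)
      then show ?thesis
        using False by (intro bexI[of _ A]) (auto simp: mapp_scaleR field_simps)
    qed
    have ef: "(norm M)\<^sup>2 = (norm (mapp M (1, 0)))\<^sup>2 + (norm (mapp M (0, 1)))\<^sup>2" for M
      by (cases M rule: prod_cases4; simp only: mapp.simps norm_mat2 norm_pair2) simp
    have fe: "(norm M)\<^sup>2 = (norm (mapp M (0, 1)))\<^sup>2 + (norm (mapp M (1, 0)))\<^sup>2" for M
      using ef[of M] by simp
    show ?thesis
    proof (cases "norm (mapp h (0, 1)) \<le> norm (mapp h (1, 0))")
      case True
      obtain A where "A \<in> T0" "norm (mapp (madj A) (mapp h (1, 0))) \<le> norm (mapp h (1, 0)) / 2"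
        using half by blast
      then show ?thesis
        using norm_mmul_shrink[OF ef _ h(1) True, of "madj A" b] b(2)[of A] big T0(1) by auto
    next
      case False
      obtain A where "A \<in> T0" "norm (mapp (madj A) (mapp h (0, 1))) \<le> norm (mapp h (0, 1)) / 2"
        using half by blast
      then show ?thesis
        using norm_mmul_shrink[OF fe _ h(1), of "madj A" b] b(2)[of A] big T0(1) False by auto
    qed
  qed
  have main: "\<exists>A\<in>insert mone T. norm (mmul (madj A) h) \<le> R"
    if "mdet h = 1" "norm h \<le> R * (4 / 3) ^ n" for h n
    using that
  proof (induction n arbitrary: h)
    case 0
    have "madj mone = mone"
      by (simp add: mone_def)
    then show ?case
      using 0 by (intro bexI[of _ mone]) auto
  next
    case (Suc n)
    show ?case
    proof (cases "norm h > R")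
      case True
      then obtain A where A: "A \<in> T" "norm (mmul (madj A) h) \<le> 3 / 4 * norm h"
        using shrink Suc.prems by blast
      then have "norm (mmul (madj A) h) \<le> R * (4 / 3) ^ n"
        using Suc.prems(2) by simp
      moreover have "mdet (mmul (madj A) h) = 1"
        using A T Suc.prems by (simp add: matrix_semigroupD)
      ultimately obtain A' where "A' \<in> insert mone T" "norm (mmul (madj A') (mmul (madj A) h)) \<le> R"
        using Suc.IH by blast
      then show ?thesis
        using A T by (intro bexI[of _ "mmul A A'"]) (auto simp: madj_mmul mmul_assoc matrix_semigroupD)
    next
      case False
      have "madj mone = mone"
        by (simp add: mone_def)
      then show ?thesis
        using False by (intro bexI[of _ mone]) auto
    qed
  qed
  show ?thesis
  proof (rule that[OF R(1)])
    fix h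
    assume h: "mdet h = 1"
    obtain n where "norm h / R < (4 / 3) ^ n"
      using real_arch_pow[of "4 / 3" "norm h / R"] by auto
    then have "norm h \<le> R * (4 / 3) ^ n"
      using R by (simp add: field_simps)
    then show "\<exists>A\<in>insert mone T. norm (mmul (madj A) h) \<le> R"
      using main h by blast
  qed
qed

text \<open>
  Recurrence: extend a word by \<open>A\<close> and then by an element of the semigroup that leads back into a
  compact set. Two of the words so obtained are close to each other, and one is a prefix of the other.
\<close>

lemma approximate_inverse_if_coarsely_dense:
  assumes T: "matrix_semigroup T"
    and dense: "\<And>h. mdet h = 1 \<Longrightarrow> \<exists>B\<in>insert mone T. norm (mmul (madj B) h) \<le> R"
    and A: "A \<in> T" and "\<epsilon> > 0"
  obtains B where "B \<in> insert mone T" "norm (mmul A B - mone) < \<epsilon>"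
proof -
  have det: "mdet B = 1" if "B \<in> insert mone T" for B
    using that T by (auto simp: matrix_semigroupD)
  have closed: "mmul B C \<in> insert mone T" if "B \<in> insert mone T" "C \<in> insert mone T" for B C
    using that T by (auto simp: matrix_semigroupD)
  obtain \<beta> where \<beta>: "\<And>h. mdet h = 1 \<Longrightarrow> \<beta> h \<in> insert mone T \<and> norm (mmul (madj (\<beta> h)) h) \<le> R"
    using dense by metis
  \<comment> \<open>Density is applied to the inverse of \<open>mmul u A\<close>. Since
    \<open>madj\<close> preserves norms, the element found leads \<open>mmul u A\<close> back into
    the ball of radius \<open>R\<close>.\<close>
  define t where "t u = \<beta> (madj (mmul u A))" for u
  define u where "u = rec_nat mone (\<lambda>_ u. mmul (mmul u A) (t u))"
  have u_simps: "u 0 = mone" "u (Suc n) = mmul (mmul (u n) A) (t (u n))" for n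
    by (simp_all add: u_def)
  have tT: "t v \<in> insert mone T" "norm (mmul (mmul v A) (t v)) \<le> R" if "mdet v = 1" for v
  proof -
    have "mdet (madj (mmul v A)) = 1"
      using that A det by simp
    from \<beta>[OF this] show "t v \<in> insert mone T" "norm (mmul (mmul v A) (t v)) \<le> R"
      using norm_madj[of "mmul (madj (t v)) (madj (mmul v A))"]
      unfolding t_def[symmetric] madj_mmul[of "madj (t v)"] madj_madj by simp_all
  qed
  have detu: "mdet (u n) = 1" for n
  proof (induction n)
    case (Suc n)
    then show ?case
      using det[of "t (u n)"] tT(1)[of "u n"] det[of A] A by (simp add: u_simps)
  qed (simp add: u_simps)
  define R' where "R' = max R (norm mone)"
  have normu: "norm (u n) \<le> R'" for n
    using tT(2)[OF detu] by (cases n) (auto simp: u_simps R'_def max_def intro: order_trans)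
  have prefix: "\<exists>B\<in>insert mone T. u (i + Suc k) = mmul (u i) (mmul A B)" for i k
  proof (induction k)
    case 0
    have "u (i + Suc 0) = mmul (u i) (mmul A (t (u i)))"
      by (simp add: u_simps mmul_assoc)
    then show ?case
      using tT(1)[OF detu] by blast
  next
    case (Suc k)
    then obtain B where B: "B \<in> insert mone T" "u (i + Suc k) = mmul (u i) (mmul A B)"
      by blast
    then have "u (i + Suc (Suc k)) = mmul (u i) (mmul A (mmul B (mmul A (t (u (i + Suc k))))))"
      using u_simps(2)[of "i + Suc k"] by (simp add: mmul_assoc)
    moreover have "mmul B (mmul A (t (u (i + Suc k)))) \<in> insert mone T"
      using A by (intro closed B(1) tT(1)[OF detu]) simp
    ultimately show ?case
      by blast
  qed
  have R': "R' > 0"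
    using norm_mat2_pos[of mone] by (simp add: R'_def less_max_iff_disj)
  have "bounded (range u)"
    using normu by (auto simp: bounded_iff)
  then obtain l r where "strict_mono (r :: nat \<Rightarrow> nat)" "(u \<circ> r) \<longlonglongrightarrow> l"
    using bounded_imp_convergent_subsequence by blast
  then have "Cauchy (u \<circ> r)"
    using LIMSEQ_imp_Cauchy by blast
  then obtain N where N: "\<And>m n. m \<ge> N \<Longrightarrow> n \<ge> N \<Longrightarrow> dist (u (r m)) (u (r n)) < \<epsilon> / R'"
    using \<open>\<epsilon> > 0\<close> R' unfolding Cauchy_def by (metis comp_apply divide_pos_pos)
  have "r N < r (Suc N)"
    using \<open>strict_mono r\<close> by (simp add: strict_mono_def)
  then obtain k where k: "r (Suc N) = r N + Suc k"
    by (metis add_Suc_right less_imp_Suc_add)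
  obtain B where B: "B \<in> insert mone T" "u (r N + Suc k) = mmul (u (r N)) (mmul A B)"
    using prefix by blast
  \<comment> \<open>\<open>mmul A B\<close> is the quotient of two nearby words, and undoing the
    first of them costs at most the factor \<open>R'\<close>.\<close>
  have "mmul A B - mone = mmul (madj (u (r N))) (u (r (Suc N)) - u (r N))"
    using B detu by (simp add: k mmul_diff)
  also have "norm \<dots> \<le> norm (u (r N)) * norm (u (r (Suc N)) - u (r N))"
    using norm_mmul_le[of "madj (u (r N))"] by simp
  also have "\<dots> \<le> R' * norm (u (r (Suc N)) - u (r N))"
    using normu by (intro mult_right_mono) auto
  also have "\<dots> < R' * (\<epsilon> / R')"
    using N[of "Suc N" N] R' by (intro mult_strict_left_mono) (auto simp: dist_norm)
  finally show ?thesis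
    using R' B(1) by (intro that) auto
qed

section \<open>Moebius transformations as matrices\<close>

lemma moebius_map_mmul:
  assumes "mdet A \<noteq> 0" "mdet B \<noteq> 0"
  shows "moebius_map (mmul A B) = moebius_map A \<circ> moebius_map B"
  using assms by (cases A rule: prod_cases4; cases B rule: prod_cases4) (simp add: moebius_map_comp)

lemma moebius_map_mone [simp]: "moebius_map mone = id"
  unfolding mone_def by (rule moebius_map_id) simp

lemma moebius_map_madj [simp]:
  assumes "mdet A = 1"
  shows "moebius_map A \<circ> moebius_map (madj A) = id" "moebius_map (madj A) \<circ> moebius_map A = id"
  using assms moebius_map_mmul[of A "madj A"] moebius_map_mmul[of "madj A" A] by simp_all

lemma moebius_map_in_carrier: "mdet A = 1 \<Longrightarrow> moebius_map A \<in> carrier moebius_group"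
  by (cases A rule: prod_cases4) (auto simp: moebius_group_def moebius_coeffs_def)

lemma inv_moebius_map:
  assumes "mdet A = 1"
  shows "inv\<^bsub>moebius_group\<^esub> (moebius_map A) = moebius_map (madj A)"
proof -
  interpret group moebius_group
    by (rule group_moebius_group)
  show ?thesis
  proof (rule inv_equality)
    show "moebius_map (madj A) \<otimes>\<^bsub>moebius_group\<^esub> moebius_map A = \<one>\<^bsub>moebius_group\<^esub>"
      using assms by (simp add: moebius_group_def)
  qed (use assms in \<open>simp_all add: moebius_map_in_carrier\<close>)
qed

lemma carrier_moebius_group_cases:
  assumes "g \<in> carrier moebius_group"
  obtains A where "mdet A = 1" "g = moebius_map A"
proof -
  obtain a b c d where g: "g = moebius_map (a, b, c, d)" "a * d - b * c > 0"
    using assms by (auto simp: moebius_group_def moebius_coeffs_def)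
  define t where "t = 1 / sqrt (a * d - b * c)"
  have t: "t \<noteq> 0" "t * t * (a * d - b * c) = 1"
    using g by (simp_all add: t_def)
  have "moebius_map (a, b, c, d) = moebius_map (a, b, c, d) \<circ> moebius_map (t, 0, 0, t)"
    using moebius_map_id[OF t(1)] by simp
  also have "\<dots> = moebius_map (a * t, b * t, c * t, d * t)"
    using g t by (subst moebius_map_comp) auto
  finally show ?thesis
    using g t by (intro that[of "(a * t, b * t, c * t, d * t)"]) (simp_all add: algebra_simps)
qed

section \<open>Orbits and the chordal metric\<close>

definition pt :: "mat2 \<Rightarrow> complex option" where
  "pt A = moebius_map A (Some \<i>)"

definition bpt :: "real \<times> real \<Rightarrow> complex option" where
  "bpt v = (if snd v = 0 then None else Some (of_real (fst v / snd v)))"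

text \<open>The map \<open>z \<mapsto> y z + x\<close>, normalised to determinant 1: a continuous
  choice of a matrix that moves \<open>\<i>\<close> to a given point.\<close>

definition hmat :: "real \<Rightarrow> real \<Rightarrow> mat2" where
  "hmat x y = (sqrt y, x / sqrt y, 0, 1 / sqrt y)"

lemma mdet_hmat [simp]: "y > 0 \<Longrightarrow> mdet (hmat x y) = 1"
  by (simp add: hmat_def)

lemma pt_hmat: "y > 0 \<Longrightarrow> pt (hmat x y) = Some (Complex x y)"
  by (simp add: pt_def hmat_def complex_eq_iff Re_divide Im_divide field_simps)

lemma pt_mmul: "mdet A = 1 \<Longrightarrow> mdet B = 1 \<Longrightarrow> pt (mmul A B) = moebius_map A (pt B)"
  by (simp add: pt_def moebius_map_mmul)

lemma denominator_nz:
  assumes "mdet (a, b, c, d) = 1"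
  shows "of_real c * \<i> + of_real d \<noteq> 0" "c\<^sup>2 + d\<^sup>2 > 0"
proof -
  have "c \<noteq> 0 \<or> d \<noteq> 0"
    using assms by auto
  then show "of_real c * \<i> + of_real d \<noteq> 0" "c\<^sup>2 + d\<^sup>2 > 0"
    by (auto simp: complex_eq_iff sum_power2_gt_zero_iff)
qed

lemma pt_eq:
  assumes "mdet (a, b, c, d) = 1"
  shows "pt (a, b, c, d) = Some ((of_real a * \<i> + of_real b) / (of_real c * \<i> + of_real d))"
  using denominator_nz[OF assms] by (simp add: pt_def)

text \<open>The quotient is \<open>2 cosh d\<close> for the hyperbolic distance \<open>d\<close>
  from \<open>\<i>\<close> to \<open>z\<close>, so the norm of a matrix measures how far it moves
  \<open>\<i>\<close>.\<close>

lemma pt_cases: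
  assumes "mdet A = 1"
  obtains z where "pt A = Some z" "Im z > 0" "(norm A)\<^sup>2 = (1 + (cmod z)\<^sup>2) / Im z"
proof -
  obtain a b c d where A: "A = (a, b, c, d)"
    by (metis prod_cases4)
  note nz = denominator_nz[OF assms[unfolded A]]
  have det: "a * d - b * c = 1"
    using assms A by simp
  define z where "z = (of_real a * \<i> + of_real b) / (of_real c * \<i> + of_real d)"
  have Im: "Im z = 1 / (c\<^sup>2 + d\<^sup>2)"
    using det by (simp add: z_def Im_divide power2_eq_square algebra_simps)
  have "(cmod z)\<^sup>2 = (a\<^sup>2 + b\<^sup>2) / (c\<^sup>2 + d\<^sup>2)"
    unfolding z_def norm_divide power_divide by (simp add: cmod_power2 algebra_simps)
  then have "(1 + (cmod z)\<^sup>2) / Im z = (1 + (a\<^sup>2 + b\<^sup>2) / (c\<^sup>2 + d\<^sup>2)) * (c\<^sup>2 + d\<^sup>2)"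
    unfolding Im by simp
  also have "\<dots> = (norm A)\<^sup>2"
  proof -
    have "(a\<^sup>2 + b\<^sup>2) / (c\<^sup>2 + d\<^sup>2) * (c\<^sup>2 + d\<^sup>2) = a\<^sup>2 + b\<^sup>2"
      using nz(2) by (intro nonzero_eq_divide_eq[THEN iffD1] refl) linarith
    then show ?thesis
      unfolding distrib_right A norm_mat2 by simp
  qed
  finally have "(1 + (cmod z)\<^sup>2) / Im z = (norm A)\<^sup>2" .
  then show ?thesis
    using that[of z] nz(2) Im pt_eq[OF assms[unfolded A]] A by (simp add: z_def)
qed

lemma upper_half_plane_eq: "upper_half_plane = {pt A |A. mdet A = 1}"
proof (intro equalityI subsetI)
  fix p
  assume "p \<in> upper_half_plane"
  then obtain z where "p = Some z" "Im z > 0"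
    by (auto simp: upper_half_plane_def)
  then have "p = pt (hmat (Re z) (Im z))" "mdet (hmat (Re z) (Im z)) = 1"
    by (simp_all add: pt_hmat)
  then show "p \<in> {pt A |A. mdet A = 1}"
    by blast
next
  fix p
  assume "p \<in> {pt A |A. mdet A = 1}"
  then obtain A where "p = pt A" "mdet A = 1"
    by blast
  then show "p \<in> upper_half_plane"
    by (metis (mono_tags, lifting) imageI mem_Collect_eq pt_cases upper_half_plane_def)
qed

lemma upper_half_plane_cases:
  assumes "p \<in> upper_half_plane"
  obtains A where "mdet A = 1" "p = pt A"
  using assms unfolding upper_half_plane_eq by blast

lemma bpt_in_ideal_boundary: "bpt v \<in> ideal_boundary"
  by (auto simp: bpt_def ideal_boundary_def)

lemma ideal_boundary_cases:
  assumes "p \<in> ideal_boundary"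
  obtains v where "v \<noteq> 0" "p = bpt v"
proof (cases p)
  case None
  then show ?thesis
    by (intro that[of "(1, 0)"]) (auto simp: bpt_def zero_prod_def)
next
  case (Some z)
  then have "z \<in> \<real>"
    using assms by (auto simp: ideal_boundary_def)
  then obtain t where "z = of_real t"
    by (auto elim: Reals_cases)
  then show ?thesis
    using Some by (intro that[of "(t, 1)"]) (auto simp: bpt_def zero_prod_def)
qed

lemma pt_neq_bpt: "mdet A = 1 \<Longrightarrow> pt A \<noteq> bpt v"
  by (rule pt_cases[of A]) (auto simp: bpt_def)

text \<open>Write \<open>A \<i> = n / m\<close> and \<open>v = (x, y)\<close>. Clearing denominators
  turns the two square roots into \<open>norm A\<close> and \<open>norm v\<close>, and
  \<open>cmod (y n - x m)\<close> is \<open>norm (mapp (madj A) v)\<close>.\<close>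

lemma chordal_pt_bpt:
  assumes A: "mdet A = 1" and v: "v \<noteq> 0"
  shows "chordal (pt A) (bpt v) = 2 * norm (mapp (madj A) v) / (norm A * norm v)"
proof -
  obtain a b c d where Aeq: "A = (a, b, c, d)"
    by (metis prod_cases4)
  obtain x y where veq: "v = (x, y)"
    by (metis surj_pair)
  note nz = denominator_nz[OF A[unfolded Aeq]]
  define n where "n = of_real a * \<i> + (of_real b :: complex)"
  define m where "m = of_real c * \<i> + (of_real d :: complex)"
  have m: "m \<noteq> 0" "cmod m = sqrt (c\<^sup>2 + d\<^sup>2)"
    using nz by (simp_all add: m_def cmod_def add.commute)
  have n: "cmod n = sqrt (a\<^sup>2 + b\<^sup>2)"
    by (simp add: n_def cmod_def add.commute)
  have pt: "pt A = Some (n / m)"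
    using pt_eq[OF A[unfolded Aeq]] by (simp add: Aeq n_def m_def)
  have "1 + (cmod (n / m))\<^sup>2 = (norm A)\<^sup>2 / (cmod m)\<^sup>2"
  proof -
    have "(cmod m)\<^sup>2 = c\<^sup>2 + d\<^sup>2" "(cmod n)\<^sup>2 = a\<^sup>2 + b\<^sup>2"
      by (simp_all add: m n)
    then have "(norm A)\<^sup>2 = (cmod m)\<^sup>2 + (cmod n)\<^sup>2"
      by (simp add: Aeq norm_mat2)
    then show ?thesis
      using m(1) by (simp add: norm_divide power_divide add_divide_distrib)
  qed
  then have s: "sqrt (1 + (cmod (n / m))\<^sup>2) = norm A / cmod m"
    by (simp add: real_sqrt_divide)
  show ?thesis
  proof (cases "y = 0")
    case True
    have "norm (mapp (madj A) v) = \<bar>x\<bar> * cmod m"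
    proof -
      have "norm (mapp (madj A) v) = sqrt (x\<^sup>2 * (c\<^sup>2 + d\<^sup>2))"
        using True by (simp add: Aeq veq norm_prod_def algebra_simps)
      then show ?thesis
        by (simp add: m(2) real_sqrt_mult)
    qed
    moreover have "norm v = \<bar>x\<bar>" "x \<noteq> 0"
      using True v by (auto simp: veq norm_prod_def zero_prod_def)
    ultimately show ?thesis
      using True by (simp add: pt bpt_def veq s)
  next
    case False
    have "1 + (cmod (of_real (x / y)))\<^sup>2 = (norm v)\<^sup>2 / y\<^sup>2"
      unfolding veq norm_pair2 norm_of_real power2_abs using False
      by (simp add: power_divide field_simps)
    then have t: "sqrt (1 + (cmod (of_real (x / y)))\<^sup>2) = norm v / \<bar>y\<bar>"
      by (simp only: real_sqrt_divide real_sqrt_abs abs_norm_cancel)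
    have "n / m - of_real (x / y) = (of_real y * n - of_real x * m) / (m * of_real y)"
      using m False by (simp add: field_simps)
    then have "cmod (n / m - of_real (x / y)) = cmod (of_real y * n - of_real x * m) / (cmod m * \<bar>y\<bar>)"
      by (simp add: norm_divide norm_mult)
    also have "cmod (of_real y * n - of_real x * m) = norm (mapp (madj A) v)"
      by (simp add: n_def m_def cmod_def Aeq veq norm_prod_def power2_commute add.commute algebra_simps)
    finally have "cmod (n / m - of_real (x / y)) = norm (mapp (madj A) v) / (cmod m * \<bar>y\<bar>)" .
    moreover have "bpt v = Some (of_real (x / y))"
      using False by (simp add: bpt_def veq)
    ultimately show ?thesis
      unfolding pt chordal.simps \<open>bpt v = _\<close> s t using m(1) False by (simp add: field_simps)
  qed
qed

interpretation chordal_metric: Metric_space UNIV chordal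
  by (rule Metric_space_chordal)

lemma limitin_sphere_topology:
  "limitin sphere_topology f p sequentially \<longleftrightarrow> (\<lambda>n. chordal (f n) p) \<longlonglongrightarrow> 0"
  unfolding sphere_topology_def by (simp add: chordal_metric.limitin_metric_dist_null)

lemma derived_set_of_sphere_topology:
  "p \<in> sphere_topology derived_set_of A \<longleftrightarrow> (\<forall>r>0. \<exists>q\<in>A. q \<noteq> p \<and> chordal p q < r)"
  unfolding sphere_topology_def by (simp add: chordal_metric.metric_derived_set_of)

lemma chordal_Some_le: "chordal (Some z) (Some w) \<le> 2 * dist z w"
proof -
  have "1 \<le> sqrt (1 + (cmod z)\<^sup>2) * sqrt (1 + (cmod w)\<^sup>2)"
    using mult_mono[of 1 "sqrt (1 + (cmod z)\<^sup>2)" 1 "sqrt (1 + (cmod w)\<^sup>2)"] by simp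
  then show ?thesis
    by (simp add: dist_norm divide_le_eq mult_le_cancel_left1 add_pos_nonneg)
qed

lemma continuous_map_Some: "continuous_map euclidean sphere_topology Some"
proof -
  have "continuous_map (Metric_space.mtopology UNIV dist) (Metric_space.mtopology UNIV chordal) Some"
  proof (subst Metric_space.metric_continuous_map[OF Met_TC.Metric_space_axioms Metric_space_chordal],
      intro conjI ballI allI impI)
    fix z :: complex and e :: real
    assume "e > 0"
    then show "\<exists>\<delta>>0. \<forall>x. x \<in> UNIV \<and> dist z x < \<delta> \<longrightarrow> chordal (Some z) (Some x) < e"
      using chordal_Some_le[of z]
      by (intro exI[of _ "e / 2"]) (fastforce intro: le_less_trans simp del: chordal.simps)
  qed simp
  then show ?thesis
    by (simp add: sphere_topology_def)
qed

lemma chordal_small_imp_close: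
  assumes "e > 0"
  obtains \<delta> where "\<delta> > 0" "\<And>p. chordal (Some z) p < \<delta> \<Longrightarrow> \<exists>w. p = Some w \<and> dist z w < e"
proof -
  define c where "c = chordal (Some z) None"
  have c: "c > 0"
    by (simp add: c_def add_pos_nonneg)
  define K where "K = sqrt (1 + (cmod z)\<^sup>2) * (4 / c)"
  have K: "K > 0"
    using c by (simp add: K_def add_pos_nonneg)
  show ?thesis
  \<comment> \<open>The first bound keeps \<open>p\<close> more than \<open>c / 2\<close> away from
    infinity, which limits its square root to \<open>4 / c\<close>; then \<open>K\<close> bounds the
    product of the two square roots that relate chordal and Euclidean distance.\<close>
  proof (rule that[of "min (c / 2) (e / K)"])
    show "min (c / 2) (e / K) > 0"
      using c K assms by simp
    fix p
    assume p: "chordal (Some z) p < min (c / 2) (e / K)"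
    have "c \<le> chordal (Some z) p + chordal p None"
      unfolding c_def by (rule chordal_metric.triangle) auto
    then have far: "chordal p None > c / 2"
      using p by linarith
    then obtain w where w: "p = Some w"
      using c by (cases p) auto
    have "sqrt (1 + (cmod w)\<^sup>2) > 0"
      by (simp add: add_pos_nonneg)
    then have "sqrt (1 + (cmod w)\<^sup>2) < 4 / c"
      using far c unfolding w by (simp add: field_simps)
    then have "sqrt (1 + (cmod z)\<^sup>2) * sqrt (1 + (cmod w)\<^sup>2) \<le> K"
      unfolding K_def by (intro mult_left_mono) auto
    moreover have "dist z w = chordal (Some z) (Some w) / 2 *
        (sqrt (1 + (cmod z)\<^sup>2) * sqrt (1 + (cmod w)\<^sup>2))"
    proof -
      have "sqrt (1 + (cmod u)\<^sup>2) \<noteq> 0" for u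
        by (metis add_pos_nonneg less_irrefl real_sqrt_gt_zero zero_le_power2 zero_less_one)
      then show ?thesis
        by (simp add: dist_norm)
    qed
    ultimately have "dist z w \<le> chordal (Some z) (Some w) / 2 * K"
      by (metis chordal_metric.nonneg divide_nonneg_nonneg mult_left_mono zero_le_numeral)
    also have "\<dots> < e"
    proof -
      have "chordal (Some z) (Some w) * K < e"
        using p K unfolding w by (simp add: pos_less_divide_eq del: chordal.simps)
      moreover have "chordal (Some z) (Some w) * K \<ge> 0"
        using K by (intro mult_nonneg_nonneg chordal_metric.nonneg) simp
      ultimately show ?thesis
        by linarith
    qed
    finally show "\<exists>w. p = Some w \<and> dist z w < e"
      using w by blast
  qed
qed

lemma chordal_tendsto_Some_iff:
  "(\<lambda>n. chordal (Some (z n)) (Some w)) \<longlonglongrightarrow> 0 \<longleftrightarrow> z \<longlonglongrightarrow> w"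
proof
  assume lim: "(\<lambda>n. chordal (Some (z n)) (Some w)) \<longlonglongrightarrow> 0"
  show "z \<longlonglongrightarrow> w"
    unfolding tendsto_iff
  proof (intro allI impI)
    fix e :: real
    assume "e > 0"
    then obtain \<delta> where \<delta>: "\<delta> > 0" "\<And>p. chordal (Some w) p < \<delta> \<Longrightarrow> \<exists>w'. p = Some w' \<and> dist w w' < e"
      using chordal_small_imp_close by blast
    have "\<forall>\<^sub>F n in sequentially. chordal (Some (z n)) (Some w) < \<delta>"
      using lim \<delta>(1) by (auto simp: order_tendsto_iff)
    then show "\<forall>\<^sub>F n in sequentially. dist (z n) w < e"
      by eventually_elim (use \<delta>(2) in \<open>metis chordal_metric.commute dist_commute option.inject\<close>)
  qed
next
  assume "z \<longlonglongrightarrow> w"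
  then have lim: "(\<lambda>n. 2 * dist (z n) w) \<longlonglongrightarrow> 0"
    using tendsto_dist[OF _ tendsto_const, of z w sequentially w] by (intro tendsto_mult_right_zero) simp
  show "(\<lambda>n. chordal (Some (z n)) (Some w)) \<longlonglongrightarrow> 0"
  proof (rule tendsto_sandwich[OF _ _ tendsto_const lim])
    show "\<forall>\<^sub>F n in sequentially. 0 \<le> chordal (Some (z n)) (Some w)"
      by (intro always_eventually allI chordal_metric.nonneg)
    show "\<forall>\<^sub>F n in sequentially. chordal (Some (z n)) (Some w) \<le> 2 * dist (z n) w"
      by (intro always_eventually allI chordal_Some_le)
  qed
qed

lemma continuous_map_pt: "continuous_map (top_of_set {A. mdet A = 1}) sphere_topology pt"
proof -
  define f where "f A = (of_real (fst A) * \<i> + of_real (fst (snd A))) /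
    (of_real (fst (snd (snd A))) * \<i> + (of_real (snd (snd (snd A))) :: complex))" for A :: mat2
  have f: "pt A = Some (f A)" if "mdet A = 1" for A
    using that by (cases A rule: prod_cases4) (simp add: pt_eq f_def)
  have nz: "of_real (fst (snd (snd A))) * \<i> + (of_real (snd (snd (snd A))) :: complex) \<noteq> 0"
    if "mdet A = 1" for A :: mat2
    using that denominator_nz(1) by (cases A rule: prod_cases4) auto
  have "continuous_on {A. mdet A = 1} f"
    unfolding f_def by (intro continuous_intros) (use nz in auto)
  then have "continuous_map (top_of_set {A. mdet A = 1}) sphere_topology (Some \<circ> f)"
    by (intro continuous_map_compose[OF _ continuous_map_Some]) simp
  then show ?thesis
    by (rule continuous_map_eq) (simp add: f)
qed

section \<open>Escaping sequences and limit sets in terms of matrices\<close>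

text \<open>A bounded subsequence would subconverge to a matrix of determinant 1, and the orbit of
  the base point would converge along it to a point of the half-plane.\<close>

lemma norm_tendsto_infinity_if_escaping:
  fixes F :: "nat \<Rightarrow> mat2"
  assumes det: "\<And>n. mdet (F n) = 1" and esc: "escaping_sequence (\<lambda>n. moebius_map (F n))"
  shows "filterlim (\<lambda>n. norm (F n)) at_top sequentially"
proof (rule ccontr)
  assume "\<not> ?thesis"
  then obtain B where "\<exists>\<^sub>F n in sequentially. norm (F n) < B"
    by (auto simp: filterlim_at_top not_eventually not_le)
  then have "infinite {n. norm (F n) < B}"
    by (simp add: frequently_cofinite flip: cofinite_eq_sequentially)
  from infinite_enumerate[OF this] obtain r where r: "strict_mono (r :: nat \<Rightarrow> nat)"
    "\<And>n. norm (F (r n)) < B"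
    by blast
  then have "bounded (range (F \<circ> r))"
    by (auto simp: bounded_iff intro: less_imp_le)
  then obtain G s where s: "strict_mono (s :: nat \<Rightarrow> nat)" "((F \<circ> r) \<circ> s) \<longlonglongrightarrow> G"
    using bounded_imp_convergent_subsequence by blast
  have rs: "strict_mono (r \<circ> s)"
    using r(1) s(1) by (rule strict_mono_o)
  have G: "mdet G = 1"
    using continuous_on_tendsto_compose[OF continuous_mat2(1) s(2)] det
    by (simp add: o_def LIMSEQ_const_iff)
  obtain w where w: "w \<in> upper_half_plane"
    "\<not> (\<exists>r :: nat \<Rightarrow> nat. \<exists>p\<in>upper_half_plane.
      strict_mono r \<and> limitin sphere_topology (\<lambda>n. moebius_map (F (r n)) w) p sequentially)"
    using esc by (auto simp: escaping_sequence_def)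
  from w(1) obtain W where W: "mdet W = 1" "w = pt W"
    by (rule upper_half_plane_cases)
  \<comment> \<open>This is right multiplication by \<open>W\<close>, expressed through left
    multiplication and \<open>madj\<close>.\<close>
  have "continuous_on UNIV (\<lambda>A. madj (mmul (madj W) (madj A)))"
    by (intro continuous_on_compose2[OF continuous_mat2(3)] continuous_on_compose2[OF continuous_mat2(2)]
        continuous_mat2(3)) auto
  then have "(\<lambda>n. mmul (F (r (s n))) W) \<longlonglongrightarrow> mmul G W"
    using continuous_on_tendsto_compose[OF _ s(2)] by (fastforce simp: madj_mmul)
  then have "limitin (top_of_set {A. mdet A = 1}) (\<lambda>n. mmul (F (r (s n))) W) (mmul G W) sequentially"
    using det G W by (simp add: limitin_subtopology)
  from continuous_map_limit[OF continuous_map_pt this]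
  have "limitin sphere_topology (\<lambda>n. moebius_map (F ((r \<circ> s) n)) w) (pt (mmul G W)) sequentially"
    using det W by (simp add: o_def pt_mmul)
  moreover have "pt (mmul G W) \<in> upper_half_plane"
    unfolding upper_half_plane_eq using G W by (intro CollectI exI[of _ "mmul G W"]) simp
  ultimately show False
    using w(2) rs by blast
qed

text \<open>By \<open>pt_cases\<close> the squared norm is a continuous function of the orbit point,
  so it stays bounded along a subsequence that converges in the half-plane.\<close>

lemma escaping_if_norm_tendsto_infinity:
  fixes F :: "nat \<Rightarrow> mat2"
  assumes det: "\<And>n. mdet (F n) = 1" and lim: "filterlim (\<lambda>n. norm (F n)) at_top sequentially"
  shows "escaping_sequence (\<lambda>n. moebius_map (F n))"
  unfolding escaping_sequence_def
proof (intro conjI bexI[of _ "Some \<i>"] notI)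
  show "range (\<lambda>n. moebius_map (F n)) \<subseteq> carrier moebius_group"
    using det by (blast intro: moebius_map_in_carrier)
  show "Some \<i> \<in> upper_half_plane"
    by (simp add: upper_half_plane_def)
  assume "\<exists>r :: nat \<Rightarrow> nat. \<exists>p\<in>upper_half_plane. strict_mono r \<and>
    limitin sphere_topology (\<lambda>n. moebius_map (F (r n)) (Some \<i>)) p sequentially"
  then obtain r p where r: "strict_mono (r :: nat \<Rightarrow> nat)" "p \<in> upper_half_plane"
    "(\<lambda>n. chordal (pt (F (r n))) p) \<longlonglongrightarrow> 0"
    by (auto simp: limitin_sphere_topology pt_def)
  obtain w where w: "p = Some w" "Im w > 0"
    using r(2) by (auto simp: upper_half_plane_def)
  obtain z where z: "\<And>n. pt (F n) = Some (z n)" "\<And>n. Im (z n) > 0"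
    "\<And>n. (norm (F n))\<^sup>2 = (1 + (cmod (z n))\<^sup>2) / Im (z n)"
  proof -
    have "\<exists>z. pt (F n) = Some z \<and> Im z > 0 \<and> (norm (F n))\<^sup>2 = (1 + (cmod z)\<^sup>2) / Im z" for n
      by (rule pt_cases[OF det[of n]]) blast
    then show ?thesis
      using that by metis
  qed
  have "(\<lambda>n. z (r n)) \<longlonglongrightarrow> w"
    using r(3) by (simp only: z w chordal_tendsto_Some_iff)
  then have "(\<lambda>n. (1 + (cmod (z (r n)))\<^sup>2) / Im (z (r n))) \<longlonglongrightarrow> (1 + (cmod w)\<^sup>2) / Im w"
    using w(2) by (intro tendsto_intros) auto
  then have "(\<lambda>n. (norm (F (r n)))\<^sup>2) \<longlonglongrightarrow> (1 + (cmod w)\<^sup>2) / Im w"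
    by (simp add: z)
  moreover have "filterlim (\<lambda>n. (norm (F (r n)))\<^sup>2) at_top sequentially"
    by (intro filterlim_pow_at_top filterlim_compose[OF lim filterlim_subseq[OF r(1)]]) simp
  ultimately show False
    using not_tendsto_and_filterlim_at_infinity[OF sequentially_bot]
    by (metis filterlim_at_top_imp_at_infinity)
qed

text \<open>For the base point \<open>\<i>\<close> the quotient is, up to a constant, the chordal
  distance. A base point \<open>W \<i>\<close> changes numerator and denominator by at most a factor
  \<open>norm W\<close> each.\<close>

lemma converges_ideally_iff:
  fixes F :: "nat \<Rightarrow> mat2"
  assumes det: "\<And>n. mdet (F n) = 1"
  shows "converges_ideally (\<lambda>n. moebius_map (F n)) \<longleftrightarrow>
    (\<exists>v. v \<noteq> 0 \<and> (\<lambda>n. norm (mapp (madj (F n)) v) / norm (F n)) \<longlonglongrightarrow> 0)"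
proof
  assume "converges_ideally (\<lambda>n. moebius_map (F n))"
  then obtain p w where pw: "p \<in> ideal_boundary" "w \<in> upper_half_plane"
    "(\<lambda>n. chordal (moebius_map (F n) w) p) \<longlonglongrightarrow> 0"
    by (auto simp: converges_ideally_def limitin_sphere_topology)
  obtain v where v: "v \<noteq> 0" "p = bpt v"
    using pw(1) by (rule ideal_boundary_cases)
  obtain W where W: "mdet W = 1" "w = pt W"
    using pw(2) by (rule upper_half_plane_cases)
  have le: "norm (mapp (madj (F n)) v) / norm (F n) \<le>
      (norm W)\<^sup>2 * norm v / 2 * chordal (moebius_map (F n) w) p" for n
  proof -
    have "norm (mapp (madj (F n)) v) \<le> norm W * norm (mapp (madj W) (mapp (madj (F n)) v))"
      using norm_mapp_ge[of "madj W"] W by simp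
    moreover have "norm (mmul (F n) W) \<le> norm (F n) * norm W"
      by (rule norm_mmul_le)
    moreover have "norm (F n) > 0" "norm (mmul (F n) W) > 0"
      by (rule norm_mat2_pos, simp add: det W)+
    ultimately have "norm (mapp (madj (F n)) v) * norm (mmul (F n) W) \<le>
        (norm W * norm (mapp (madj W) (mapp (madj (F n)) v))) * (norm (F n) * norm W)"
      by (intro mult_mono) auto
    then have "norm (mapp (madj (F n)) v) / norm (F n) \<le>
        (norm W)\<^sup>2 * (norm (mapp (madj W) (mapp (madj (F n)) v)) / norm (mmul (F n) W))"
      using \<open>norm (F n) > 0\<close> \<open>norm (mmul (F n) W) > 0\<close>
      by (simp add: field_simps power2_eq_square)
    also have "norm (mapp (madj W) (mapp (madj (F n)) v)) / norm (mmul (F n) W) =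
        norm v / 2 * chordal (moebius_map (F n) w) p"
      using chordal_pt_bpt[of "mmul (F n) W" v] det W v
      by (simp add: pt_mmul madj_mmul mapp_mmul)
    finally show ?thesis
      by simp
  qed
  have "(\<lambda>n. norm (mapp (madj (F n)) v) / norm (F n)) \<longlonglongrightarrow> 0"
  proof (rule tendsto_sandwich[OF _ _ tendsto_const])
    show "(\<lambda>n. (norm W)\<^sup>2 * norm v / 2 * chordal (moebius_map (F n) w) p) \<longlonglongrightarrow> 0"
      using pw(3) by (rule tendsto_mult_right_zero)
  qed (use le in auto)
  then show "\<exists>v. v \<noteq> 0 \<and> (\<lambda>n. norm (mapp (madj (F n)) v) / norm (F n)) \<longlonglongrightarrow> 0"
    using v by blast
next
  assume "\<exists>v. v \<noteq> 0 \<and> (\<lambda>n. norm (mapp (madj (F n)) v) / norm (F n)) \<longlonglongrightarrow> 0"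
  then obtain v where v: "v \<noteq> 0" "(\<lambda>n. norm (mapp (madj (F n)) v) / norm (F n)) \<longlonglongrightarrow> 0"
    by blast
  have "(\<lambda>n. 2 / norm v * (norm (mapp (madj (F n)) v) / norm (F n))) \<longlonglongrightarrow> 0"
    using v(2) by (rule tendsto_mult_right_zero)
  then have "(\<lambda>n. chordal (pt (F n)) (bpt v)) \<longlonglongrightarrow> 0"
    using det v by (simp add: chordal_pt_bpt mult.commute)
  moreover have "Some \<i> \<in> upper_half_plane"
    by (simp add: upper_half_plane_def)
  ultimately show "converges_ideally (\<lambda>n. moebius_map (F n))"
    unfolding converges_ideally_def limitin_sphere_topology
    unfolding pt_def by (intro bexI[of _ "bpt v"] bexI[of _ "Some \<i>"] bpt_in_ideal_boundary)
qed

text \<open>No \<open>A\<close> with \<open>moebius_map A\<close> in \<open>S\<close> lengthens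
  \<open>q\<close>, so an orbit under the inverses stays in one horoball at \<open>q\<close>, whose
  only ideal point is \<open>q\<close>. The unbounded sequence \<open>F\<close> shows that
  \<open>q\<close> really is approached.\<close>

lemma backward_limit_set_eigenvector:
  assumes S: "S \<subseteq> carrier moebius_group" and q: "q \<noteq> 0"
    and eig: "\<And>A. mdet A = 1 \<Longrightarrow> moebius_map A \<in> S \<Longrightarrow> \<exists>t. \<bar>t\<bar> \<ge> 1 \<and> mapp (madj A) q = t *\<^sub>R q"
    and F: "\<And>n. mdet (F n) = 1" "\<And>n. moebius_map (F n) \<in> S"
    and lim: "filterlim (\<lambda>n. norm (F n)) at_top sequentially"
  shows "backward_limit_set S = {bpt q}"
proof -
  have close: "chordal (pt (mmul (madj A) W)) (bpt q) \<le>
      2 * norm (mapp (madj W) q) / (norm (mmul (madj A) W) * norm q)"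
    if A: "mdet A = 1" "moebius_map A \<in> S" and W: "mdet W = 1" for A W
  proof -
    obtain t where t: "\<bar>t\<bar> \<ge> 1" "mapp (madj A) q = t *\<^sub>R q"
      using eig[OF A] by blast
    then have "q = t *\<^sub>R mapp A q"
      using A by (metis mapp_madj_cancel(1) mapp_scaleR(1))
    then have "mapp (madj W) q = t *\<^sub>R mapp (madj W) (mapp A q)"
      by (metis mapp_scaleR(1))
    then have "norm (mapp (madj W) (mapp A q)) \<le> norm (mapp (madj W) q)"
      using mult_right_mono[OF t(1), of "norm (mapp (madj W) (mapp A q))"] by simp
    moreover have "chordal (pt (mmul (madj A) W)) (bpt q) =
        2 * norm (mapp (madj W) (mapp A q)) / (norm (mmul (madj A) W) * norm q)"
      using A W q by (simp add: chordal_pt_bpt madj_mmul mapp_mmul)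
    ultimately show ?thesis
      by (simp add: divide_right_mono)
  qed
  show ?thesis
  proof (intro equalityI subsetI)
    fix p
    assume "p \<in> backward_limit_set S"
    then obtain w where p: "p \<in> ideal_boundary" "w \<in> upper_half_plane"
      "\<And>r. r > 0 \<Longrightarrow> \<exists>q\<in>{g w |g. g \<in> {inv\<^bsub>moebius_group\<^esub> g |g. g \<in> S}}. q \<noteq> p \<and> chordal p q < r"
      by (auto simp: backward_limit_set_def forward_limit_set_def derived_set_of_sphere_topology)
    obtain v where v: "v \<noteq> 0" "p = bpt v"
      using p(1) by (rule ideal_boundary_cases)
    obtain W where W: "mdet W = 1" "w = pt W"
      using p(2) by (rule upper_half_plane_cases)
    define K where "K = norm (mapp (madj W) q) / norm q"
    have K: "K > 0"
      using q W by (simp add: K_def)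
    have "chordal p (bpt q) \<le> 0 + e" if e: "e > 0" for e
    proof -
      \<comment> \<open>A point \<open>B \<i>\<close> has chordal distance at least
        \<open>2 / (norm B)\<^sup>2\<close> from the ideal boundary, so the second bound makes
        \<open>B\<close> large enough for \<open>2 * K / norm B < e / 2\<close>.\<close>
      define r where "r = min (e / 2) (e\<^sup>2 / (8 * K\<^sup>2))"
      have "r > 0"
        using e K by (simp add: r_def)
      then obtain g where g: "g \<in> S" "chordal p ((inv\<^bsub>moebius_group\<^esub> g) w) < r"
        using p(3) by blast
      obtain A where A: "mdet A = 1" "g = moebius_map A"
        using g(1) S by (meson carrier_moebius_group_cases subsetD)
      define B where "B = mmul (madj A) W"
      have B: "mdet B = 1" "(inv\<^bsub>moebius_group\<^esub> g) w = pt B"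
        using A W by (simp_all add: B_def inv_moebius_map pt_mmul)
      have nB: "norm B > 0"
        using B(1) by (rule norm_mat2_pos)
      have "norm v \<le> norm B * norm (mapp (madj B) v)"
        using norm_mapp_ge[of "madj B" v] B by simp
      then have "1 / norm B \<le> norm (mapp (madj B) v) / norm v"
        using nB v by (simp add: field_simps)
      then have "2 / norm B * (1 / norm B) \<le> 2 / norm B * (norm (mapp (madj B) v) / norm v)"
        by (intro mult_left_mono) auto
      then have "2 / (norm B)\<^sup>2 \<le> chordal (pt B) p"
        unfolding v(2) chordal_pt_bpt[OF B(1) v(1)] by (simp add: power2_eq_square)
      then have "2 / (norm B)\<^sup>2 < e\<^sup>2 / (8 * K\<^sup>2)"
        using g(2) B(2) by (simp add: chordal_metric.commute r_def del: chordal.simps)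
      then have "(2 * K / norm B)\<^sup>2 < (e / 2)\<^sup>2"
        using K nB by (simp add: power_divide power_mult_distrib field_simps)
      then have "2 * K / norm B < e / 2"
        by (rule power2_less_imp_less) (use e in simp)
      moreover have "chordal (pt B) (bpt q) \<le> 2 * K / norm B"
        using close[of A W] A g(1) W by (simp add: B_def K_def mult.commute)
      moreover have "chordal p (pt B) < e / 2"
        using g(2) B(2) by (simp add: r_def)
      ultimately show ?thesis
        using chordal_metric.triangle[of p "pt B" "bpt q"] by simp
    qed
    then have "chordal p (bpt q) \<le> 0"
      by (rule field_le_epsilon)
    then show "p \<in> {bpt q}"
      using chordal_metric.zero[of p "bpt q"] chordal_metric.nonneg[of p "bpt q"] by simp
  next
    fix p
    assume "p \<in> {bpt q}"
    then have p: "p = bpt q"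
      by simp
    have "\<exists>y\<in>{g (Some \<i>) |g. g \<in> {inv\<^bsub>moebius_group\<^esub> g |g. g \<in> S}}. y \<noteq> p \<and> chordal p y < r"
      if r: "r > 0" for r
    proof -
      have "\<forall>\<^sub>F n in sequentially. norm (F n) > 2 / r"
        using lim by (simp add: filterlim_at_top_dense)
      then obtain n where n: "norm (F n) > 2 / r"
        by (auto simp: eventually_sequentially)
      have "madj mone = mone"
        by (simp add: mone_def)
      then have "chordal (pt (madj (F n))) (bpt q) \<le> 2 / norm (F n)"
        using close[of "F n" mone] F q by simp
      also have "\<dots> < r"
        using n r norm_mat2_pos[OF F(1), of n] by (simp add: field_simps)
      finally have "chordal p (pt (madj (F n))) < r"
        unfolding p by (simp add: chordal_metric.commute)
      moreover have "pt (madj (F n)) = (inv\<^bsub>moebius_group\<^esub> (moebius_map (F n))) (Some \<i>)"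
        using F by (simp add: inv_moebius_map pt_def)
      moreover have "pt (madj (F n)) \<noteq> p"
        unfolding p using F by (intro pt_neq_bpt) simp
      ultimately show ?thesis
        using F(2)[of n] by blast
    qed
    then show "p \<in> backward_limit_set S"
      unfolding backward_limit_set_def forward_limit_set_def derived_set_of_sphere_topology
      using p bpt_in_ideal_boundary[of q]
      by (intro CollectI conjI bexI[of _ "Some \<i>"]) (auto simp: upper_half_plane_def)
  qed
qed

section \<open>Semigroups of Moebius transformations as matrix semigroups\<close>

text \<open>The full preimage in SL(2, \<real>). It contains \<open>- A\<close> along with
  \<open>A\<close>, so closure under products needs no choice of signs.\<close>

definition lifts :: "moebius set \<Rightarrow> mat2 set" where
  "lifts S = {A. mdet A = 1 \<and> moebius_map A \<in> S}"

lemma lifts_iff: "A \<in> lifts S \<longleftrightarrow> mdet A = 1 \<and> moebius_map A \<in> S"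
  by (simp add: lifts_def)

lemma matrix_semigroup_lifts:
  assumes "moebius_semigroup S"
  shows "matrix_semigroup (lifts S)"
  using assms by (simp add: matrix_semigroup_def moebius_semigroup_def lifts_iff moebius_map_mmul)

lemma moebius_semigroup_cases:
  assumes "moebius_semigroup S" "g \<in> S"
  obtains A where "A \<in> lifts S" "g = moebius_map A"
proof -
  have "g \<in> carrier moebius_group"
    using assms by (auto simp: moebius_semigroup_def)
  then obtain A where "mdet A = 1" "g = moebius_map A"
    by (rule carrier_moebius_group_cases)
  then show ?thesis
    using assms by (intro that[of A]) (simp_all add: lifts_iff)
qed

lemma semidiscrete_neighbourhood:
  assumes "semidiscrete S"
  obtains U where "openin moebius_topology U" "id \<in> U" "\<And>g. g \<in> S \<Longrightarrow> g \<in> U \<Longrightarrow> g = id"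
proof -
  have "id \<in> topspace moebius_topology"
    using moebius_map_in_carrier[of mone] by (simp add: topspace_moebius_topology)
  then show ?thesis
    using assms that by (auto simp: semidiscrete_def derived_set_of_def)
qed

lemma semidiscrete_lifts:
  assumes "semidiscrete S"
  obtains \<delta> where "\<delta> > 0" "\<And>A. A \<in> lifts S \<Longrightarrow> norm (A - mone) < \<delta> \<Longrightarrow> moebius_map A = id"
proof -
  obtain U where U: "openin moebius_topology U" "id \<in> U" "\<And>g. g \<in> S \<Longrightarrow> g \<in> U \<Longrightarrow> g = id"
    using semidiscrete_neighbourhood[OF assms] by blast
  have coeffs: "A \<in> moebius_coeffs" if "mdet A = 1" for A
    using that by (cases A rule: prod_cases4) (simp add: moebius_coeffs_def)
  have "openin (top_of_set moebius_coeffs) {A \<in> moebius_coeffs. moebius_map A \<in> U}"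
    using U(1) by (simp add: moebius_topology_def openin_quotient_topology)
  moreover have "mone \<in> {A \<in> moebius_coeffs. moebius_map A \<in> U}"
    using U(2) coeffs by simp
  ultimately obtain \<delta> where \<delta>: "\<delta> > 0"
    "\<And>A. A \<in> moebius_coeffs \<Longrightarrow> dist A mone < \<delta> \<Longrightarrow> A \<in> {A \<in> moebius_coeffs. moebius_map A \<in> U}"
    unfolding openin_euclidean_subtopology_iff by blast
  show ?thesis
  proof (rule that[OF \<delta>(1)])
    fix A
    assume A: "A \<in> lifts S" "norm (A - mone) < \<delta>"
    then have "A \<in> {A \<in> moebius_coeffs. moebius_map A \<in> U}"
      using coeffs by (intro \<delta>(2)) (auto simp: lifts_iff dist_norm)
    then show "moebius_map A = id"
      using A U(3) by (simp add: lifts_iff)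
  qed
qed

section \<open>From coarse density to cocompact groups\<close>

text \<open>The norm is a function of the hyperbolic distance from \<open>A \<i>\<close> to
  \<open>h \<i>\<close>: some fixed radius suffices for every ball of that radius to meet the orbit
  of \<open>\<i>\<close>.\<close>

definition coarsely_dense :: "mat2 set \<Rightarrow> bool" where
  "coarsely_dense T \<longleftrightarrow> (\<exists>R>0. \<forall>h. mdet h = 1 \<longrightarrow> (\<exists>A\<in>T. norm (mmul (madj A) h) \<le> R))"

text \<open>Semidiscreteness turns a product \<open>mmul A B\<close> close to \<open>mone\<close>
  into the identity map, so \<open>B\<close> acts as the inverse of \<open>A\<close>. If
  \<open>B\<close> is the adjoined \<open>mone\<close>, then \<open>A\<close> itself acts as the
  identity, which therefore belongs to \<open>S\<close>.\<close>

lemma group_if_coarsely_dense: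
  assumes S: "moebius_semigroup S" "semidiscrete S"
    and dense: "coarsely_dense (insert mone (lifts S))"
  shows "mone \<in> lifts S" "A \<in> lifts S \<Longrightarrow> madj A \<in> lifts S"
proof -
  note T = matrix_semigroup_lifts[OF S(1)]
  obtain \<delta> where \<delta>: "\<delta> > 0" "\<And>A. A \<in> lifts S \<Longrightarrow> norm (A - mone) < \<delta> \<Longrightarrow> moebius_map A = id"
    using semidiscrete_lifts[OF S(2)] by blast
  obtain R where R: "\<And>h. mdet h = 1 \<Longrightarrow> \<exists>B\<in>insert mone (lifts S). norm (mmul (madj B) h) \<le> R"
    using dense unfolding coarsely_dense_def by blast
  have inverse: "id \<in> S \<and> moebius_map (madj A) \<in> S" if A: "A \<in> lifts S" for A
  proof -
    obtain B where B: "B \<in> insert mone (lifts S)" "norm (mmul A B - mone) < \<delta>"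
      using approximate_inverse_if_coarsely_dense[OF T R A \<delta>(1)] by blast
    have AB: "mmul A B \<in> lifts S"
      using A B(1) matrix_semigroupD(2)[OF T A, of B] by auto
    then have id: "moebius_map (mmul A B) = id"
      using \<delta>(2) B(2) by blast
    have det: "mdet A = 1" "mdet B = 1"
      using A B(1) by (auto simp: lifts_iff)
    have "moebius_map (madj A) = moebius_map (madj A) \<circ> moebius_map (mmul A B)"
      by (simp add: id)
    also have "\<dots> = moebius_map (mmul (madj A) (mmul A B))"
      using det by (simp add: moebius_map_mmul del: mmul_madj_cancel)
    finally have "moebius_map (madj A) = moebius_map B"
      using det by simp
    moreover have "id \<in> S"
      using AB id by (simp add: lifts_iff)
    ultimately show ?thesis
      using B(1) by (auto simp: lifts_iff)
  qed
  obtain g where "g \<in> S"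
    using S(1) by (auto simp: moebius_semigroup_def)
  then show "mone \<in> lifts S"
    using inverse by (metis S(1) lifts_iff mdet_mone moebius_map_mone moebius_semigroup_cases)
  show "A \<in> lifts S \<Longrightarrow> madj A \<in> lifts S"
    using inverse by (simp add: lifts_iff)
qed

lemma orbit_moebius_map:
  assumes S: "moebius_semigroup S" and A: "A \<in> lifts S" "madj A \<in> lifts S"
  shows "orbit S (moebius_map A p) = orbit S p"
proof (intro equalityI subsetI)
  fix y
  assume "y \<in> orbit S (moebius_map A p)"
  then obtain g where "g \<in> S" "y = (g \<circ> moebius_map A) p"
    by (auto simp: orbit_def)
  moreover have "g \<circ> moebius_map A \<in> S"
    using \<open>g \<in> S\<close> A S by (simp add: moebius_semigroup_def lifts_iff)
  ultimately show "y \<in> orbit S p"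
    unfolding orbit_def by blast
next
  fix y
  assume "y \<in> orbit S p"
  then obtain g where g: "g \<in> S" "y = g p"
    by (auto simp: orbit_def)
  have "(moebius_map (madj A) \<circ> moebius_map A) p = p"
    using A by (simp add: lifts_iff del: o_apply)
  then have "y = (g \<circ> moebius_map (madj A)) (moebius_map A p)"
    using g by simp
  moreover have "g \<circ> moebius_map (madj A) \<in> S"
    using g A S by (simp add: moebius_semigroup_def lifts_iff)
  ultimately show "y \<in> orbit S (moebius_map A p)"
    unfolding orbit_def by blast
qed

text \<open>Left translation by \<open>g\<close> carries a neighbourhood that isolates the identity
  to one that isolates \<open>g\<close>; the translate is checked to be open on the level of
  matrices.\<close>

lemma fuchsian_if_semidiscrete_group:
  assumes S: "moebius_semigroup S" "semidiscrete S"
    and adj: "\<And>A. A \<in> lifts S \<Longrightarrow> madj A \<in> lifts S"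
  shows "fuchsian_group S"
  unfolding fuchsian_group_def
proof
  interpret group moebius_group
    by (rule group_moebius_group)
  have inv: "inv\<^bsub>moebius_group\<^esub> g \<in> S" if "g \<in> S" for g
    using S(1) that adj by (auto elim!: moebius_semigroup_cases simp: lifts_iff inv_moebius_map)
  show "subgroup S moebius_group"
    using S(1) inv by (intro subgroupI) (auto simp: moebius_semigroup_def moebius_group_def)
  obtain U where U: "openin moebius_topology U" "id \<in> U" "\<And>g. g \<in> S \<Longrightarrow> g \<in> U \<Longrightarrow> g = id"
    using semidiscrete_neighbourhood[OF S(2)] by blast
  have "g \<notin> moebius_topology derived_set_of S" if gS: "g \<in> S" for g
  proof
    assume g': "g \<in> moebius_topology derived_set_of S"
    obtain G where G: "G \<in> lifts S" "g = moebius_map G"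
      using S(1) gS by (rule moebius_semigroup_cases)
    have detG: "mdet G = 1"
      using G by (simp add: lifts_iff)
    have coeffs: "moebius_coeffs = {A. mdet A > 0}"
      by (auto simp: moebius_coeffs_def)
    define T where "T = {f \<in> carrier moebius_group. moebius_map (madj G) \<circ> f \<in> U}"
    have "openin (top_of_set moebius_coeffs) {A \<in> moebius_coeffs. moebius_map A \<in> T}"
    proof -
      have "continuous_map (top_of_set moebius_coeffs) (top_of_set moebius_coeffs) (mmul (madj G))"
        using detG continuous_on_subset[OF continuous_mat2(2)] by (auto simp: coeffs simp del: madj.simps)
      moreover have "openin (top_of_set moebius_coeffs) {A \<in> moebius_coeffs. moebius_map A \<in> U}"
        using U(1) by (simp add: moebius_topology_def openin_quotient_topology)
      ultimately have "openin (top_of_set moebius_coeffs)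
          {A \<in> topspace (top_of_set moebius_coeffs).
            mmul (madj G) A \<in> {A \<in> moebius_coeffs. moebius_map A \<in> U}}"
        by (rule openin_continuous_map_preimage)
      also have "{A \<in> topspace (top_of_set moebius_coeffs).
            mmul (madj G) A \<in> {A \<in> moebius_coeffs. moebius_map A \<in> U}} =
          {A \<in> moebius_coeffs. moebius_map A \<in> T}"
      proof -
        have "moebius_map (mmul (madj G) A) = moebius_map (madj G) \<circ> moebius_map A"
          "mdet (mmul (madj G) A) = mdet A" "moebius_map A \<in> carrier moebius_group"
          if "A \<in> moebius_coeffs" for A
          using that detG by (auto simp: coeffs moebius_map_mmul moebius_group_def)
        then show ?thesis
          unfolding T_def coeffs by auto
      qed
      finally show ?thesis .
    qed
    then have "openin moebius_topology T"
      by (auto simp: moebius_topology_def openin_quotient_topology T_def moebius_group_def)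
    moreover have "g \<in> T"
      using G(2) detG U(2) by (simp add: T_def moebius_map_in_carrier)
    ultimately obtain y where y: "y \<noteq> g" "y \<in> S" "y \<in> T"
      using g' by (auto simp: derived_set_of_def)
    have "moebius_map (madj G) \<circ> y \<in> S"
      using S(1) adj[OF G(1)] y(2) by (simp add: moebius_semigroup_def lifts_iff)
    then have "moebius_map (madj G) \<circ> y = id"
      using y(3) U(3) by (simp add: T_def)
    then have "moebius_map G \<circ> (moebius_map (madj G) \<circ> y) = moebius_map G"
      by simp
    then show False
      using y(1) G(2) detG by (simp flip: comp_assoc)
  qed
  moreover have "S \<subseteq> topspace moebius_topology"
    using S(1) by (simp add: moebius_semigroup_def topspace_moebius_topology)
  ultimately show "subtopology moebius_topology S = discrete_topology S"
    by (auto simp: subtopology_eq_discrete_topology_eq)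
qed

lemma topspace_sphere_topology [simp]: "topspace sphere_topology = UNIV"
  by (simp add: sphere_topology_def)

lemma topspace_orbit_space: "topspace (orbit_space S) = orbit S ` upper_half_plane"
  by (simp add: orbit_space_def topspace_quotient_topology)

text \<open>The quotient is the image of a compact set, namely of the points \<open>A \<i>\<close>
  with \<open>norm A \<le> R\<close>.\<close>

lemma cocompact_if_coarsely_dense:
  assumes S: "moebius_semigroup S" "semidiscrete S"
    and dense: "coarsely_dense (insert mone (lifts S))"
  shows "cocompact_fuchsian_group S"
  unfolding cocompact_fuchsian_group_def
proof
  note gr = group_if_coarsely_dense[OF assms]
  show "fuchsian_group S"
    using S gr(2) by (rule fuchsian_if_semidiscrete_group)
  obtain R where R: "\<And>h. mdet h = 1 \<Longrightarrow> \<exists>A\<in>lifts S. norm (mmul (madj A) h) \<le> R"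
    using dense unfolding coarsely_dense_def insert_absorb[OF gr(1)] by blast
  define K where "K = {A :: mat2. mdet A = 1} \<inter> cball 0 R"
  have "closed {A :: mat2. mdet A = 1}"
    using continuous_mat2(1) by (intro closed_Collect_eq continuous_on_const)
  then have "compact K"
    unfolding K_def by (intro closed_Int_compact compact_cball)
  then have "compactin (top_of_set {A. mdet A = 1}) K"
    by (auto simp: compactin_subtopology K_def)
  then have "compactin sphere_topology (pt ` K)"
    using continuous_map_pt by (rule image_compactin)
  moreover have "pt ` K \<subseteq> upper_half_plane"
    by (auto simp: K_def upper_half_plane_eq simp del: mdet.simps)
  ultimately have "compactin (subtopology sphere_topology upper_half_plane) (pt ` K)"
    by (simp add: compactin_subtopology)
  moreover have "continuous_map (subtopology sphere_topology upper_half_plane) (orbit_space S) (orbit S)"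
    unfolding orbit_space_def
    by (intro quotient_imp_continuous_map quotient_map_quotient_topology)
  ultimately have "compactin (orbit_space S) (orbit S ` pt ` K)"
    by (rule image_compactin)
  moreover have "orbit S ` pt ` K = topspace (orbit_space S)"
    unfolding topspace_orbit_space
  proof
    show "orbit S ` pt ` K \<subseteq> orbit S ` upper_half_plane"
      using \<open>pt ` K \<subseteq> upper_half_plane\<close> by blast
    show "orbit S ` upper_half_plane \<subseteq> orbit S ` pt ` K"
    proof
      fix y
      assume "y \<in> orbit S ` upper_half_plane"
      then obtain h where h: "mdet h = 1" "y = orbit S (pt h)"
        by (auto simp: upper_half_plane_eq simp del: mdet.simps)
      obtain A where A: "A \<in> lifts S" "norm (mmul (madj A) h) \<le> R"
        using R[OF h(1)] by blast
      have detA: "mdet A = 1"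
        using A by (simp add: lifts_iff)
      have "pt h = moebius_map A (pt (mmul (madj A) h))"
        using pt_mmul[of A "mmul (madj A) h"] detA h by simp
      then have "y = orbit S (pt (mmul (madj A) h))"
        using h(2) orbit_moebius_map[OF S(1) A(1) gr(2)[OF A(1)]] by simp
      moreover have "mmul (madj A) h \<in> K"
        using A detA h by (simp add: K_def)
      ultimately show "y \<in> orbit S ` pt ` K"
        by blast
    qed
  qed
  ultimately show "compact_space (orbit_space S)"
    by (simp add: compact_space_def)
qed

section \<open>From cocompact groups to coarse density\<close>

lemma norm_eq_if_pt_eq:
  assumes "mdet A = 1" "mdet B = 1" "pt A = pt B"
  shows "norm A = norm B"
proof -
  have "(norm A)\<^sup>2 = (norm B)\<^sup>2"
    using pt_cases[OF assms(1)] pt_cases[OF assms(2)] assms(3) by (metis option.inject)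
  then show ?thesis
    by simp
qed

lemma openin_sphere_topology_Some:
  assumes "open N"
  shows "openin sphere_topology (Some ` N)"
  unfolding sphere_topology_def chordal_metric.openin_mtopology
proof (intro conjI allI impI)
  fix p :: "complex option"
  assume "p \<in> Some ` N"
  then obtain z where z: "z \<in> N" "p = Some z"
    by blast
  obtain e where e: "e > 0" "ball z e \<subseteq> N"
    using assms z(1) open_contains_ball by blast
  obtain \<delta> where \<delta>: "\<delta> > 0" "\<And>q. chordal (Some z) q < \<delta> \<Longrightarrow> \<exists>w. q = Some w \<and> dist z w < e"
    using chordal_small_imp_close[OF e(1)] by blast
  have "chordal_metric.mball p \<delta> \<subseteq> Some ` N"
    using \<delta>(2) e(2) z(2) by (fastforce simp: chordal_metric.mball_def simp del: chordal.simps)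
  then show "\<exists>r>0. chordal_metric.mball p r \<subseteq> Some ` N"
    using \<delta>(1) by blast
qed simp

lemma group_lifts_if_subgroup:
  assumes "subgroup S moebius_group"
  shows "moebius_semigroup S" "mone \<in> lifts S" "A \<in> lifts S \<Longrightarrow> madj A \<in> lifts S"
proof -
  show "moebius_semigroup S" "mone \<in> lifts S"
    using subgroup.subset[OF assms] subgroup.m_closed[OF assms] subgroup.one_closed[OF assms]
    by (auto simp: moebius_semigroup_def moebius_group_def lifts_iff)
  show "A \<in> lifts S \<Longrightarrow> madj A \<in> lifts S"
    using subgroup.m_inv_closed[OF assms, of "moebius_map A"] by (simp add: lifts_iff inv_moebius_map)
qed

text \<open>The orbits that meet the ball given by \<open>norm h < real n\<close> form an open set
  \<open>V n\<close> of the quotient. These sets cover it, and a finite subcover provides a uniform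
  radius.\<close>

lemma coarsely_dense_if_cocompact:
  assumes "cocompact_fuchsian_group S"
  shows "coarsely_dense (lifts S)"
proof -
  have "subgroup S moebius_group" and cpt: "compact_space (orbit_space S)"
    using assms by (auto simp: cocompact_fuchsian_group_def fuchsian_group_def)
  note gr = group_lifts_if_subgroup[OF this(1)]
  define V where "V n = orbit S ` {pt h |h. mdet h = 1 \<and> norm h < real n}" for n :: nat
  have mem_V: "orbit S (pt k) \<in> V n \<longleftrightarrow> (\<exists>A\<in>lifts S. norm (mmul (madj A) k) < real n)"
    if k: "mdet k = 1" for k n
  proof
    assume "orbit S (pt k) \<in> V n"
    then obtain h where h: "mdet h = 1" "norm h < real n" "orbit S (pt k) = orbit S (pt h)"
      by (auto simp: V_def simp del: mdet.simps)
    have "id \<in> S"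
      using gr(2) by (simp add: lifts_iff)
    then have "pt k \<in> orbit S (pt k)"
      unfolding orbit_def by (intro CollectI exI[of _ id]) simp
    then obtain g where "g \<in> S" "pt k = g (pt h)"
      using h(3) by (auto simp: orbit_def)
    then obtain A where A: "A \<in> lifts S" "pt k = moebius_map A (pt h)"
      using gr(1) by (metis moebius_semigroup_cases)
    have detA: "mdet A = 1"
      using A by (simp add: lifts_iff)
    have "pt (mmul (madj A) k) = (moebius_map (madj A) \<circ> moebius_map A) (pt h)"
      using A(2) detA k by (simp add: pt_mmul del: moebius_map_madj)
    also have "\<dots> = pt h"
      using detA by (simp del: o_apply)
    finally have "norm (mmul (madj A) k) = norm h"
      using detA k h(1) by (intro norm_eq_if_pt_eq) simp_all
    then show "\<exists>A\<in>lifts S. norm (mmul (madj A) k) < real n"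
      using A(1) h(2) by (intro bexI[of _ A]) simp_all
  next
    assume "\<exists>A\<in>lifts S. norm (mmul (madj A) k) < real n"
    then obtain A where A: "A \<in> lifts S" "norm (mmul (madj A) k) < real n"
      by blast
    have detA: "mdet A = 1"
      using A by (simp add: lifts_iff)
    have "pt k = moebius_map A (pt (mmul (madj A) k))"
      using pt_mmul[of A "mmul (madj A) k"] detA k by simp
    then have "orbit S (pt k) = orbit S (pt (mmul (madj A) k))"
      using orbit_moebius_map[OF gr(1) A(1) gr(3)[OF A(1)]] by simp
    then show "orbit S (pt k) \<in> V n"
      unfolding V_def using A(2) detA k by (intro image_eqI CollectI exI[of _ "mmul (madj A) k"]) auto
  qed
  have "openin (orbit_space S) (V n)" for n
  proof -
    \<comment> \<open>Since \<open>hmat\<close> depends continuously on the point, the criterion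
      \<open>mem_V\<close> becomes an open condition on \<open>z\<close>.\<close>
    define N where "N = (\<Union>A\<in>lifts S. {z. Im z > 0} \<inter>
      (\<lambda>z. norm (mmul (madj A) (hmat (Re z) (Im z)))) -` {..<real n})"
    have "open N"
      unfolding N_def
    proof (intro open_UN ballI continuous_open_preimage)
      fix A
      have "continuous_on {z. Im z > 0} (\<lambda>z. hmat (Re z) (Im z))"
        unfolding hmat_def by (intro continuous_intros) auto
      then have "continuous_on {z. Im z > 0} (\<lambda>z. mmul (madj A) (hmat (Re z) (Im z)))"
        by (intro continuous_on_compose2[OF continuous_mat2(2)]) auto
      then show "continuous_on {z. Im z > 0} (\<lambda>z. norm (mmul (madj A) (hmat (Re z) (Im z))))"
        by (rule continuous_on_norm)
    qed (auto simp: open_halfspace_Im_gt)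
    have "{x \<in> topspace (subtopology sphere_topology upper_half_plane). orbit S x \<in> V n} = Some ` N"
    proof -
      have "orbit S (Some z) \<in> V n \<longleftrightarrow> z \<in> N" if z: "Im z > 0" for z
      proof -
        have "Some z = pt (hmat (Re z) (Im z))"
          using z by (simp add: pt_hmat)
        then show ?thesis
          using mem_V[of "hmat (Re z) (Im z)" n] z by (auto simp: N_def simp del: madj.simps mmul.simps)
      qed
      moreover have "Im z > 0" if "z \<in> N" for z
        using that by (auto simp: N_def)
      ultimately show ?thesis
        by (auto simp: upper_half_plane_def)
    qed
    moreover have "openin (subtopology sphere_topology upper_half_plane) (Some ` N)"
    proof -
      have "Some ` N \<subseteq> upper_half_plane"
        by (auto simp: N_def upper_half_plane_def)
      then show ?thesis
        using openin_sphere_topology_Some[OF \<open>open N\<close>]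
        by (simp add: openin_subset_topspace_eq openin_subtopology) (metis Int_absorb2)
    qed
    moreover have "V n \<subseteq> orbit S ` upper_half_plane"
      unfolding V_def upper_half_plane_eq by blast
    ultimately show ?thesis
      by (simp add: orbit_space_def openin_quotient_topology)
  qed
  moreover have "topspace (orbit_space S) \<subseteq> \<Union>(range V)"
  proof
    fix y
    assume "y \<in> topspace (orbit_space S)"
    then obtain h where h: "mdet h = 1" "y = orbit S (pt h)"
      by (auto simp: topspace_orbit_space upper_half_plane_eq simp del: mdet.simps)
    obtain n where "norm h < real n"
      using reals_Archimedean2 by blast
    then have "y \<in> V n"
      unfolding V_def using h by blast
    then show "y \<in> \<Union>(range V)"
      by blast
  qed
  ultimately obtain \<F> where \<F>: "finite \<F>" "\<F> \<subseteq> range V" "topspace (orbit_space S) \<subseteq> \<Union>\<F>"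
    using cpt unfolding compact_space_alt by (metis rangeE)
  obtain I where I: "finite I" "\<F> = V ` I"
    using finite_subset_image[OF \<F>(1,2)] by blast
  \<comment> \<open>The inserted 1 keeps the maximum defined and positive.\<close>
  define R where "R = real (Max (insert 1 I))"
  have "\<exists>A\<in>lifts S. norm (mmul (madj A) h) \<le> R" if h: "mdet h = 1" for h
  proof -
    have "orbit S (pt h) \<in> topspace (orbit_space S)"
      unfolding topspace_orbit_space upper_half_plane_eq using h by blast
    then obtain n where n: "n \<in> I" "orbit S (pt h) \<in> V n"
      using \<F>(3) I(2) by auto
    then obtain A where A: "A \<in> lifts S" "norm (mmul (madj A) h) < real n"
      using mem_V[OF h] by blast
    moreover have "real n \<le> R"
      using n(1) I(1) by (simp add: R_def)
    ultimately show ?thesis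
      by (intro bexI[of _ A]) auto
  qed
  moreover have "R > 0"
    using I(1) by (simp add: R_def Max_gr_iff)
  ultimately show ?thesis
    by (auto simp: coarsely_dense_def)
qed

section \<open>Divergent escaping composition sequences\<close>

text \<open>One lift is fixed for each generator; finiteness of \<open>F\<close> then bounds the
  norms of all steps. A non-attracting direction would be the only point of the backward limit set,
  so all directions are attracting.\<close>

lemma cocompact_if_divergent_composition_sequence:
  assumes F: "F \<subseteq> carrier moebius_group" "finite F"
    and S: "S = semigroup_generated F" "moebius_semigroup S" "semidiscrete S"
    and backward: "card (backward_limit_set S) \<noteq> 1"
    and X: "composition_sequence F X" "escaping_sequence X" "\<not> converges_ideally X"
  shows "cocompact_fuchsian_group S"
proof -
  obtain f where f: "\<And>n. f n \<in> F" "X 0 = f 0" "\<And>n. X (Suc n) = X n \<circ> f (Suc n)"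
    using X(1) by (auto simp: composition_sequence_def)
  have "\<exists>A. A \<in> lifts S \<and> g = moebius_map A" if "g \<in> F" for g
    using that S by (metis moebius_semigroup_cases semigroup_generated.generator)
  then obtain L where L: "\<And>g. g \<in> F \<Longrightarrow> L g \<in> lifts S" "\<And>g. g \<in> F \<Longrightarrow> moebius_map (L g) = g"
    by metis
  define G where "G n = L (f n)" for n
  define P where "P = rec_nat (G 0) (\<lambda>n A. mmul A (G (Suc n)))"
  note T = matrix_semigroup_lifts[OF S(2)]
  have G: "G n \<in> lifts S" "moebius_map (G n) = f n" for n
    using L f by (simp_all add: G_def)
  have P_Suc: "P (Suc n) = mmul (P n) (G (Suc n))" for n
    by (simp add: P_def)
  have P: "P n \<in> lifts S" for n
  proof (induction n)
    case 0
    then show ?case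
      using G by (simp add: P_def)
  next
    case (Suc n)
    then show ?case
      unfolding P_Suc using G by (intro matrix_semigroupD(2)[OF T])
  qed
  have detP: "mdet (P n) = 1" for n
    using P by (simp add: lifts_iff)
  have XP: "X = (\<lambda>n. moebius_map (P n))"
  proof
    show "X n = moebius_map (P n)" for n
    proof (induction n)
      case 0
      then show ?case
        using f(2) G(2) by (simp add: P_def)
    next
      case (Suc n)
      then show ?case
        using f(3) G P by (simp add: P_Suc moebius_map_mmul lifts_iff)
    qed
  qed
  have esc: "filterlim (\<lambda>n. norm (P n)) at_top sequentially"
    using X(2) unfolding XP by (intro norm_tendsto_infinity_if_escaping detP)
  have div: "\<not> (\<lambda>n. norm (mapp (madj (P n)) v) / norm (P n)) \<longlonglongrightarrow> 0" if "v \<noteq> 0" for v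
    using X(3) that unfolding XP converges_ideally_iff[OF detP] by blast
  obtain M where M: "\<And>g. g \<in> F \<Longrightarrow> norm (L g) \<le> M"
    using finite_imp_bounded[OF finite_imageI[OF F(2)], of L] by (auto simp: bounded_iff)
  have parallel: "wedge y y' = 0"
    if "\<not> attracting (lifts S) y" "\<not> attracting (lifts S) y'" for y y'
    by (rule not_attracting_parallel[OF T detP _ P_Suc _ esc div that])
      (use G M f in \<open>auto simp: G_def\<close>)
  have "attracting (lifts S) v" if v: "v \<noteq> 0" for v
  proof (rule ccontr)
    assume bad: "\<not> attracting (lifts S) v"
    have "backward_limit_set S = {bpt v}"
    proof (rule backward_limit_set_eigenvector[OF _ v _ detP _ esc])
      show "S \<subseteq> carrier moebius_group"
        using S(2) by (simp add: moebius_semigroup_def)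
      show "moebius_map (P n) \<in> S" for n
        using P by (simp add: lifts_iff)
      show "\<exists>t. \<bar>t\<bar> \<ge> 1 \<and> mapp (madj A) v = t *\<^sub>R v" if "mdet A = 1" "moebius_map A \<in> S" for A
        by (rule unique_not_attracting_eigenvector[OF T parallel[OF bad] bad v, of A])
          (use that in \<open>auto simp: lifts_iff\<close>)
    qed
    then show False
      using backward by simp
  qed
  then obtain R where "R > 0" "\<And>h. mdet h = 1 \<Longrightarrow> \<exists>A\<in>insert mone (lifts S). norm (mmul (madj A) h) \<le> R"
    using attracting_imp_coarsely_dense[OF T] by blast
  then have "coarsely_dense (insert mone (lifts S))"
    unfolding coarsely_dense_def by blast
  with S(2,3) show ?thesis
    by (rule cocompact_if_coarsely_dense)
qed

section \<open>Divergent composition sequences in cocompact groups\<close>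

text \<open>Among infinitely many maps with bounded lifts, two have lifts so close that their
  quotient is within \<open>\<delta>\<close> of \<open>mone\<close>. Then the quotient acts as the
  identity and the two maps coincide.\<close>

lemma finite_bounded_lifts:
  assumes S: "moebius_semigroup S" "semidiscrete S"
    and adj: "\<And>A. A \<in> lifts S \<Longrightarrow> madj A \<in> lifts S"
  shows "finite (moebius_map ` {A \<in> lifts S. norm A \<le> B})"
proof (rule ccontr)
  note T = matrix_semigroup_lifts[OF S(1)]
  obtain \<delta> where \<delta>: "\<delta> > 0" "\<And>A. A \<in> lifts S \<Longrightarrow> norm (A - mone) < \<delta> \<Longrightarrow> moebius_map A = id"
    using semidiscrete_lifts[OF S(2)] by blast
  assume "infinite (moebius_map ` {A \<in> lifts S. norm A \<le> B})"
  then obtain m where m: "inj (m :: nat \<Rightarrow> moebius)" "range m \<subseteq> moebius_map ` {A \<in> lifts S. norm A \<le> B}"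
    using infinite_countable_subset by blast
  then have "\<exists>A. A \<in> lifts S \<and> norm A \<le> B \<and> m n = moebius_map A" for n
    by blast
  then obtain A where A: "\<And>n. A n \<in> lifts S" "\<And>n. norm (A n) \<le> B" "\<And>n. m n = moebius_map (A n)"
    by metis
  have detA: "mdet (A n) = 1" for n
    using A(1) by (simp add: lifts_iff)
  have "norm (A 0) > 0"
    using detA by (rule norm_mat2_pos)
  then have B: "B > 0"
    using A(2)[of 0] by linarith
  have "bounded (range A)"
    using A(2) by (auto simp: bounded_iff)
  then obtain l r where r: "strict_mono (r :: nat \<Rightarrow> nat)" "(A \<circ> r) \<longlonglongrightarrow> l"
    using bounded_imp_convergent_subsequence by blast
  then have "Cauchy (A \<circ> r)"
    using LIMSEQ_imp_Cauchy by blast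
  moreover have "\<delta> / B > 0"
    using \<delta>(1) B by simp
  ultimately obtain N where N: "\<And>i j. i \<ge> N \<Longrightarrow> j \<ge> N \<Longrightarrow> dist (A (r i)) (A (r j)) < \<delta> / B"
    unfolding Cauchy_def comp_apply by blast
  define i where "i = r N"
  define j where "j = r (Suc N)"
  have "i \<noteq> j"
    using strict_mono_less[OF r(1), of N "Suc N"] by (simp add: i_def j_def)
  have "mmul (madj (A i)) (A j) - mone = mmul (madj (A i)) (A j - A i)"
    using detA by (simp add: mmul_diff)
  also have "norm \<dots> \<le> norm (A i) * norm (A j - A i)"
    using norm_mmul_le[of "madj (A i)"] by simp
  also have "\<dots> \<le> B * norm (A j - A i)"
    using A(2) by (intro mult_right_mono) auto
  also have "\<dots> < B * (\<delta> / B)"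
    using N[of "Suc N" N] B by (intro mult_strict_left_mono) (auto simp: dist_norm i_def j_def)
  also have "\<dots> = \<delta>"
    using B by simp
  finally have "moebius_map (mmul (madj (A i)) (A j)) = id"
    by (intro \<delta>(2) matrix_semigroupD(2)[OF T] adj A(1))
  then have "moebius_map (A i) \<circ> moebius_map (mmul (madj (A i)) (A j)) = moebius_map (A i)"
    by simp
  moreover have "moebius_map (A i) \<circ> moebius_map (mmul (madj (A i)) (A j)) =
      moebius_map (mmul (A i) (mmul (madj (A i)) (A j)))"
    using detA by (simp add: moebius_map_mmul del: mmul_madj_cancel)
  ultimately have "m j = m i"
    using detA A(3) by simp
  then show False
    using m(1) \<open>i \<noteq> j\<close> by (auto dest: injD)
qed

section \<open>Words in the generators\<close>

definition wprod :: "moebius list \<Rightarrow> moebius" where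
  "wprod ws = foldr (\<circ>) ws id"

lemma wprod_simps [simp]: "wprod [] = id" "wprod (x # ws) = x \<circ> wprod ws"
  by (simp_all add: wprod_def)

lemma wprod_append: "wprod (us @ vs) = wprod us \<circ> wprod vs"
  by (induction us) (simp_all add: comp_assoc)

lemma semigroup_generated_word:
  assumes "g \<in> semigroup_generated F"
  obtains ws where "ws \<noteq> []" "set ws \<subseteq> F" "wprod ws = g"
proof -
  have "\<exists>ws. ws \<noteq> [] \<and> set ws \<subseteq> F \<and> wprod ws = g"
    using assms
  proof induction
    case (generator f)
    then show ?case
      by (intro exI[of _ "[f]"]) simp
  next
    case (comp g h)
    then obtain us vs where "us \<noteq> []" "set us \<subseteq> F" "wprod us = g" "set vs \<subseteq> F" "wprod vs = h"
      by blast
    then show ?case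
      by (intro exI[of _ "us @ vs"]) (simp add: wprod_append)
  qed
  then show ?thesis
    using that by blast
qed

lemma wprod_in_carrier:
  assumes "set ws \<subseteq> carrier moebius_group"
  shows "wprod ws \<in> carrier moebius_group"
  using assms
proof (induction ws)
  case Nil
  show ?case
    unfolding wprod_simps by (rule moebius_map_in_carrier[OF mdet_mone, unfolded moebius_map_mone])
next
  case (Cons x ws)
  interpret group moebius_group
    by (rule group_moebius_group)
  have "x \<otimes>\<^bsub>moebius_group\<^esub> wprod ws \<in> carrier moebius_group"
    using Cons by (intro m_closed) auto
  moreover have "x \<otimes>\<^bsub>moebius_group\<^esub> wprod ws = wprod (x # ws)"
    by (simp add: moebius_group_def)
  ultimately show ?case
    by (simp only:)
qed

text \<open>
  The words \<open>w 0\<close>, \<open>w 1\<close>, \dots are read off letter by letter; the state records the index of the current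
  word and its unread part.
\<close>

lemma composition_sequence_of_words:
  fixes w :: "nat \<Rightarrow> moebius list" and Q :: "nat \<Rightarrow> moebius"
  assumes w: "\<And>n. w n \<noteq> []" "\<And>n. set (w n) \<subseteq> F"
    and Q: "Q 0 = wprod (w 0)" "\<And>n. Q (Suc n) = Q n \<circ> wprod (w (Suc n))"
  obtains X N where "composition_sequence F X" "filterlim N at_top sequentially"
    "\<And>k. \<exists>us vs. w (N k) = us @ vs \<and> X k \<circ> wprod vs = Q (N k)"
    "\<And>n. \<exists>k\<ge>n. X k = Q n"
proof -
  \<comment> \<open>The next word is loaded when only the letter being read is left, so the unread
    part is never empty and each step reads exactly one letter.\<close>
  define step where
    "step st = (if tl (snd st) = [] then (Suc (fst st), w (Suc (fst st))) else (fst st, tl (snd st)))"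
    for st :: "nat \<times> moebius list"
  define st where "st k = (step ^^ k) (0, w 0)" for k
  define N where "N k = fst (st k)" for k
  define l where "l k = snd (st k)" for k
  define f where "f k = hd (l k)" for k
  define X where "X = rec_nat (f 0) (\<lambda>n g. g \<circ> f (Suc n))"
  have X: "X 0 = f 0" "X (Suc k) = X k \<circ> f (Suc k)" for k
    by (simp_all add: X_def)
  have st0: "N 0 = 0" "l 0 = w 0"
    by (simp_all add: N_def l_def st_def)
  have st_Suc: "N (Suc k) = (if tl (l k) = [] then Suc (N k) else N k)"
    "l (Suc k) = (if tl (l k) = [] then w (Suc (N k)) else tl (l k))" for k
    by (simp_all add: N_def l_def st_def step_def)
  have suffix: "l k \<noteq> [] \<and> (\<exists>us. w (N k) = us @ l k)" for k
  proof (induction k)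
    case 0
    then show ?case
      using w by (simp add: st0)
  next
    case (Suc k)
    then obtain us where us: "w (N k) = us @ l k"
      by blast
    have "w (N k) = (us @ [hd (l k)]) @ tl (l k)"
      using Suc us by simp
    then show ?case
      using w by (auto simp: st_Suc)
  qed
  have hd_tl: "wprod (l k) = f k \<circ> wprod (tl (l k))" for k
    using suffix[of k] by (cases "l k") (simp_all add: f_def)
  \<comment> \<open>The letters still to come in the current word complete the partial product to
    the value at the end of that word.\<close>
  have inv: "X k \<circ> wprod (tl (l k)) = Q (N k)" for k
  proof (induction k)
    case 0
    then show ?case
      using hd_tl[of 0] by (simp add: X st0 Q)
  next
    case (Suc k)
    have "X (Suc k) \<circ> wprod (tl (l (Suc k))) = X k \<circ> wprod (l (Suc k))"
      by (simp add: X hd_tl comp_assoc)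
    also have "\<dots> = Q (N (Suc k))"
    proof (cases "tl (l k) = []")
      case True
      then show ?thesis
        using Suc by (simp add: st_Suc Q)
    next
      case False
      then show ?thesis
        using Suc by (simp only: st_Suc if_False)
    qed
    finally show ?case .
  qed
  have mono: "N i \<le> N j" if "i \<le> j" for i j
    using that by (rule lift_Suc_mono_le[rotated]) (simp add: st_Suc)
  \<comment> \<open>No step advances by more than one word, so the word with number \<open>n\<close>
    ends at an index of at least \<open>n\<close>.\<close>
  have N_le: "N k \<le> k" for k
    by (induction k) (simp_all add: st0 st_Suc)
  have finish: "\<exists>k'. N k' = N k \<and> tl (l k') = []" for k
  proof (induction "length (l k)" arbitrary: k rule: less_induct)
    case less
    show ?case
    proof (cases "tl (l k) = []")
      case False
      then have "length (l (Suc k)) < length (l k)" "N (Suc k) = N k"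
        using suffix[of k] by (auto simp: st_Suc)
      then show ?thesis
        using less by metis
    qed blast
  qed
  have surj: "\<exists>k. N k = n" for n
  proof (induction n)
    case 0
    then show ?case
      using st0 by blast
  next
    case (Suc n)
    then obtain k where "N k = n" "tl (l k) = []"
      using finish by metis
    then have "N (Suc k) = Suc n"
      by (simp add: st_Suc)
    then show ?case
      by blast
  qed
  show ?thesis
  proof (rule that)
    have "f k \<in> F" for k
    proof -
      have "f k \<in> set (w (N k))"
        using suffix[of k] by (metis UnCI f_def list.set_sel(1) set_append)
      then show ?thesis
        using w(2) by blast
    qed
    then show "composition_sequence F X"
      unfolding composition_sequence_def using X by blast
    show "filterlim N at_top sequentially"
      unfolding filterlim_at_top eventually_sequentially using surj mono by metis
    show "\<exists>us vs. w (N k) = us @ vs \<and> X k \<circ> wprod vs = Q (N k)" for k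
    proof -
      obtain us where "w (N k) = us @ l k"
        using suffix by blast
      then have "w (N k) = (us @ [hd (l k)]) @ tl (l k)"
        using suffix[of k] by simp
      then show ?thesis
        using inv by blast
    qed
    show "\<exists>k\<ge>n. X k = Q n" for n
    proof -
      obtain k where k: "N k = n" "tl (l k) = []"
        using surj finish by metis
      then have "X k = Q n"
        using inv[of k] by simp
      then show ?thesis
        using N_le[of k] k by blast
    qed
  qed
qed

section \<open>The oscillating path\<close>

lemma abs_sin_diff_le: "\<bar>sin x - sin y\<bar> \<le> \<bar>x - y :: real\<bar>"
proof -
  have "\<bar>sin x - sin y\<bar> = 2 * \<bar>sin ((x - y) / 2)\<bar> * \<bar>cos ((x + y) / 2)\<bar>"
    by (simp add: sin_diff_sin abs_mult)
  also have "\<dots> \<le> 2 * \<bar>(x - y) / 2\<bar> * 1"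
    by (intro mult_mono abs_sin_x_le_abs_x) auto
  finally show ?thesis
    by simp
qed

lemma ln_add_one_diff_le:
  assumes "x > 0" "0 \<le> d"
  shows "ln (x + d) - ln x \<le> d / (x :: real)"
proof -
  have "ln (x + d) - ln x = ln ((x + d) / x)"
    using assms by (simp add: ln_div)
  also have "\<dots> = ln (1 + d / x)"
    using assms by (simp add: add_divide_distrib)
  also have "\<dots> \<le> d / x"
    using assms by (intro ln_add_one_self_le_self) simp
  finally show ?thesis .
qed

text \<open>Along the integer parts of \<open>exp (2 * pi * real k + c)\<close> the values tend to
  \<open>sin c\<close>. As \<open>c\<close> is arbitrary, a limit would equal both
  \<open>sin 0\<close> and \<open>sin (pi / 2)\<close>.\<close>

lemma sin_ln_not_tendsto: "\<not> (\<lambda>n. sin (ln (real n + 1))) \<longlonglongrightarrow> L"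
proof
  assume L: "(\<lambda>n. sin (ln (real n + 1))) \<longlonglongrightarrow> L"
  have "L = sin c" for c
  proof -
    define e where "e k = exp (2 * pi * real k + c)" for k :: nat
    define a where "a k = nat \<lfloor>e k\<rfloor>" for k
    have e: "e k > 0" for k
      by (simp add: e_def)
    have a: "e k \<le> real (a k) + 1" "real (a k) \<le> e k" for k
      using e[of k] unfolding a_def by linarith+
    have lim_e: "filterlim e at_top sequentially"
      unfolding e_def
      by (subst add.commute, intro filterlim_compose[OF exp_at_top]
          filterlim_tendsto_add_at_top[OF tendsto_const]
          filterlim_tendsto_pos_mult_at_top[OF tendsto_const] filterlim_real_sequentially) simp
    have "filterlim a at_top sequentially"
    proof (rule filterlim_at_top_mono[of "\<lambda>k. nat \<lfloor>e k\<rfloor>"])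
      show "filterlim (\<lambda>k. nat \<lfloor>e k\<rfloor>) at_top sequentially"
        by (intro filterlim_compose[OF filterlim_nat_sequentially]
            filterlim_compose[OF filterlim_floor_sequentially] lim_e)
    qed (simp add: a_def)
    then have "(\<lambda>k. sin (ln (real (a k) + 1))) \<longlonglongrightarrow> L"
      by (rule filterlim_compose[OF L])
    moreover have "(\<lambda>k. sin (ln (real (a k) + 1))) \<longlonglongrightarrow> sin c"
    proof -
      have "\<bar>sin (ln (real (a k) + 1)) - sin c\<bar> \<le> 1 / e k" for k
      proof -
        have "sin c = sin (2 * pi * real k + c)"
        proof -
          have "2 * pi * real k = 2 * real k * pi"
            by simp
          then show ?thesis
            unfolding sin_add by (simp only: sin_2npi cos_2npi)
        qed
        also have "\<dots> = sin (ln (e k))"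
          by (simp add: e_def)
        finally have "\<bar>sin (ln (real (a k) + 1)) - sin c\<bar> \<le> \<bar>ln (real (a k) + 1) - ln (e k)\<bar>"
          by (simp add: abs_sin_diff_le)
        also have "\<dots> = ln (real (a k) + 1) - ln (e k)"
          using a(1)[of k] e[of k] by simp
        also have "\<dots> \<le> ln (e k + 1) - ln (e k)"
          using a(2)[of k] by simp
        also have "\<dots> \<le> 1 / e k"
          using e by (intro ln_add_one_diff_le) auto
        finally show ?thesis .
      qed
      note bound = this
      have lim: "(\<lambda>k. 1 / e k) \<longlonglongrightarrow> 0"
        using lim_e by (simp add: tendsto_inverse_0_at_top flip: inverse_eq_divide)
      have "(\<lambda>k. sin (ln (real (a k) + 1)) - sin c) \<longlonglongrightarrow> 0"
        by (rule Lim_null_comparison[OF _ lim]) (simp add: bound)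
      then show ?thesis
        by (simp add: LIM_zero_iff)
    qed
    ultimately show ?thesis
      by (rule LIMSEQ_unique)
  qed
  from this[of 0] this[of "pi / 2"] show False
    by simp
qed

text \<open>
  A path that approaches the real line and oscillates along it, in steps of bounded hyperbolic length.
\<close>

definition spath :: "nat \<Rightarrow> mat2" where
  "spath n = hmat (sin (ln (real n + 1))) (1 / (real n + 1))"

lemma mdet_spath [simp]: "mdet (spath n) = 1"
  by (simp add: spath_def)

lemma norm_hmat:
  assumes "y > 0"
  shows "(norm (hmat x y))\<^sup>2 = (1 + x\<^sup>2 + y\<^sup>2) / y"
  unfolding hmat_def norm_mat2 using assms
  by (simp add: power_divide add_divide_distrib power2_eq_square)

lemma norm_spath_ge: "real n + 1 \<le> (norm (spath n))\<^sup>2"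
proof -
  have "(norm (spath n))\<^sup>2 = (1 + (sin (ln (real n + 1)))\<^sup>2 + (1 / (real n + 1))\<^sup>2) * (real n + 1)"
    unfolding spath_def by (subst norm_hmat) auto
  moreover have "1 * (real n + 1) \<le> \<dots>"
    by (intro mult_right_mono) auto
  ultimately show ?thesis
    by simp
qed

text \<open>At height \<open>1 / N\<close> a horizontal move by \<open>x' - x\<close> has hyperbolic
  size about \<open>N * \<bar>x' - x\<bar>\<close>, and \<open>sin (ln N)\<close> changes by at most
  \<open>1 / N\<close> in one step. The nonzero entries contribute at most 1, 2 and 2 to the squared
  norm, and 5 is less than \<open>3\<^sup>2\<close>.\<close>

lemma norm_spath_step: "norm (mmul (madj (spath n)) (spath (Suc n))) \<le> 3"
proof (rule power2_le_imp_le)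
  define N where "N = real n + 1"
  define x where "x = sin (ln N)"
  define x' where "x' = sin (ln (N + 1))"
  have N: "N \<ge> 1"
    by (simp add: N_def)
  define a where "a = sqrt N"
  define b where "b = sqrt (N + 1)"
  have ab: "a > 0" "b > 0" "a\<^sup>2 = N" "b\<^sup>2 = N + 1"
    using N by (simp_all add: a_def b_def)
  have "spath n = (1 / a, x * a, 0, a)" "spath (Suc n) = (1 / b, x' * b, 0, b)"
    unfolding spath_def hmat_def
    by (simp_all add: x_def x'_def a_def b_def N_def real_sqrt_divide add.commute)
  then have "mmul (madj (spath n)) (spath (Suc n)) = (a / b, (x' - x) * (a * b), 0, b / a)"
    by (simp add: algebra_simps)
  then have "(norm (mmul (madj (spath n)) (spath (Suc n))))\<^sup>2 =
      N / (N + 1) + (x' - x)\<^sup>2 * (N * (N + 1)) + (N + 1) / N"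
    by (simp add: norm_mat2 power_mult_distrib power_divide ab)
  moreover have "N / (N + 1) \<le> 1" "(N + 1) / N \<le> 2"
    using N by (simp_all add: field_simps)
  moreover have "(x' - x)\<^sup>2 * (N * (N + 1)) \<le> 2"
  proof -
    have "\<bar>x' - x\<bar> \<le> \<bar>ln (N + 1) - ln N\<bar>"
      unfolding x_def x'_def by (rule abs_sin_diff_le)
    also have "\<dots> \<le> 1 / N"
      using N ln_add_one_diff_le[of N 1] by simp
    finally have "\<bar>x' - x\<bar>\<^sup>2 \<le> (1 / N)\<^sup>2"
      by (intro power_mono) auto
    then have "(x' - x)\<^sup>2 * (N * (N + 1)) \<le> (1 / N)\<^sup>2 * (N * (N + 1))"
      using N by (intro mult_right_mono) auto
    also have "\<dots> = (N + 1) / N"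
      using N by (simp add: power2_eq_square)
    also have "\<dots> \<le> 2"
      using N by (simp add: field_simps)
    finally show ?thesis .
  qed
  ultimately show "(norm (mmul (madj (spath n)) (spath (Suc n))))\<^sup>2 \<le> 3\<^sup>2"
    by simp
qed simp

text \<open>The ideal point of \<open>v = (s, t)\<close> could be a limit only if the real parts of
  the path converged to \<open>s / t\<close>. For \<open>t = 0\<close> this point is infinity, which
  the bounded path does not approach.\<close>

lemma spath_not_tendsto:
  assumes "v \<noteq> 0"
  shows "\<not> (\<lambda>n. norm (mapp (madj (spath n)) v) / norm (spath n)) \<longlonglongrightarrow> 0"
proof
  assume lim: "(\<lambda>n. norm (mapp (madj (spath n)) v) / norm (spath n)) \<longlonglongrightarrow> 0"
  obtain s t where v: "v = (s, t)"
    by (metis surj_pair)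
  define x where "x n = sin (ln (real n + 1))" for n
  \<comment> \<open>The factor 2 is the square root of 4, a bound for
    \<open>(norm (spath n))\<^sup>2 * y = 1 + (x n)\<^sup>2 + y\<^sup>2\<close>.\<close>
  have bound: "\<bar>s - x n * t\<bar> \<le> 2 * (norm (mapp (madj (spath n)) v) / norm (spath n))" for n
  proof (rule power2_le_imp_le)
    define y where "y = 1 / (real n + 1)"
    have y: "0 < y" "y \<le> 1"
      by (simp_all add: y_def)
    have hm: "spath n = hmat (x n) y"
      by (simp add: spath_def x_def y_def)
    have "mapp (madj (hmat (x n) y)) v = ((s - x n * t) / sqrt y, sqrt y * t)"
      using y by (simp add: hmat_def v field_simps)
    then have "(norm (mapp (madj (spath n)) v))\<^sup>2 = (s - x n * t)\<^sup>2 / y + y * t\<^sup>2"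
      using y by (simp add: hm norm_pair2 power_divide power_mult_distrib)
    then have "(s - x n * t)\<^sup>2 / y \<le> (norm (mapp (madj (spath n)) v))\<^sup>2"
      using y by simp
    then have le: "(s - x n * t)\<^sup>2 \<le> (norm (mapp (madj (spath n)) v))\<^sup>2 * y"
      using y by (simp add: pos_divide_le_eq)
    have "(norm (spath n))\<^sup>2 * y = 1 + (x n)\<^sup>2 + y\<^sup>2"
      using y by (simp add: hm norm_hmat)
    also have "\<dots> \<le> 1 + 1 + 1"
      using y by (intro add_mono) (simp_all add: x_def abs_square_le_1 power_le_one)
    finally have "(norm (spath n))\<^sup>2 * y \<le> 4"
      by simp
    then have "(s - x n * t)\<^sup>2 * ((norm (spath n))\<^sup>2 * y) \<le> (norm (mapp (madj (spath n)) v))\<^sup>2 * y * 4"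
      using y by (intro mult_mono le) auto
    then have "(s - x n * t)\<^sup>2 * (norm (spath n))\<^sup>2 \<le> 4 * (norm (mapp (madj (spath n)) v))\<^sup>2"
      using y by (simp add: mult_ac)
    moreover have "(norm (spath n))\<^sup>2 > 0"
      using norm_spath_ge[of n] by linarith
    ultimately have "(s - x n * t)\<^sup>2 \<le> 4 * (norm (mapp (madj (spath n)) v))\<^sup>2 / (norm (spath n))\<^sup>2"
      by (simp only: pos_le_divide_eq)
    then show "\<bar>s - x n * t\<bar>\<^sup>2 \<le> (2 * (norm (mapp (madj (spath n)) v) / norm (spath n)))\<^sup>2"
      by (simp add: power_mult_distrib power_divide)
  qed simp
  have "(\<lambda>n. s - x n * t) \<longlonglongrightarrow> 0"
    using bound by (intro Lim_null_comparison[OF _ tendsto_mult_right_zero[OF lim, of 2]]) auto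
  then have xt: "(\<lambda>n. x n * t) \<longlonglongrightarrow> s"
    using tendsto_diff[OF tendsto_const[of s]] by fastforce
  show False
  proof (cases "t = 0")
    case True
    then have "s = 0"
      using xt by (simp add: LIMSEQ_const_iff)
    then show False
      using True assms v by (simp add: zero_prod_def)
  next
    case False
    have "(\<lambda>n. x n * t / t) \<longlonglongrightarrow> s / t"
      using xt False by (intro tendsto_divide) auto
    then show False
      using sin_ln_not_tendsto False by (simp add: x_def)
  qed
qed

section \<open>A divergent sequence in a cocompact group\<close>

text \<open>The orbit points \<open>s n \<i>\<close> shadow the path. Their increments
  \<open>t n\<close> have bounded norm, so they realise only finitely many maps, each of which gets
  a fixed word. Partial products inside a word differ from the value at its end by one of finitely
  many suffixes; therefore the whole sequence escapes, while its values at the ends of words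
  oscillate like the path.\<close>

lemma divergent_composition_sequence_if_cocompact:
  assumes F: "F \<subseteq> carrier moebius_group"
    and S: "S = semigroup_generated F" "semidiscrete S" "cocompact_fuchsian_group S"
  obtains X where "composition_sequence F X" "escaping_sequence X" "\<not> converges_ideally X"
proof -
  have "subgroup S moebius_group"
    using S(3) by (simp add: cocompact_fuchsian_group_def fuchsian_group_def)
  note gr = group_lifts_if_subgroup[OF this]
  note T = matrix_semigroup_lifts[OF gr(1)]
  obtain R where R: "R > 0" "\<And>h. mdet h = 1 \<Longrightarrow> \<exists>A\<in>lifts S. norm (mmul (madj A) h) \<le> R"
    using coarsely_dense_if_cocompact[OF S(3)] unfolding coarsely_dense_def by blast
  have "\<exists>A. A \<in> lifts S \<and> norm (mmul (madj A) (spath n)) \<le> R" for n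
    using R(2)[OF mdet_spath] by blast
  then obtain s where s: "\<And>n. s n \<in> lifts S" "\<And>n. norm (mmul (madj (s n)) (spath n)) \<le> R"
    by metis
  have dets: "mdet (s n) = 1" for n
    using s(1) by (simp add: lifts_iff)
  define t where "t n = mmul (madj (s n)) (s (Suc n))" for n
  have t: "t n \<in> lifts S" for n
    unfolding t_def by (intro matrix_semigroupD(2)[OF T] gr(3) s(1))
  have norm_t: "norm (t n) \<le> R * (3 * R)" for n
  proof -
    \<comment> \<open>From \<open>s n\<close> to the path, one step along the path, and back to
      \<open>s (Suc n)\<close>: these three factors give \<open>R * (3 * R)\<close>.\<close>
    have "t n = mmul (mmul (madj (s n)) (spath n)) (mmul (mmul (madj (spath n)) (spath (Suc n)))
        (madj (mmul (madj (s (Suc n))) (spath (Suc n)))))"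
      using dets by (simp add: t_def madj_mmul mmul_assoc)
    also have "norm \<dots> \<le> norm (mmul (madj (s n)) (spath n)) *
        (norm (mmul (madj (spath n)) (spath (Suc n))) *
          norm (madj (mmul (madj (s (Suc n))) (spath (Suc n)))))"
      by (intro order.trans[OF norm_mmul_le] mult_left_mono norm_mmul_le norm_ge_zero)
    also have "\<dots> \<le> R * (3 * R)"
      using s(2) R(1) norm_spath_step by (intro mult_mono) auto
    finally show ?thesis .
  qed
  have "finite (moebius_map ` {A \<in> lifts S. norm A \<le> R * (3 * R)})"
    using gr(1) S(2) gr(3) by (rule finite_bounded_lifts)
  then have fin: "finite (range (\<lambda>n. moebius_map (t n)))"
    by (rule rev_finite_subset) (use t norm_t in blast)
  have "\<exists>ws. ws \<noteq> [] \<and> set ws \<subseteq> F \<and> wprod ws = g" if "g \<in> S" for g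
    using semigroup_generated_word that S(1) by metis
  \<comment> \<open>The word depends on the map only, so finitely many increments yield finitely
    many words.\<close>
  then obtain wd where wd: "\<And>g. g \<in> S \<Longrightarrow> wd g \<noteq> []" "\<And>g. g \<in> S \<Longrightarrow> set (wd g) \<subseteq> F"
    "\<And>g. g \<in> S \<Longrightarrow> wprod (wd g) = g"
    by metis
  \<comment> \<open>The indices are shifted: word 0 spells \<open>s 0\<close>, and word
    \<open>Suc n\<close> spells the increment from \<open>s n\<close> to
    \<open>s (Suc n)\<close>.\<close>
  define \<tau> where "\<tau> n = (case n of 0 \<Rightarrow> moebius_map (s 0) | Suc m \<Rightarrow> moebius_map (t m))" for n
  define w where "w n = wd (\<tau> n)" for n
  have \<tau>: "\<tau> n \<in> S" for n
    using s(1) t by (cases n) (auto simp: \<tau>_def lifts_iff)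
  have w: "w n \<noteq> []" "set (w n) \<subseteq> F" "wprod (w n) = \<tau> n" for n
    using wd \<tau> by (simp_all add: w_def)
  have "range \<tau> \<subseteq> insert (moebius_map (s 0)) (range (\<lambda>n. moebius_map (t n)))"
    by (auto simp: \<tau>_def split: nat.split)
  then have fin_w: "finite (range w)"
    using fin by (auto simp: w_def intro: finite_subset simp flip: image_image[of wd \<tau>])
  define Y where "Y = {wprod vs |us vs n. w n = us @ vs}"
  have "Y \<subseteq> (\<Union>ws\<in>range w. (\<lambda>k. wprod (drop k ws)) ` {..length ws})"
  proof
    fix y
    assume "y \<in> Y"
    then obtain us vs n where "y = wprod vs" "w n = us @ vs"
      by (auto simp: Y_def)
    then have "y = wprod (drop (length us) (w n))" "length us \<le> length (w n)"
      by simp_all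
    then show "y \<in> (\<Union>ws\<in>range w. (\<lambda>k. wprod (drop k ws)) ` {..length ws})"
      by blast
  qed
  then have "finite Y"
    by (rule finite_subset) (intro finite_UN_I fin_w finite_imageI finite_atMost)
  have "\<exists>D. mdet D = 1 \<and> y = moebius_map D" if "y \<in> Y" for y
  proof -
    obtain us vs n where "y = wprod vs" "w n = us @ vs"
      using \<open>y \<in> Y\<close> by (auto simp: Y_def)
    then have "y \<in> carrier moebius_group"
      using w(2)[of n] F by (auto intro!: wprod_in_carrier)
    then show ?thesis
      by (meson carrier_moebius_group_cases)
  qed
  then obtain D where D: "\<And>y. y \<in> Y \<Longrightarrow> mdet (D y) = 1" "\<And>y. y \<in> Y \<Longrightarrow> y = moebius_map (D y)"
    by metis
  obtain M where M: "M > 0" "\<And>y. y \<in> Y \<Longrightarrow> norm (D y) \<le> M"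
    using finite_imp_bounded[OF finite_imageI[OF \<open>finite Y\<close>], of D] by (auto simp: bounded_pos)
  define Q where "Q n = moebius_map (s n)" for n
  have Q: "Q 0 = wprod (w 0)" "Q (Suc n) = Q n \<circ> wprod (w (Suc n))" for n
  proof -
    show "Q 0 = wprod (w 0)"
      by (simp add: Q_def w(3) \<tau>_def)
    have "Q n \<circ> wprod (w (Suc n)) = moebius_map (mmul (s n) (t n))"
      using dets t by (simp add: Q_def w(3) \<tau>_def moebius_map_mmul lifts_iff)
    then show "Q (Suc n) = Q n \<circ> wprod (w (Suc n))"
      using dets by (simp add: Q_def t_def)
  qed
  obtain X N where X: "composition_sequence F X" "filterlim N at_top sequentially"
    "\<And>k. \<exists>us vs. w (N k) = us @ vs \<and> X k \<circ> wprod vs = Q (N k)"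
    "\<And>n. \<exists>k\<ge>n. X k = Q n"
    using composition_sequence_of_words[OF w(1,2) Q] by blast
  show ?thesis
  proof (rule that[OF X(1)])
    have "\<exists>P. mdet P = 1 \<and> X k = moebius_map P \<and> norm (s (N k)) / M \<le> norm P" for k
    proof -
      obtain us vs where uv: "w (N k) = us @ vs" "X k \<circ> wprod vs = Q (N k)"
        using X(3) by blast
      define y where "y = wprod vs"
      have y: "y \<in> Y"
        using uv(1) by (auto simp: Y_def y_def)
      \<comment> \<open>A lift of \<open>X k\<close>, obtained from the end of the current word by
        cancelling the unread suffix \<open>y\<close> on the right.\<close>
      define P where "P = mmul (s (N k)) (madj (D y))"
      have P: "mdet P = 1"
        using dets D(1)[OF y] by (simp add: P_def)
      have "X k = X k \<circ> (moebius_map (D y) \<circ> moebius_map (madj (D y)))"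
        using D(1)[OF y] by simp
      also have "\<dots> = (X k \<circ> y) \<circ> moebius_map (madj (D y))"
        unfolding comp_assoc using D(2)[OF y] by simp
      also have "\<dots> = moebius_map P"
        using uv(2) dets D(1)[OF y] by (simp add: y_def Q_def P_def moebius_map_mmul)
      finally have "X k = moebius_map P" .
      moreover have "norm (s (N k)) / M \<le> norm P"
      proof -
        have "s (N k) = mmul P (D y)"
          using D(1)[OF y] by (simp add: P_def mmul_assoc)
        then have "norm (s (N k)) \<le> norm P * norm (D y)"
          using norm_mmul_le by metis
        also have "\<dots> \<le> norm P * M"
          using M(2)[OF y] by (intro mult_left_mono) auto
        finally show ?thesis
          using M(1) by (simp add: pos_divide_le_eq)
      qed
      ultimately show ?thesis
        using P by blast
    qed
    then obtain P where P: "\<And>k. mdet (P k) = 1" "\<And>k. X k = moebius_map (P k)"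
      "\<And>k. norm (s (N k)) / M \<le> norm (P k)"
      by metis
    have norm_s: "sqrt (real n) / R \<le> norm (s n)" for n
    proof -
      have "sqrt (real n) \<le> norm (spath n)"
        using norm_spath_ge[of n] by (intro real_le_lsqrt) auto
      also have "\<dots> = norm (mmul (s n) (mmul (madj (s n)) (spath n)))"
        using dets by simp
      also have "\<dots> \<le> norm (s n) * norm (mmul (madj (s n)) (spath n))"
        by (rule norm_mmul_le)
      also have "\<dots> \<le> norm (s n) * R"
        using s(2) by (intro mult_left_mono) auto
      finally show ?thesis
        using R(1) by (simp add: pos_divide_le_eq)
    qed
    have "filterlim (\<lambda>k. norm (P k)) at_top sequentially"
    proof (rule filterlim_at_top_mono)
      have "filterlim (\<lambda>k. 1 / (R * M) * sqrt (real (N k))) at_top sequentially"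
        using R(1) M(1)
        by (intro filterlim_tendsto_pos_mult_at_top[OF tendsto_const]
            filterlim_compose[OF sqrt_at_top] filterlim_compose[OF filterlim_real_sequentially X(2)]) simp
      then show "filterlim (\<lambda>k. sqrt (real (N k)) / R / M) at_top sequentially"
        by simp
      show "\<forall>\<^sub>F k in sequentially. sqrt (real (N k)) / R / M \<le> norm (P k)"
      proof (intro always_eventually allI)
        fix k
        have "sqrt (real (N k)) / R / M \<le> norm (s (N k)) / M"
          using norm_s M(1) by (intro divide_right_mono) auto
        then show "sqrt (real (N k)) / R / M \<le> norm (P k)"
          using P(3)[of k] by linarith
      qed
    qed
    then have "escaping_sequence (\<lambda>k. moebius_map (P k))"
      by (intro escaping_if_norm_tendsto_infinity P(1))
    then show "escaping_sequence X"
      by (simp flip: P(2))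
    show "\<not> converges_ideally X"
    proof
      assume "converges_ideally X"
      then obtain p z where pz: "p \<in> ideal_boundary" "z \<in> upper_half_plane"
        "(\<lambda>k. chordal (X k z) p) \<longlonglongrightarrow> 0"
        by (auto simp: converges_ideally_def limitin_sphere_topology)
      obtain \<kappa> where \<kappa>: "\<And>n. \<kappa> n \<ge> n" "\<And>n. X (\<kappa> n) = Q n"
        using X(4) by metis
      have "filterlim \<kappa> at_top sequentially"
        by (rule filterlim_at_top_mono[OF filterlim_ident]) (use \<kappa>(1) in auto)
      from filterlim_compose[OF pz(3) this]
      have "(\<lambda>n. chordal (moebius_map (s n) z) p) \<longlonglongrightarrow> 0"
        by (simp add: \<kappa>(2) Q_def)
      then have "converges_ideally (\<lambda>n. moebius_map (s n))"
        using pz(1,2) by (auto simp: converges_ideally_def limitin_sphere_topology)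
      then obtain v where v: "v \<noteq> 0" "(\<lambda>n. norm (mapp (madj (s n)) v) / norm (s n)) \<longlonglongrightarrow> 0"
        unfolding converges_ideally_iff[of s, OF dets] by blast
      have "norm (norm (mapp (madj (spath n)) v) / norm (spath n)) \<le>
          R\<^sup>2 * (norm (mapp (madj (s n)) v) / norm (s n))" for n
      proof -
        \<comment> \<open>The bounded discrepancy between the path and its shadow. It transfers
          ideal convergence from \<open>s\<close> to \<open>spath\<close> at the cost of a factor
          \<open>R\<^sup>2\<close>.\<close>
        define e where "e = mmul (madj (s n)) (spath n)"
        have se: "spath n = mmul (s n) e" "s n = mmul (spath n) (madj e)"
          using dets by (simp_all add: e_def madj_mmul)
        have e: "norm e \<le> R"
          using s(2) by (simp add: e_def)
        have "norm (mapp (madj (spath n)) v) \<le> norm e * norm (mapp (madj (s n)) v)"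
          unfolding se(1) madj_mmul mapp_mmul using norm_mapp_le[of "madj e"] by simp
        also have "\<dots> \<le> R * norm (mapp (madj (s n)) v)"
          using e by (intro mult_right_mono) auto
        finally have 1: "norm (mapp (madj (spath n)) v) \<le> R * norm (mapp (madj (s n)) v)" .
        have "norm (s n) \<le> norm (spath n) * norm e"
          using norm_mmul_le[of "spath n" "madj e"] se(2) by simp
        also have "\<dots> \<le> norm (spath n) * R"
          using e by (intro mult_left_mono) auto
        finally have 2: "norm (s n) \<le> norm (spath n) * R" .
        have pos: "norm (s n) > 0" "norm (spath n) > 0"
          by (intro norm_mat2_pos dets mdet_spath)+
        have "1 / norm (spath n) \<le> R / norm (s n)"
          using 2 pos unfolding pos_divide_le_eq[OF pos(2)] times_divide_eq_left pos_le_divide_eq[OF pos(1)]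
          by (simp add: mult.commute)
        then have "norm (mapp (madj (spath n)) v) * (1 / norm (spath n)) \<le>
            (R * norm (mapp (madj (s n)) v)) * (R / norm (s n))"
          using 1 R(1) by (intro mult_mono) auto
        then show ?thesis
          by (simp add: power2_eq_square mult_ac)
      qed
      then have "(\<lambda>n. norm (mapp (madj (spath n)) v) / norm (spath n)) \<longlonglongrightarrow> 0"
        by (intro Lim_null_comparison[OF _ tendsto_mult_right_zero[OF v(2), of "R\<^sup>2"]]) simp
      then show False
        using spath_not_tendsto[OF v(1)] by blast
    qed
  qed
qed

theorem theorem11p3:
  fixes F S :: "moebius set"
  assumes "F \<subseteq> carrier moebius_group" and "finite F"
    and "S = semigroup_generated F"
    and "moebius_semigroup S" and "semidiscrete S"
    and "card (backward_limit_set S) \<noteq> 1"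
  shows "(\<forall>X. composition_sequence F X \<and> escaping_sequence X \<longrightarrow> converges_ideally X)
         \<longleftrightarrow> \<not> cocompact_fuchsian_group S"
proof
  assume "\<forall>X. composition_sequence F X \<and> escaping_sequence X \<longrightarrow> converges_ideally X"
  then show "\<not> cocompact_fuchsian_group S"
    using divergent_composition_sequence_if_cocompact[OF assms(1,3,5)] by blast
next
  assume "\<not> cocompact_fuchsian_group S"
  then show "\<forall>X. composition_sequence F X \<and> escaping_sequence X \<longrightarrow> converges_ideally X"
    using cocompact_if_divergent_composition_sequence[OF assms] by blast
qed

end
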